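(* There is an absolute constant $C>0$ such that the following holds. Let $H$ be a $k$-vertex graph with no isolated vertices and maximum degree $\Delta$, and let $n\ge 2^{C\Delta\log^2\Delta}k$ be an integer. Then there exists a red/blue colouring of the edges of the complete graph on $r(nH)-1$ vertices with no monochromatic copy of $nH$, together with a partition of its vertex set into sets $R$, $B$, $E$ such that: (i) $|E| \leq r(H)$ and $|R|, |B| \geq k(|E|+1)$; (ii) all edges inside $R$ are red and all edges inside $B$ are blue; (iii) all edges between $R$ and $B$ have the same colour, all edges between $R$ and $E$ are blue, and all edges between $B$ and $E$ are red; (iv) there is no $H$-tie containing a vertex of $E$.
   Context: Logarithms are base 2. $nH$ is the disjoint union of $n$ copies of $H$; $r(F)$ is the least $N$ such that every 2-colouring of $K_N$ contains a monochromatic $F$. In a red/blue coloured complete graph, an $H$-tie is a set $T$ of $2k-\alpha(H)$ vertices whose induced coloured graph contains both a red copy and a blue copy of $H$, where $\alpha(H)$ is the independence number of $H$.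
   Formalization: For Δ = 1 the factor log Δ is read as log 2, so the hypothesis is n ≥ 2^C k instead of n ≥ k; with log 1 = 0 the claim fails for H = K_2, n = 2. For Δ ≥ 2 nothing is changed. *)

theory Defs
  imports Complex_Main "HOL-Library.Ramsey"
begin

record 'a ugraph =
  verts :: "'a set"
  edges :: "'a set set"

(* The set nsets A 2 consists of the two-element subsets of A. *)
definition simple_graph :: "'a ugraph \<Rightarrow> bool" where
  "simple_graph H \<longleftrightarrow> finite (verts H) \<and> edges H \<subseteq> nsets (verts H) 2"

definition degree :: "'a ugraph \<Rightarrow> 'a \<Rightarrow> nat" where
  "degree H v = card {e \<in> edges H. v \<in> e}"

definition max_degree :: "'a ugraph \<Rightarrow> nat" where
  "max_degree H = Max (degree H ` verts H)"

definition no_isolated :: "'a ugraph \<Rightarrow> bool" where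
  "no_isolated H \<longleftrightarrow> (\<forall>v\<in>verts H. \<exists>e\<in>edges H. v \<in> e)"

definition independent :: "'a ugraph \<Rightarrow> 'a set \<Rightarrow> bool" where
  "independent H I \<longleftrightarrow> I \<subseteq> verts H \<and> (\<forall>e\<in>edges H. \<not> e \<subseteq> I)"

definition independence_number :: "'a ugraph \<Rightarrow> nat" where
  "independence_number H = Max (card ` {I. independent H I})"

definition copies :: "nat \<Rightarrow> 'a ugraph \<Rightarrow> ('a \<times> nat) ugraph" where
  "copies n H = \<lparr> verts = verts H \<times> {..<n},
                  edges = {e \<times> {i} | e i. e \<in> edges H \<and> i < n} \<rparr>"

datatype colour = Red | Blue

(* An edge colouring of the complete graph on a vertex set S is any function
   on sets; only its values on the two-element subsets of S are ever used.
   A copy is a not necessarily induced subgraph. *)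
definition has_copy :: "('b set \<Rightarrow> colour) \<Rightarrow> 'b set \<Rightarrow> colour \<Rightarrow> 'a ugraph \<Rightarrow> bool" where
  "has_copy c S x F \<longleftrightarrow>
     (\<exists>f. inj_on f (verts F) \<and> f ` verts F \<subseteq> S \<and> (\<forall>e\<in>edges F. c (f ` e) = x))"

definition has_mono_copy :: "('b set \<Rightarrow> colour) \<Rightarrow> 'b set \<Rightarrow> 'a ugraph \<Rightarrow> bool" where
  "has_mono_copy c S F \<longleftrightarrow> (\<exists>x. has_copy c S x F)"

definition ramsey_number :: "'a ugraph \<Rightarrow> nat" where
  "ramsey_number F = (LEAST N. \<forall>c :: nat set \<Rightarrow> colour. has_mono_copy c {..<N} F)"

definition is_tie :: "('b set \<Rightarrow> colour) \<Rightarrow> 'b set \<Rightarrow> 'a ugraph \<Rightarrow> 'b set \<Rightarrow> bool" where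
  "is_tie c S H T \<longleftrightarrow> T \<subseteq> S \<and> finite T
     \<and> card T = 2 * card (verts H) - independence_number H
     \<and> has_copy c T Red H \<and> has_copy c T Blue H"

(* The factor log \<Delta> in a bound 2 ^ (C \<Delta> (log \<Delta>)^2) is read as log 2 for \<Delta> = 1.
   With log 1 = 0 the constant C would have no effect on perfect matchings, and
   the structure result is then false: take two copies of a single edge. *)
definition log_degree :: "nat \<Rightarrow> real" where
  "log_degree \<Delta> = log 2 (real (max 2 \<Delta>))"

end

(* Write k, Delta, alpha for the order, the maximum degree and the independence number of H, and r(F)
   for the Ramsey number of F. A tie has 2k - alpha vertices and serves one copy of H in each colour.

   A large set without a blue H contains a large set that is almost completely red: a blue H could be
   embedded greedily unless some two large sets have few blue edges between them, and iterating this
   log Delta times gives the exponent Delta (log Delta)^2. Two such sets, one for each colour,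
   contain a tie, so a colouring without ties is exhausted, up to a bounded number of vertices, by
   disjoint copies of H of one colour. Counting with r(nH) > (2k - alpha) n - 2 then shows that a
   critical colouring contains an almost red set R and an almost blue set B with almost all edges
   between them of one colour (a vertex violating the latter lies in two ties that meet only in that
   vertex, which saves a vertex). Removing ties outside R and B, and then ties through vertices that
   are not joined to R in blue and to B in red, leaves R, B and a bounded set E.

   Now R and B are replaced by larger true cliques, adding k vertices to R and k - alpha vertices to B
   for each removed tie. A monochromatic nH in the new colouring would have at most |E| copies meeting E,
   and after deleting one other copy for each removed tie the rest could be embedded in the old
   colouring, by the Sauer-Spencer argument. In the same way a tie through E is traded for k + (k - alpha)
   clique vertices until no tie meets E. Then |E| < r(H), because a monochromatic H in E gives a tie
   when its independent set is moved to the clique of the other colour. *)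

theory Submission
  imports Defs "HOL-Combinatorics.Transposition"
begin

section \<open>Embedding lemmas\<close>

text \<open>A tie has k + (k - \<alpha>) vertices, the price of one more copy in each colour when
  the colouring consists of two cliques. So removing a tie and lowering n by one keeps |V| - (2k -
  \<alpha>) n, and a critical colouring has almost the largest possible value of this quantity. The
  exchanges bring in vertices from outside V; only cardinalities survive, and the vertices are
  renamed at the end. The main obstacle is that nothing is known about the edges between an almost
  x-coloured set R and an almost y-coloured set B. Either most vertices of B keep enough
  y-neighbours in every subset of R that the greedy embedding meets, or some subpair is almost
  completely of colour x and the two colours trade roles. Hence the colours are variables
  \<open>x\<close>, \<open>y\<close> until the final theorem. A second obstacle is that k - \<alpha>
  may be as small as k / (\<Delta> + 1), so every count passes between k and k - \<alpha> at the
  cost of a factor \<Delta> + 1. Moreover each of about \<Gamma>^8 k exceptional vertices can spoil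
  a whole copy, that is k vertices; this is why the bound on n carries the factor k.\<close>

definition nbh :: "'a ugraph \<Rightarrow> 'a \<Rightarrow> 'a set" where
  "nbh F v = {u. {v, u} \<in> edges F}"

definition deg_le :: "'a ugraph \<Rightarrow> nat \<Rightarrow> bool" where
  "deg_le F d \<longleftrightarrow> (\<forall>v\<in>verts F. card (nbh F v) \<le> d)"

text \<open>The vertex \<open>v\<close> never belongs to \<open>nbr c x v A\<close>, so for
  \<open>v\<close> in \<open>A\<close> the set \<open>A - nbr c x v A\<close> of non-neighbours
  contains \<open>v\<close>. Even a perfect clique therefore has one non-neighbour per
  vertex.\<close>

definition nbr :: "('b set \<Rightarrow> colour) \<Rightarrow> colour \<Rightarrow> 'b \<Rightarrow> 'b set \<Rightarrow> 'b set" where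
  "nbr c x v A = {u \<in> A. u \<noteq> v \<and> c {v, u} = x}"

lemma nbr_subset: "nbr c x v A \<subseteq> A"
  by (auto simp: nbr_def)

lemma nbr_finite [simp]: "finite A \<Longrightarrow> finite (nbr c x v A)"
  by (auto simp: nbr_def)

lemma nbr_other:
  assumes "x \<noteq> y" "v \<notin> A" shows "A - nbr c x v A = nbr c y v A"
  using assms by (cases x; cases y; cases "c {v, u}") (auto simp: nbr_def intro: colour.exhaust)

lemma nbr_Diff_insert:
  assumes "x \<noteq> y" shows "A - nbr c x v A \<subseteq> insert v (nbr c y v A)"
proof
  fix u assume "u \<in> A - nbr c x v A"
  then show "u \<in> insert v (nbr c y v A)"
    using assms by (cases x; cases y; cases "c {v, u}") (auto simp: nbr_def)
qed

lemma nbr_card_lower: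
  assumes "finite A" "C \<subseteq> A"
  shows "real (card C) - real (card (A - nbr c x v A)) \<le> real (card (nbr c x v C))"
proof -
  have "C \<subseteq> nbr c x v C \<union> (A - nbr c x v A)"
    using assms by (auto simp: nbr_def)
  then have "card C \<le> card (nbr c x v C \<union> (A - nbr c x v A))"
    using assms finite_subset[OF assms(2,1)] by (intro card_mono) auto
  also have "\<dots> \<le> card (nbr c x v C) + card (A - nbr c x v A)"
    by (rule card_Un_le)
  finally show ?thesis by linarith
qed

lemma edges_doubleton:
  assumes "simple_graph F" "e \<in> edges F"
  obtains u v where "e = {u, v}" "u \<noteq> v" "u \<in> verts F" "v \<in> verts F"
proof -
  have "e \<in> nsets (verts F) 2" using assms by (auto simp: simple_graph_def)
  then show ?thesis using that unfolding nsets_2_eq by blast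
qed

lemma edge_verts:
  assumes "simple_graph F" "{u, v} \<in> edges F"
  shows "u \<in> verts F" "v \<in> verts F" "u \<noteq> v"
proof -
  have "{u, v} \<in> nsets (verts F) 2" using assms unfolding simple_graph_def by blast
  then show "u \<in> verts F" "v \<in> verts F" "u \<noteq> v" by auto
qed

lemma nbh_sym: "u \<in> nbh F v \<Longrightarrow> v \<in> nbh F u"
  by (simp add: nbh_def insert_commute)

lemma nbh_verts: "simple_graph F \<Longrightarrow> u \<in> nbh F v \<Longrightarrow> u \<in> verts F \<and> v \<in> verts F \<and> u \<noteq> v"
  using edge_verts[of F v u] by (simp add: nbh_def)

lemma nbh_finite [simp]: "simple_graph F \<Longrightarrow> finite (nbh F v)"
  by (meson nbh_verts finite_subset simple_graph_def subsetI)

lemma nbh_degree: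
  assumes "simple_graph F" shows "card (nbh F v) = degree F v"
proof -
  have "bij_betw (\<lambda>u. {v, u}) (nbh F v) {e \<in> edges F. v \<in> e}"
    unfolding bij_betw_def
  proof
    show "inj_on (\<lambda>u. {v, u}) (nbh F v)"
      by (auto simp: inj_on_def doubleton_eq_iff)
    show "(\<lambda>u. {v, u}) ` nbh F v = {e \<in> edges F. v \<in> e}"
    proof (intro equalityI subsetI)
      fix e assume "e \<in> {e \<in> edges F. v \<in> e}"
      then obtain a b where ab: "e = {a, b}" "v \<in> e" "e \<in> edges F"
        using edges_doubleton[OF assms] by blast
      then have "(v = a \<and> b \<in> nbh F v) \<or> (v = b \<and> a \<in> nbh F v)"
        by (auto simp: nbh_def insert_commute)
      then show "e \<in> (\<lambda>u. {v, u}) ` nbh F v"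
        using ab(1) by (auto simp: insert_commute)
    qed (auto simp: nbh_def)
  qed
  then show ?thesis unfolding degree_def by (rule bij_betw_same_card)
qed

definition hom :: "('b set \<Rightarrow> colour) \<Rightarrow> colour \<Rightarrow> 'a ugraph \<Rightarrow> ('a \<Rightarrow> 'b) \<Rightarrow> bool" where
  "hom c x F f \<longleftrightarrow> inj_on f (verts F) \<and> (\<forall>u v. {u, v} \<in> edges F \<longrightarrow> c {f u, f v} = x)"

lemma has_copy_hom:
  assumes "simple_graph F"
  shows "has_copy c S x F \<longleftrightarrow> (\<exists>f. hom c x F f \<and> f ` verts F \<subseteq> S)"
proof -
  have "(\<forall>e\<in>edges F. c (f ` e) = x) \<longleftrightarrow> (\<forall>u v. {u, v} \<in> edges F \<longrightarrow> c {f u, f v} = x)" for f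
    by (metis (no_types, lifting) assms edges_doubleton image_insert image_empty)
  then show ?thesis by (auto simp: has_copy_def hom_def)
qed

lemma homI:
  assumes "inj_on f (verts F)" "\<And>u v. {u, v} \<in> edges F \<Longrightarrow> c {f u, f v} = x"
  shows "hom c x F f"
  using assms by (auto simp: hom_def)

lemma has_copy_mono: "has_copy c S x F \<Longrightarrow> S \<subseteq> S' \<Longrightarrow> has_copy c S' x F"
  unfolding has_copy_def by blast

lemma hom_inj: "hom c x F f \<Longrightarrow> inj_on f (verts F)"
  by (simp add: hom_def)

lemma hom_edge: "hom c x F f \<Longrightarrow> {u, v} \<in> edges F \<Longrightarrow> c {f u, f v} = x"
  by (simp add: hom_def)

text \<open>The vertices are placed in the order of the list. \<open>t v m\<close> is a lower bound for the number of
  candidates left for \<open>v\<close> once \<open>m\<close> of its neighbours are placed; at most \<open>\<beta> u\<close> choices for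
  \<open>u\<close> spoil this bound for a given later neighbour.\<close>

lemma candidate_embedding_list:
  fixes F :: "'a ugraph" and c :: "'b set \<Rightarrow> colour" and t :: "'a \<Rightarrow> nat \<Rightarrow> real" and \<beta> :: "'a \<Rightarrow> real"
  assumes simple: "simple_graph F"
    and ys: "distinct ys" "set ys \<subseteq> verts F"
    and sorted: "sorted_wrt (\<lambda>u v. {u, v} \<in> edges F \<longrightarrow>
        (\<forall>m<d. \<forall>C\<subseteq>A0 v. t v m \<le> card C \<longrightarrow>
          real (card {w \<in> A0 u. card (nbr c x w C) < t v (Suc m)}) \<le> \<beta> u)) ys"
    and size: "\<forall>v\<in>set ys. \<forall>m\<le>d. K + d * \<beta> v < t v m" and \<beta>: "\<forall>v. 0 \<le> \<beta> v"
    and A0: "\<forall>v. finite (A0 v)"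
    and A: "\<forall>v\<in>set ys. A v \<subseteq> A0 v \<and> lev v + card (nbh F v \<inter> set ys) \<le> d \<and> t v (lev v) \<le> card (A v)"
    and used: "finite used" "card used + length ys \<le> K"
  shows "\<exists>f. inj_on f (set ys) \<and> (\<forall>v\<in>set ys. f v \<in> A v - used)
     \<and> (\<forall>u\<in>set ys. \<forall>v\<in>set ys. {u, v} \<in> edges F \<longrightarrow> c {f u, f v} = x)"
  using ys sorted size A used
proof (induction ys arbitrary: A lev used)
  case Nil
  then show ?case by auto
next
  case (Cons y ys)
  define N where "N = nbh F y \<inter> set ys"
  \<comment> \<open>These images of \<open>y\<close> would push the candidate set of the later
    neighbour \<open>v\<close> below its next threshold.\<close>
  define Bad where "Bad v = {w \<in> A0 y. card (nbr c x w (A v)) < t v (Suc (lev v))}" for v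
  have finN: "finite N" by (simp add: N_def)
  have yin: "y \<in> set (y # ys)" by simp
  have yny: "y \<notin> nbh F y" using simple nbh_verts by fast
  have Nd: "card N \<le> d" "lev y \<le> d"
  proof -
    have "lev y + card (nbh F y \<inter> set (y # ys)) \<le> d" using Cons.prems(5) by simp
    moreover have "nbh F y \<inter> set (y # ys) = N" using yny by (auto simp: N_def)
    ultimately show "card N \<le> d" "lev y \<le> d" by auto
  qed
  \<comment> \<open>Placed neighbours plus waiting neighbours never exceed \<open>d\<close>, so the
    thresholds are consulted only up to index \<open>d\<close>.\<close>
  have lev: "Suc (lev v) + card (nbh F v \<inter> set ys) \<le> d" if "v \<in> N" for v
  proof -
    have v: "v \<in> set ys" "y \<in> nbh F v" using that nbh_sym by (auto simp: N_def)
    have "y \<notin> set ys" using Cons.prems(1) by simp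
    have "nbh F v \<inter> set (y # ys) = insert y (nbh F v \<inter> set ys)" using v by auto
    moreover have "card (insert y (nbh F v \<inter> set ys)) = Suc (card (nbh F v \<inter> set ys))"
      using \<open>y \<notin> set ys\<close> by simp
    moreover have "lev v + card (nbh F v \<inter> set (y # ys)) \<le> d"
      using Cons.prems(5) v(1) by (meson list.set_intros(2))
    ultimately show ?thesis by simp
  qed
  have Bad: "real (card (Bad v)) \<le> \<beta> y" if "v \<in> N" for v
  proof -
    have "v \<in> set ys" "{y, v} \<in> edges F" using that by (auto simp: N_def nbh_def)
    moreover have "lev v < d" using lev[OF that] by simp
    moreover have "A v \<subseteq> A0 v" "t v (lev v) \<le> card (A v)"
      using Cons.prems(5) calculation by auto
    ultimately show ?thesis using Cons.prems(3) unfolding Bad_def by simp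
  qed
  have "real (card (\<Union>v\<in>N. Bad v)) \<le> (\<Sum>v\<in>N. real (card (Bad v)))"
    using card_UN_le[OF finN, of Bad] by (metis of_nat_le_iff of_nat_sum)
  also have "\<dots> \<le> (\<Sum>v\<in>N. \<beta> y)" by (rule sum_mono) (rule Bad)
  also have "\<dots> \<le> d * \<beta> y" using Nd \<beta> by (simp add: mult_right_mono)
  finally have bad: "real (card (\<Union>v\<in>N. Bad v)) \<le> d * \<beta> y" .
  have "K + d * \<beta> y < card (A y)"
    using Cons.prems(4) Cons.prems(5) Nd yin by (smt (verit, best))
  moreover have "card used < K" using Cons.prems(7) by simp
  ultimately have "real (card used) + real (card (\<Union>v\<in>N. Bad v)) < card (A y)"
    using bad by linarith
  moreover have "card (used \<union> (\<Union>v\<in>N. Bad v)) \<le> card used + card (\<Union>v\<in>N. Bad v)"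
    by (rule card_Un_le)
  ultimately have "card (used \<union> (\<Union>v\<in>N. Bad v)) < card (A y)" by linarith
  moreover have "finite (used \<union> (\<Union>v\<in>N. Bad v))"
    using A0 finN Cons.prems(6) by (auto simp: Bad_def)
  ultimately have "\<not> A y \<subseteq> used \<union> (\<Union>v\<in>N. Bad v)"
    by (meson card_mono leD)
  then obtain a where a: "a \<in> A y" "a \<notin> used" "\<And>v. v \<in> N \<Longrightarrow> a \<notin> Bad v" by auto
  have aA0: "a \<in> A0 y" using a(1) Cons.prems(5) by auto
  define A' where "A' v = (if v \<in> N then nbr c x a (A v) else A v)" for v
  define lev' where "lev' v = (if v \<in> N then Suc (lev v) else lev v)" for v
  have "\<exists>f. inj_on f (set ys) \<and> (\<forall>v\<in>set ys. f v \<in> A' v - insert a used)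
     \<and> (\<forall>u\<in>set ys. \<forall>v\<in>set ys. {u, v} \<in> edges F \<longrightarrow> c {f u, f v} = x)"
  proof (rule Cons.IH)
    show "distinct ys" "set ys \<subseteq> verts F" using Cons.prems by auto
    show "sorted_wrt (\<lambda>u v. {u, v} \<in> edges F \<longrightarrow>
        (\<forall>m<d. \<forall>C\<subseteq>A0 v. t v m \<le> card C \<longrightarrow>
          real (card {w \<in> A0 u. card (nbr c x w C) < t v (Suc m)}) \<le> \<beta> u)) ys"
      using Cons.prems(3) by simp
    show "\<forall>v\<in>set ys. \<forall>m\<le>d. K + d * \<beta> v < t v m" using Cons.prems(4) by simp
    show "finite (insert a used)" "card (insert a used) + length ys \<le> K"
      using Cons.prems(6,7) a(2) by auto
    show "\<forall>v\<in>set ys. A' v \<subseteq> A0 v \<and> lev' v + card (nbh F v \<inter> set ys) \<le> d \<and> t v (lev' v) \<le> card (A' v)"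
    proof (intro ballI conjI)
      fix v assume v: "v \<in> set ys"
      then have Av: "A v \<subseteq> A0 v" "lev v + card (nbh F v \<inter> set (y # ys)) \<le> d" "t v (lev v) \<le> card (A v)"
        using Cons.prems(5) by auto
      show "A' v \<subseteq> A0 v" using Av(1) by (auto simp: A'_def nbr_def)
      have "card (nbh F v \<inter> set ys) \<le> card (nbh F v \<inter> set (y # ys))"
        by (intro card_mono) auto
      then show "lev' v + card (nbh F v \<inter> set ys) \<le> d"
        using lev Av(2) by (auto simp: lev'_def)
      show "t v (lev' v) \<le> card (A' v)"
        using a(3)[of v] aA0 Av(3) by (auto simp: lev'_def A'_def Bad_def)
    qed
  qed
  then obtain f where f: "inj_on f (set ys)" "\<forall>v\<in>set ys. f v \<in> A' v - insert a used"
    "\<forall>u\<in>set ys. \<forall>v\<in>set ys. {u, v} \<in> edges F \<longrightarrow> c {f u, f v} = x" by blast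
  have yys: "y \<notin> set ys" using Cons.prems(1) by simp
  define g where "g = f(y := a)"
  have gy: "c {a, f v} = x" if "v \<in> set ys" "{y, v} \<in> edges F" for v
  proof -
    have "v \<in> N" using that by (simp add: N_def nbh_def)
    then show ?thesis using f(2) that by (auto simp: A'_def nbr_def)
  qed
  show ?case
  proof (intro exI[of _ g] conjI ballI impI)
    show "inj_on g (set (y # ys))"
      using f(1,2) yys by (auto simp: g_def inj_on_def)
    fix v assume "v \<in> set (y # ys)"
    then show "g v \<in> A v - used"
      using f(2) a yys by (auto simp: g_def A'_def nbr_def split: if_splits)
  next
    fix u v assume uv: "u \<in> set (y # ys)" "v \<in> set (y # ys)" "{u, v} \<in> edges F"
    then have ne: "u \<noteq> v" using edge_verts simple by metis
    show "c {g u, g v} = x"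
      using uv ne f(3) gy[of u] gy[of v] yys by (auto simp: g_def insert_commute)
  qed
qed

lemma candidate_embedding:
  fixes F :: "'a ugraph" and c :: "'b set \<Rightarrow> colour" and t :: "'a \<Rightarrow> nat \<Rightarrow> real" and \<beta> :: "'a \<Rightarrow> real"
  assumes simple: "simple_graph F" and deg: "deg_le F d"
    and ys: "distinct ys" "set ys = verts F"
    and sorted: "sorted_wrt (\<lambda>u v. {u, v} \<in> edges F \<longrightarrow>
        (\<forall>m<d. \<forall>C\<subseteq>A v. t v m \<le> card C \<longrightarrow>
          real (card {w \<in> A u. card (nbr c x w C) < t v (Suc m)}) \<le> \<beta> u)) ys"
    and size: "\<And>v m. v \<in> verts F \<Longrightarrow> m \<le> d \<Longrightarrow> card (verts F) + d * \<beta> v < t v m"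
    and \<beta>: "\<And>v. 0 \<le> \<beta> v"
    and A: "\<And>v. finite (A v)" "\<And>v. v \<in> verts F \<Longrightarrow> t v 0 \<le> card (A v)"
  shows "\<exists>f. hom c x F f \<and> (\<forall>v\<in>verts F. f v \<in> A v)"
proof -
  have "\<exists>f. inj_on f (set ys) \<and> (\<forall>v\<in>set ys. f v \<in> A v - {})
     \<and> (\<forall>u\<in>set ys. \<forall>v\<in>set ys. {u, v} \<in> edges F \<longrightarrow> c {f u, f v} = x)"
  proof (rule candidate_embedding_list[where ?A0.0=A and lev="\<lambda>_. 0" and K="card (verts F)"])
    show "\<forall>v\<in>set ys. A v \<subseteq> A v \<and> 0 + card (nbh F v \<inter> set ys) \<le> d \<and> t v 0 \<le> card (A v)"
    proof (intro ballI conjI)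
      fix v assume v: "v \<in> set ys"
      have "card (nbh F v \<inter> set ys) \<le> card (nbh F v)" using simple by (intro card_mono) auto
      also have "\<dots> \<le> d" using deg v ys by (auto simp: deg_le_def)
      finally show "0 + card (nbh F v \<inter> set ys) \<le> d" by simp
      show "t v 0 \<le> card (A v)" using A(2) v ys by auto
    qed simp
    show "card {} + length ys \<le> card (verts F)"
      using ys distinct_card by fastforce
  qed (use assms in auto)
  then obtain f where f: "inj_on f (set ys)" "\<forall>v\<in>set ys. f v \<in> A v"
     "\<forall>u\<in>set ys. \<forall>v\<in>set ys. {u, v} \<in> edges F \<longrightarrow> c {f u, f v} = x" by auto
  have "hom c x F f"
    using f ys edge_verts[OF simple] by (intro homI) auto
  then show ?thesis using f ys by auto
qed

text \<open>The edges are repaired one at a time: the image of an endpoint of a bad edge is swapped with a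
  vertex of \<open>A\<close> that spoils no other edge.\<close>

lemma sauer_spencer:
  fixes F :: "'a ugraph" and c :: "'b set \<Rightarrow> colour" and \<eta> :: real
  assumes simple: "simple_graph F" and deg: "deg_le F d"
    and A: "finite A" "card (verts F) \<le> card A"
    and \<eta>: "\<And>a. a \<in> A \<Longrightarrow> real (card (A - nbr c x a A)) \<le> \<eta>"
    and size: "2 * d * \<eta> < card A"
  shows "\<exists>f. hom c x F f \<and> f ` verts F \<subseteq> A"
proof -
  have finV: "finite (verts F)" using simple by (simp add: simple_graph_def)
  have finE: "finite (edges F)"
    using simple finV unfolding simple_graph_def
    by (meson finite_imp_finite_nsets finite_subset)
  define W where "W v = A - nbr c x v A" for v
  have "\<exists>f. inj_on f (verts F) \<and> f ` verts F \<subseteq> A \<and> (\<forall>u v. {u, v} \<in> D \<longrightarrow> f u \<in> nbr c x (f v) A)"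
    if "D \<subseteq> edges F" for D
    using finite_subset[OF that finE] that
  proof (induction D rule: finite_induct)
    case empty
    obtain f where "f ` verts F \<subseteq> A" "inj_on f (verts F)"
      using card_le_inj[OF finV A] by blast
    then show ?case by auto
  next
    case (insert e D)
    then obtain f where f: "inj_on f (verts F)" "f ` verts F \<subseteq> A"
      "\<forall>u v. {u, v} \<in> D \<longrightarrow> f u \<in> nbr c x (f v) A" by auto
    obtain u v where uv: "e = {u, v}" "u \<noteq> v" "u \<in> verts F" "v \<in> verts F"
      using insert.prems edges_doubleton[OF simple] by blast
    have fuA: "f u \<in> A" using f uv by auto
    \<comment> \<open>An \<open>s\<close> outside \<open>T1\<close> can host \<open>u\<close>: it
      has colour \<open>x\<close> to the images of all neighbours of \<open>u\<close>. Since
      \<open>W a\<close> contains \<open>a\<close>, such an \<open>s\<close> is none of these images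
      either.\<close>
    define T1 where "T1 = (\<Union>z\<in>nbh F u. W (f z))"
    \<comment> \<open>If \<open>s\<close> is the image of some \<open>a\<close>, the swap moves
      \<open>a\<close> to \<open>f u\<close>. This is harmless unless \<open>a\<close> has a
      neighbour in \<open>Z\<close>, and \<open>T2\<close> collects the \<open>s\<close> for which
      that happens.\<close>
    define Z where "Z = {z \<in> verts F. f z \<in> W (f u)}"
    define T2 where "T2 = (\<Union>z\<in>Z. f ` nbh F z)"
    have nb: "card (nbh F z) \<le> d" if "z \<in> verts F" for z using deg that by (simp add: deg_le_def)
    have WA: "real (card (W a)) \<le> \<eta>" if "a \<in> A" for a using \<eta> that by (simp add: W_def)
    have \<eta>0: "0 \<le> \<eta>" using WA[OF fuA] by linarith
    have "real (card T1) \<le> (\<Sum>z\<in>nbh F u. real (card (W (f z))))"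
      unfolding T1_def using card_UN_le[of "nbh F u" "\<lambda>z. W (f z)"] simple
      by (metis nbh_finite of_nat_le_iff of_nat_sum)
    also have "\<dots> \<le> (\<Sum>z\<in>nbh F u. \<eta>)"
      by (rule sum_mono) (use f(2) nbh_verts[OF simple] WA in blast)
    also have "\<dots> \<le> d * \<eta>" using nb[OF uv(3)] \<eta>0 by (simp add: mult_right_mono)
    finally have T1: "real (card T1) \<le> d * \<eta>" .
    have "card Z \<le> card (W (f u))"
      by (rule card_inj_on_le[of f]) (use f A in \<open>auto simp: Z_def W_def inj_on_def\<close>)
    then have Z: "real (card Z) \<le> \<eta>" using WA[OF fuA] by linarith
    have "card T2 \<le> (\<Sum>z\<in>Z. card (f ` nbh F z))"
      unfolding T2_def using finV by (intro card_UN_le) (auto simp: Z_def)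
    also have "\<dots> \<le> (\<Sum>z\<in>Z. d)"
      by (intro sum_mono) (metis (no_types, lifting) Z_def card_image_le le_trans mem_Collect_eq nb nbh_finite simple)
    finally have "real (card T2) \<le> real (card Z) * d" by (simp flip: of_nat_mult)
    also have "\<dots> \<le> \<eta> * d" using Z by (simp add: mult_right_mono)
    finally have T2: "real (card T2) \<le> d * \<eta>" by (simp add: mult.commute)
    have "card (T1 \<union> T2) \<le> card T1 + card T2" by (rule card_Un_le)
    then have "card (T1 \<union> T2) < card A" using T1 T2 size by linarith
    moreover have "finite (T1 \<union> T2)"
      using A finV simple by (auto simp: T1_def T2_def W_def Z_def)
    ultimately have "\<not> A \<subseteq> T1 \<union> T2" by (meson card_mono leD)
    then obtain s where s: "s \<in> A" "s \<notin> T1" "s \<notin> T2" by auto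
    define g where "g = (\<lambda>z. Transposition.transpose (f u) s (f z))"
    have gu: "g u = s" by (simp add: g_def)
    have sadj: "f b \<noteq> s \<and> f b \<in> nbr c x s A" if "b \<in> nbh F u" for b
    proof -
      have "f b \<in> A" using f(2) nbh_verts[OF simple that] by auto
      have "s \<notin> W (f b)" using s(2) that by (auto simp: T1_def)
      then have "s \<in> nbr c x (f b) A" using s(1) by (auto simp: W_def)
      then show ?thesis using \<open>f b \<in> A\<close> by (auto simp: nbr_def insert_commute)
    qed
    have gadj: "g u \<in> nbr c x (g b) A \<and> g b \<in> nbr c x (g u) A" if "b \<in> nbh F u" for b
    proof -
      have "f b \<noteq> f u" using f(1) uv(3) nbh_verts[OF simple that] by (auto simp: inj_on_def)
      then have "g b = f b" using sadj[OF that] by (simp add: g_def)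
      then show ?thesis using sadj[OF that] s(1) gu by (auto simp: nbr_def insert_commute)
    qed
    have gt: "g a \<in> nbr c x (g b) A \<and> g b \<in> nbr c x (g a) A"
      if ab: "{a, b} \<in> D" "a \<noteq> u" "b \<noteq> u" "f a = s" for a b
    proof -
      have abE: "{a, b} \<in> edges F" using ab(1) insert.prems by auto
      have v: "a \<in> verts F" "b \<in> verts F" "a \<noteq> b" using edge_verts[OF simple abE] by auto
      have "f b \<noteq> s" using f(1) v ab(4) by (auto simp: inj_on_def)
      moreover have "f b \<noteq> f u" using f(1) v(2) ab(3) uv(3) by (auto simp: inj_on_def)
      ultimately have gb: "g b = f b" by (simp add: g_def)
      have ga: "g a = f u" using ab(4) by (simp add: g_def)
      have "a \<in> nbh F b" using abE by (simp add: nbh_def insert_commute)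
      then have "b \<notin> Z" using s(3) ab(4) by (auto simp: T2_def)
      then have "f b \<notin> W (f u)" using v by (simp add: Z_def)
      moreover have "f b \<in> A" using f(2) v by auto
      ultimately have "f b \<in> nbr c x (f u) A" by (auto simp: W_def)
      then show ?thesis using ga gb fuA by (auto simp: nbr_def insert_commute)
    qed
    have "inj_on g (verts F)"
      using f(1) by (auto simp: g_def inj_on_def dest: transpose_eq_imp_eq)
    moreover have "g ` verts F \<subseteq> A"
      using f(2) s(1) fuA by (auto simp: g_def Transposition.transpose_def)
    moreover have "g a \<in> nbr c x (g b) A" if ab: "{a, b} \<in> insert e D" for a b
    proof -
      have abE: "{a, b} \<in> edges F" using ab insert.prems by auto
      have v: "a \<in> verts F" "b \<in> verts F" "a \<noteq> b" using edge_verts[OF simple abE] by auto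
      consider "a = u" | "b = u" | "a \<noteq> u" "b \<noteq> u" by blast
      then show ?thesis
      proof cases
        case 1
        then show ?thesis using gadj[of b] abE by (auto simp: nbh_def)
      next
        case 2
        then show ?thesis using gadj[of a] abE by (auto simp: nbh_def insert_commute)
      next
        case 3
        then have D: "{a, b} \<in> D" using ab uv(1) by auto
        then have D': "{b, a} \<in> D" by (simp add: insert_commute)
        show ?thesis
        proof (cases "f a = s \<or> f b = s")
          case True
          then show ?thesis using gt[OF D] gt[OF D'] 3 by auto
        next
          case False
          have "f a \<noteq> f u" "f b \<noteq> f u" using f(1) v 3 uv(3) by (auto simp: inj_on_def)
          then have "g a = f a" "g b = f b" using False by (auto simp: g_def)
          then show ?thesis using f(3) D by auto
        qed
      qed
    qed
    ultimately show ?case by blast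
  qed
  from this[OF subset_refl] obtain f where f: "inj_on f (verts F)" "f ` verts F \<subseteq> A"
    "\<forall>u v. {u, v} \<in> edges F \<longrightarrow> f u \<in> nbr c x (f v) A" by blast
  have "hom c x F f" using f(1,3) by (intro homI) (auto simp: nbr_def insert_commute)
  then show ?thesis using f by blast
qed

text \<open>Before each choice fewer than \<open>card I\<close> values are taken, so a set with at
  least \<open>card I\<close> elements still offers a new one.\<close>

lemma greedy_sdr:
  assumes "finite I" "\<And>i. i \<in> I \<Longrightarrow> finite (C i) \<and> card I \<le> card (C i)"
  shows "\<exists>g. inj_on g I \<and> (\<forall>i\<in>I. g i \<in> C i)"
proof -
  have "\<exists>g. inj_on g J \<and> (\<forall>i\<in>J. g i \<in> C i)" if "J \<subseteq> I" for J
    using finite_subset[OF that assms(1)] that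
  proof (induction J rule: finite_induct)
    case (insert j J)
    then obtain g where g: "inj_on g J" "\<forall>i\<in>J. g i \<in> C i" by auto
    have "card J < card I" using insert assms(1) psubset_card_mono[of I J] by auto
    then have "card (g ` J) < card (C j)"
      using assms(2)[of j] insert card_image_le[of J g] by fastforce
    then obtain a where "a \<in> C j" "a \<notin> g ` J"
      by (metis card_mono finite_imageI insert.hyps(1) leD subsetI)
    then have "inj_on (g(j := a)) (insert j J) \<and> (\<forall>i\<in>insert j J. (g(j := a)) i \<in> C i)"
      using g insert.hyps by (auto simp: inj_on_def)
    then show ?case by blast
  qed simp
  then show ?thesis by blast
qed

section \<open>Dense monochromatic sets\<close>

lemma nbr_double_count:
  assumes "finite X" "finite Y"
  shows "(\<Sum>v\<in>X. card (nbr c y v Y)) = (\<Sum>u\<in>Y. card (nbr c y u X))"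
proof -
  have "(\<Sum>v\<in>X. card (nbr c y v Y)) = (\<Sum>v\<in>X. \<Sum>u\<in>Y. if u \<noteq> v \<and> c {v, u} = y then 1 else 0)"
    using assms by (simp add: nbr_def sum.If_cases Int_def)
  also have "\<dots> = (\<Sum>u\<in>Y. \<Sum>v\<in>X. if v \<noteq> u \<and> c {u, v} = y then 1 else 0)"
    by (subst sum.swap) (auto intro!: sum.cong simp: insert_commute)
  also have "\<dots> = (\<Sum>u\<in>Y. card (nbr c y u X))"
    using assms by (simp add: nbr_def sum.If_cases Int_def)
  finally show ?thesis .
qed

lemma markov_card:
  fixes f :: "'b \<Rightarrow> real" and t :: real
  assumes "finite A" "\<And>a. a \<in> A \<Longrightarrow> 0 \<le> f a"
  shows "card {a \<in> A. t < f a} * t \<le> sum f A"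
proof -
  have "card {a \<in> A. t < f a} * t = (\<Sum>a\<in>{a \<in> A. t < f a}. t)" by simp
  also have "\<dots> \<le> (\<Sum>a\<in>{a \<in> A. t < f a}. f a)" by (rule sum_mono) auto
  also have "\<dots> \<le> sum f A" using assms by (intro sum_mono2) auto
  finally show ?thesis .
qed

text \<open>Contraposition of the greedy embedding with thresholds
  \<open>\<epsilon>^m * card U\<close>: if it cannot be carried out, some candidate set
  \<open>C\<close> has too many bad vertices, and these bad vertices form \<open>X\<close> while
  \<open>C\<close> serves as \<open>Y\<close>.\<close>

lemma sparse_pair:
  fixes H :: "'a ugraph" and c :: "'b set \<Rightarrow> colour" and \<epsilon> :: real
  assumes simple: "simple_graph H" and deg: "deg_le H d" and d: "1 \<le> d"
    and U: "finite U" "0 < card U" "\<not> has_copy c U y H"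
    and \<epsilon>: "0 < \<epsilon>" "\<epsilon> \<le> 1" and size: "2 * card (verts H) \<le> \<epsilon>^d * card U"
  shows "\<exists>X Y. X \<subseteq> U \<and> Y \<subseteq> U \<and> \<epsilon>^d * card U / (4 * real d) < card X \<and> \<epsilon>^d * card U \<le> card Y
     \<and> (\<forall>v\<in>X. card (nbr c y v Y) < \<epsilon> * card Y)"
proof (rule ccontr)
  assume contra: "\<not> ?thesis"
  \<comment> \<open>Up to \<open>d\<close> neighbours together forbid at most a quarter of the
    smallest threshold \<open>\<epsilon>^d * card U\<close>, and the vertices already used take at
    most half of it.\<close>
  define \<beta> where "\<beta> = \<epsilon>^d * card U / (4 * real d)"
  have pw: "\<epsilon>^d \<le> \<epsilon>^m" if "m \<le> d" for m
    using \<epsilon> that by (intro power_decreasing) auto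
  have pos: "0 < \<epsilon>^d * card U" using \<epsilon> U by simp
  have d\<beta>: "d * \<beta> = \<epsilon>^d * card U / 4" using d by (simp add: \<beta>_def)
  obtain ys where ys: "distinct ys" "set ys = verts H"
    using simple finite_distinct_list unfolding simple_graph_def by metis
  have ok: "real (card {w \<in> U. card (nbr c y w C) < \<epsilon>^(Suc m) * card U}) \<le> \<beta>"
    if "m < d" "C \<subseteq> U" "\<epsilon>^m * card U \<le> card C" for m C
  proof (rule ccontr)
    define X where "X = {w \<in> U. card (nbr c y w C) < \<epsilon>^(Suc m) * card U}"
    assume "\<not> ?thesis"
    then have X: "\<epsilon>^d * card U / (4 * real d) < card X" by (simp add: \<beta>_def X_def)
    have C: "\<epsilon>^d * card U \<le> card C"
      using that mult_right_mono[OF pw[of m], of "card U"] by linarith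
    have "\<epsilon>^(Suc m) * card U \<le> \<epsilon> * card C"
      using that(3) \<epsilon> by (simp add: mult.assoc)
    then have "\<forall>v\<in>X. card (nbr c y v C) < \<epsilon> * card C" by (auto simp: X_def)
    moreover have "X \<subseteq> U" by (auto simp: X_def)
    ultimately have "\<exists>X Y. X \<subseteq> U \<and> Y \<subseteq> U \<and> \<epsilon>^d * card U / (4 * real d) < card X \<and> \<epsilon>^d * card U \<le> card Y
     \<and> (\<forall>v\<in>X. card (nbr c y v Y) < \<epsilon> * card Y)"
      using X C that(2) by (intro exI[of _ X] exI[of _ C] conjI)
    with contra show False by contradiction
  qed
  have "\<exists>f. hom c y H f \<and> (\<forall>v\<in>verts H. f v \<in> U)"
  proof (rule candidate_embedding[where t="\<lambda>v m. \<epsilon>^m * card U" and \<beta>="\<lambda>v. \<beta>", OF simple deg ys])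
    show "sorted_wrt (\<lambda>u v. {u, v} \<in> edges H \<longrightarrow>
        (\<forall>m<d. \<forall>C\<subseteq>U. \<epsilon>^m * card U \<le> card C \<longrightarrow>
          real (card {w \<in> U. card (nbr c y w C) < \<epsilon>^(Suc m) * card U}) \<le> \<beta>)) ys"
      unfolding sorted_wrt_iff_nth_less using ok by blast
    fix v m assume "m \<le> d"
    then have "\<epsilon>^d * card U \<le> \<epsilon>^m * card U" using pw by (simp add: mult_right_mono)
    then show "card (verts H) + d * \<beta> < \<epsilon>^m * card U" using size d\<beta> pos by linarith
  qed (use U \<epsilon> in \<open>auto simp: \<beta>_def\<close>)
  then show False using U(3) has_copy_hom[OF simple] by blast
qed

text \<open>The set doubles in each step: \<open>X\<close> yields one half, and the other half is found among
  those vertices of \<open>Y\<close> that see few vertices of the first half.\<close>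

lemma low_density_set:
  fixes H :: "'a ugraph" and c :: "'b set \<Rightarrow> colour" and \<epsilon> :: real and K s :: nat
  assumes simple: "simple_graph H" and deg: "deg_le H d" and d: "1 \<le> d"
    and \<epsilon>: "0 < \<epsilon>" "\<epsilon> \<le> 1" and K: "16 * d \<le> \<epsilon>^d * K" and s: "0 < s" "2 * card (verts H) \<le> \<epsilon>^d * s"
    and U: "finite U" "\<not> has_copy c U y H" "K^h * s \<le> card U"
  shows "\<exists>W\<subseteq>U. card W = 2^h * s \<and>
    real (\<Sum>v\<in>W. card (nbr c y v W)) \<le> (1 / 2^h + 4 * \<epsilon>) * (real (card W))\<^sup>2"
  using U
proof (induction h arbitrary: U)
  case 0
  then have "s \<le> card U" by simp
  then obtain W where W: "W \<subseteq> U" "card W = s" by (meson obtain_subset_with_card_n)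
  then have fW: "finite W" using 0 finite_subset by auto
  have "(\<Sum>v\<in>W. card (nbr c y v W)) \<le> (\<Sum>v\<in>W. card W)"
    using fW by (intro sum_mono card_mono) (auto simp: nbr_def)
  then have "real (\<Sum>v\<in>W. card (nbr c y v W)) \<le> (real (card W))\<^sup>2"
    by (simp add: power2_eq_square flip: of_nat_mult of_nat_sum)
  also have "\<dots> \<le> (1 + 4 * \<epsilon>) * (real (card W))\<^sup>2" using \<epsilon> by (simp add: mult_le_cancel_right1)
  finally show ?case using W by auto
next
  case (Suc h)
  have ed: "\<epsilon>^d \<le> 1" "0 < \<epsilon>^d" using \<epsilon> by (auto simp: power_le_one)
  have "real K \<ge> \<epsilon>^d * K" using ed by (simp add: mult_left_le_one_le)
  then have "real K \<ge> 16" using K d by linarith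
  then have K16: "K \<ge> 16" by simp
  define q where "q = 2^h * s"
  define L where "L = K^h * s"
  have qL: "q \<le> L" using K16 by (auto simp: q_def L_def intro: power_mono)
  have q0: "0 < q" using s by (simp add: q_def)
  have UL: "K * L \<le> card U" using Suc.prems(3) by (simp add: L_def mult.assoc)
  have sL: "s \<le> L" using K16 by (simp add: L_def)
  have "L \<le> K * L" using K16 by simp
  then have "s \<le> card U" using sL UL by linarith
  then have "\<epsilon>^d * s \<le> \<epsilon>^d * card U" using ed by simp
  then have "2 * card (verts H) \<le> \<epsilon>^d * card U" using s(2) by linarith
  from sparse_pair[OF simple deg d Suc.prems(1) _ Suc.prems(2) \<epsilon> this] \<open>s \<le> card U\<close> s
  obtain X Y where XY: "X \<subseteq> U" "Y \<subseteq> U" "\<epsilon>^d * card U / (4 * real d) < card X" "\<epsilon>^d * card U \<le> card Y"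
     "\<forall>v\<in>X. card (nbr c y v Y) < \<epsilon> * card Y" by auto
  have fin: "finite X" "finite Y" using finite_subset[OF XY(1)] finite_subset[OF XY(2)] Suc.prems(1) by blast+
  \<comment> \<open>\<open>L\<close> vertices suffice for the induction hypothesis. \<open>X\<close>
    needs this much directly; \<open>Y\<close> needs the factor 4 because parts of it are thrown
    away before the second application.\<close>
  have big: "4 * real L \<le> \<epsilon>^d * card U / (4 * real d)"
  proof -
    have "16 * d * real L \<le> \<epsilon>^d * K * L" using K by (intro mult_right_mono) auto
    also have "\<dots> \<le> \<epsilon>^d * card U" using UL ed by (simp add: mult.assoc flip: of_nat_mult)
    finally show ?thesis using d by (simp add: field_simps)
  qed
  have "1 * (\<epsilon>^d * card U) \<le> 4 * real d * (\<epsilon>^d * card U)"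
    using d ed by (intro mult_right_mono) auto
  then have "\<epsilon>^d * card U / (4 * real d) \<le> \<epsilon>^d * card U"
    using d by (auto simp: field_simps)
  then have YL: "4 * L \<le> card Y" using XY(4) big by linarith
  have "K^h * s \<le> card X" using XY(3) big by (simp add: L_def[symmetric])
  moreover have "\<not> has_copy c X y H" using Suc.prems(2) XY(1) has_copy_mono by blast
  ultimately obtain X' where X': "X' \<subseteq> X" "card X' = q"
      "real (\<Sum>v\<in>X'. card (nbr c y v X')) \<le> (1 / 2^h + 4 * \<epsilon>) * (real q)\<^sup>2"
    using Suc.IH[OF fin(1)] unfolding q_def by (metis (no_types, lifting))
  have fX': "finite X'" using X' fin finite_subset by auto
  define f where "f u = real (card (nbr c y u X'))" for u
  \<comment> \<open>The average of \<open>f\<close> over \<open>Y\<close> is at most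
    \<open>\<epsilon> * q\<close>, so Markov removes at most a quarter of \<open>Y\<close>, and
    \<open>X'\<close> removes at most another quarter because \<open>q \<le> L\<close>.\<close>
  define Z where "Z = {u \<in> Y - X'. f u \<le> 4 * \<epsilon> * q}"
  have "sum f Y = real (\<Sum>v\<in>X'. card (nbr c y v Y))"
    using nbr_double_count[OF fX' fin(2)] by (simp add: f_def)
  also have "\<dots> \<le> (\<Sum>v\<in>X'. \<epsilon> * card Y)"
    unfolding of_nat_sum by (rule sum_mono) (use XY(5) X'(1) in force)
  finally have "sum f Y \<le> q * \<epsilon> * card Y" using X' by (simp add: mult.assoc)
  then have "card {u \<in> Y. 4 * \<epsilon> * q < f u} * (4 * \<epsilon> * q) \<le> q * \<epsilon> * card Y"
    using markov_card[OF fin(2), of f "4 * \<epsilon> * q"] by (simp add: f_def)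
  then have "(4 * card {u \<in> Y. 4 * \<epsilon> * q < f u}) * (\<epsilon> * q) \<le> card Y * (\<epsilon> * q)"
    by (simp add: algebra_simps)
  then have bad: "4 * card {u \<in> Y. 4 * \<epsilon> * q < f u} \<le> card Y"
    using \<epsilon> q0 by (simp add: mult_le_cancel_right flip: of_nat_mult)
  have "Y \<subseteq> Z \<union> {u \<in> Y. 4 * \<epsilon> * q < f u} \<union> X'" by (auto simp: Z_def)
  then have "card Y \<le> card (Z \<union> {u \<in> Y. 4 * \<epsilon> * q < f u} \<union> X')"
    using fin fX' by (intro card_mono) (auto simp: Z_def)
  also have "\<dots> \<le> card Z + card {u \<in> Y. 4 * \<epsilon> * q < f u} + card X'"
    by (meson card_Un_le le_trans add_le_mono1)
  finally have "K^h * s \<le> card Z" using bad X'(2) YL qL by (simp add: L_def)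
  moreover have "finite Z" "\<not> has_copy c Z y H"
    using fin Suc.prems(2) XY(2) has_copy_mono[of c Z y H U] by (auto simp: Z_def)
  ultimately obtain Y' where Y': "Y' \<subseteq> Z" "card Y' = q"
      "real (\<Sum>v\<in>Y'. card (nbr c y v Y')) \<le> (1 / 2^h + 4 * \<epsilon>) * (real q)\<^sup>2"
    using Suc.IH unfolding q_def by metis
  have fY': "finite Y'" using Y' \<open>finite Z\<close> finite_subset by auto
  have dis: "X' \<inter> Y' = {}" using Y'(1) by (auto simp: Z_def)
  define W where "W = X' \<union> Y'"
  have cW: "card W = 2 * q" using dis fX' fY' X'(2) Y'(2) by (simp add: W_def card_Un_disjoint)
  have spl: "card (nbr c y v W) = card (nbr c y v X') + card (nbr c y v Y')" for v
  proof -
    have "nbr c y v W = nbr c y v X' \<union> nbr c y v Y'" by (auto simp: nbr_def W_def)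
    moreover have "nbr c y v X' \<inter> nbr c y v Y' = {}" using dis by (auto simp: nbr_def)
    ultimately show ?thesis using fX' fY' by (simp add: card_Un_disjoint)
  qed
  have cross: "real (\<Sum>u\<in>Y'. card (nbr c y u X')) \<le> 4 * \<epsilon> * (real q)\<^sup>2"
  proof -
    have "real (\<Sum>u\<in>Y'. card (nbr c y u X')) \<le> (\<Sum>u\<in>Y'. 4 * \<epsilon> * q)"
      unfolding of_nat_sum by (rule sum_mono) (use Y'(1) in \<open>force simp: Z_def f_def\<close>)
    then show ?thesis using Y'(2) by (simp add: power2_eq_square algebra_simps)
  qed
  have "(\<Sum>v\<in>W. card (nbr c y v W)) = (\<Sum>v\<in>X'. card (nbr c y v W)) + (\<Sum>v\<in>Y'. card (nbr c y v W))"
    unfolding W_def using fX' fY' dis by (rule sum.union_disjoint)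
  also have "\<dots> = (\<Sum>v\<in>X'. card (nbr c y v X')) + (\<Sum>v\<in>Y'. card (nbr c y v Y'))
      + 2 * (\<Sum>u\<in>Y'. card (nbr c y u X'))"
    using nbr_double_count[OF fX' fY', of c y] by (simp add: spl sum.distrib)
  finally have "real (\<Sum>v\<in>W. card (nbr c y v W)) \<le> 2 * (1 / 2^h + 4 * \<epsilon>) * (real q)\<^sup>2 + 2 * (4 * \<epsilon> * (real q)\<^sup>2)"
    using X'(3) Y'(3) cross by (simp only: of_nat_add of_nat_mult)
  \<comment> \<open>Joining two halves averages their density with the cross density
    \<open>4 * \<epsilon>\<close>. Thus \<open>4 * \<epsilon>\<close> is the fixed point of the
    recursion, and the initial excess 1 is halved in each step.\<close>
  also have "\<dots> = (1 / 2^Suc h + 4 * \<epsilon>) * (real (card W))\<^sup>2"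
    by (simp add: cW power2_eq_square field_simps)
  finally have "real (\<Sum>v\<in>W. card (nbr c y v W)) \<le> (1 / 2^Suc h + 4 * \<epsilon>) * (real (card W))\<^sup>2" .
  moreover have "W \<subseteq> U" using X' Y' XY by (auto simp: W_def Z_def)
  ultimately show ?case using cW by (auto simp: q_def)
qed

text \<open>Passage from average to minimum degree. With \<open>Suc h\<close> doublings the low
  density set is twice as large as needed and has average \<open>y\<close>-degree at most
  \<open>5 * \<epsilon>\<close> times its size; at most half of its vertices exceed twice this
  average, and they are discarded.\<close>

lemma dense_set:
  fixes H :: "'a ugraph" and c :: "'b set \<Rightarrow> colour" and \<epsilon> :: real and K s :: nat
  assumes simple: "simple_graph H" and deg: "deg_le H d" and d: "1 \<le> d" and xy: "x \<noteq> y"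
    and \<epsilon>: "0 < \<epsilon>" "\<epsilon> \<le> 1" and K: "16 * d \<le> \<epsilon>^d * K" and s: "1 \<le> \<epsilon> * s" "2 * card (verts H) \<le> \<epsilon>^d * s"
    and U: "finite U" "\<not> has_copy c U y H" "K^Suc h * s \<le> card U" and h: "1 / 2^h \<le> \<epsilon>"
  shows "\<exists>R\<subseteq>U. card R = 2^h * s \<and> (\<forall>v\<in>R. card (R - nbr c x v R) \<le> 32 * \<epsilon> * card R)"
proof -
  have s0: "0 < s" using s(1) by (cases s) auto
  from low_density_set[OF simple deg d \<epsilon> K s0 s(2) U]
  obtain W where W: "W \<subseteq> U" "card W = 2^Suc h * s"
    "real (\<Sum>v\<in>W. card (nbr c y v W)) \<le> (1 / 2^Suc h + 4 * \<epsilon>) * (real (card W))\<^sup>2" by blast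
  have fW: "finite W" using W U finite_subset by auto
  define w where "w = card W"
  have w0: "0 < w" using W s0 by (simp add: w_def)
  have "1 / 2^Suc h + 4 * \<epsilon> \<le> 5 * \<epsilon>" using h \<epsilon> by (simp add: field_simps)
  then have "(1 / 2^Suc h + 4 * \<epsilon>) * (real w)\<^sup>2 \<le> 5 * \<epsilon> * (real w)\<^sup>2"
    by (intro mult_right_mono) auto
  then have 1: "(\<Sum>v\<in>W. real (card (nbr c y v W))) \<le> 5 * \<epsilon> * (real w)\<^sup>2"
    using W(3) by (simp add: w_def)
  define D where "D = {v \<in> W. 10 * \<epsilon> * w < card (nbr c y v W)}"
  have "card D * (10 * \<epsilon> * w) \<le> 5 * \<epsilon> * (real w)\<^sup>2"
    using markov_card[OF fW, of "\<lambda>v. real (card (nbr c y v W))" "10 * \<epsilon> * w"] 1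
    unfolding D_def by linarith
  then have "(2 * card D) * (5 * \<epsilon> * w) \<le> w * (5 * \<epsilon> * w)"
    by (simp add: power2_eq_square algebra_simps)
  then have "2 * card D \<le> w" using \<epsilon> w0 by (simp add: mult_le_cancel_right flip: of_nat_mult)
  moreover have "card (W - D) = w - card D"
    using fW by (simp add: w_def card_Diff_subset D_def)
  ultimately have "2^h * s \<le> card (W - D)" using W(2) by (simp add: w_def)
  then obtain R where R: "R \<subseteq> W - D" "card R = 2^h * s" by (metis obtain_subset_with_card_n)
  have fR: "finite R" using R fW finite_subset by blast
  have wR: "w = 2 * card R" using W(2) R(2) by (simp add: w_def)
  have "s \<le> card R" using R(2) by simp
  then have "\<epsilon> * s \<le> \<epsilon> * card R" using \<epsilon> by simp
  then have eR: "1 \<le> \<epsilon> * card R" using s(1) by linarith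
  have "card (R - nbr c x v R) \<le> 32 * \<epsilon> * card R" if v: "v \<in> R" for v
  proof -
    have "R - nbr c x v R \<subseteq> insert v (nbr c y v W)"
      using nbr_Diff_insert[OF xy, of R c v] R(1) by (auto simp: nbr_def)
    then have "card (R - nbr c x v R) \<le> card (insert v (nbr c y v W))"
      using fW by (intro card_mono) auto
    also have "\<dots> \<le> Suc (card (nbr c y v W))" using card_insert_le_m1 by (simp add: card_insert_if fW)
    finally have "real (card (R - nbr c x v R)) \<le> 1 + card (nbr c y v W)" by linarith
    \<comment> \<open>The first summand pays for \<open>v\<close> itself as its own non-neighbour;
      in the second, \<open>w\<close> is twice \<open>card R\<close>.\<close>
    also have "\<dots> \<le> \<epsilon> * card R + 10 * \<epsilon> * w" using v R eR by (auto simp: D_def)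
    also have "\<dots> = 21 * (\<epsilon> * card R)" by (simp add: wR)
    also have "\<dots> \<le> 32 * (\<epsilon> * card R)" using eR by linarith
    finally show ?thesis by (simp add: mult.assoc)
  qed
  then show ?thesis using R W(1) by blast
qed

section \<open>Disjoint copies\<close>

definition induced :: "'a ugraph \<Rightarrow> 'a set \<Rightarrow> 'a ugraph" where
  "induced F S = \<lparr>verts = S, edges = {e \<in> edges F. e \<subseteq> S}\<rparr>"

lemma verts_induced [simp]: "verts (induced F S) = S"
  by (simp add: induced_def)

lemma edges_induced [simp]: "{u, v} \<in> edges (induced F S) \<longleftrightarrow> {u, v} \<in> edges F \<and> u \<in> S \<and> v \<in> S"
  by (auto simp: induced_def)

lemma simple_induced:
  assumes "simple_graph F" "S \<subseteq> verts F" shows "simple_graph (induced F S)"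
  using assms finite_subset unfolding simple_graph_def induced_def nsets_def by auto

lemma deg_le_induced:
  assumes "simple_graph F" "deg_le F d" "S \<subseteq> verts F" shows "deg_le (induced F S) d"
  unfolding deg_le_def
proof
  fix v assume "v \<in> verts (induced F S)"
  then have v: "v \<in> verts F" using assms(3) by auto
  have "nbh (induced F S) v \<subseteq> nbh F v" by (auto simp: nbh_def)
  then have "card (nbh (induced F S) v) \<le> card (nbh F v)" using assms(1) by (intro card_mono) auto
  then show "card (nbh (induced F S) v) \<le> d" using assms(2) v by (auto simp: deg_le_def)
qed

lemma card_inter_nbr:
  fixes \<eta> :: real
  assumes "finite N" "card N \<le> d" "finite A" "0 \<le> \<eta>"
    and "\<And>z. z \<in> N \<Longrightarrow> card (A - nbr c x (h z) A) \<le> \<eta>"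
  shows "card A - d * \<eta> \<le> card {a \<in> A. \<forall>z\<in>N. a \<in> nbr c x (h z) A}"
proof -
  define B where "B = (\<Union>z\<in>N. A - nbr c x (h z) A)"
  have "real (card B) \<le> (\<Sum>z\<in>N. real (card (A - nbr c x (h z) A)))"
    unfolding B_def using card_UN_le[OF assms(1), of "\<lambda>z. A - nbr c x (h z) A"]
    by (simp flip: of_nat_sum)
  also have "\<dots> \<le> (\<Sum>z\<in>N. \<eta>)" using assms(5) by (rule sum_mono)
  also have "\<dots> \<le> d * \<eta>" using assms(2,4) by (simp add: mult_right_mono)
  finally have B: "card B \<le> d * \<eta>" .
  have "{a \<in> A. \<forall>z\<in>N. a \<in> nbr c x (h z) A} = A - B" by (auto simp: B_def)
  moreover have "B \<subseteq> A" by (auto simp: B_def)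
  ultimately have "card {a \<in> A. \<forall>z\<in>N. a \<in> nbr c x (h z) A} = card A - card B"
    using assms(3) by (simp add: card_Diff_subset finite_subset)
  then show ?thesis using B by linarith
qed

text \<open>Three different embeddings are glued. The part \<open>FE\<close> is prescribed,
  \<open>FD\<close> goes into the dense set \<open>D\<close> by Sauer-Spencer and may fill it
  completely, and the independent part \<open>FI\<close> is placed last, greedily, which is why only
  \<open>J\<close> must have \<open>d * \<eta>\<close> vertices to spare. The hypothesis on edges
  between \<open>J\<close> and \<open>D\<close> is conditional on an edge between \<open>FI\<close>
  and \<open>FD\<close>, so that it is vacuous in the colour which does not occur between the two
  cliques.\<close>

lemma split_embedding:
  fixes F :: "'a ugraph" and c :: "'b set \<Rightarrow> colour" and \<eta> :: real
  assumes simple: "simple_graph F" and deg: "deg_le F d"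
    and verts: "verts F = FD \<union> FI \<union> FE" "FD \<inter> FI = {}" "FD \<inter> FE = {}" "FI \<inter> FE = {}"
    and II: "\<And>u v. u \<in> FI \<Longrightarrow> v \<in> FI \<Longrightarrow> {u, v} \<notin> edges F"
    and DE: "\<And>u v. u \<in> FD \<Longrightarrow> v \<in> FE \<Longrightarrow> {u, v} \<notin> edges F"
    and f0: "inj_on f0 FE" "f0 ` FE \<subseteq> E"
      "\<And>u v. u \<in> FE \<Longrightarrow> v \<in> FE \<Longrightarrow> {u, v} \<in> edges F \<Longrightarrow> c {f0 u, f0 v} = x"
    and disj: "D \<inter> J = {}" "D \<inter> E = {}" "J \<inter> E = {}" and fin: "finite D" "finite J"
    and D: "card FD \<le> card D" "\<And>a. a \<in> D \<Longrightarrow> card (D - nbr c x a D) \<le> \<eta>" "2 * d * \<eta> < card D"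
    and \<eta>: "0 \<le> \<eta>"
    and J: "card FI + d * \<eta> \<le> card J"
    and ID: "\<And>u v a. u \<in> FI \<Longrightarrow> v \<in> FD \<Longrightarrow> {u, v} \<in> edges F \<Longrightarrow> a \<in> D \<Longrightarrow> card (J - nbr c x a J) \<le> \<eta>"
    and IE: "\<And>e. e \<in> E \<Longrightarrow> card (J - nbr c x e J) \<le> \<eta>"
  shows "has_copy c (D \<union> J \<union> E) x F"
proof -
  have finF: "finite FD" "finite FI" "finite FE"
    using simple verts(1) unfolding simple_graph_def by auto
  have FDs: "FD \<subseteq> verts F" using verts by auto
  obtain f1 where f1: "hom c x (induced F FD) f1" "f1 ` FD \<subseteq> D"
    using sauer_spencer[OF simple_induced[OF simple FDs] deg_le_induced[OF simple deg FDs] fin(1) _ D(2,3)] D(1)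
    by auto
  define h where "h v = (if v \<in> FE then f0 v else f1 v)" for v
  define C where "C i = {a \<in> J. \<forall>z\<in>nbh F i. a \<in> nbr c x (h z) J}" for i
  have C: "finite (C i) \<and> card FI \<le> card (C i)" if i: "i \<in> FI" for i
  proof -
    have "card J - d * \<eta> \<le> card (C i)"
      unfolding C_def
    proof (rule card_inter_nbr)
      show "card (nbh F i) \<le> d" using deg i verts(1) by (auto simp: deg_le_def)
      fix z assume z: "z \<in> nbh F i"
      then have ze: "{i, z} \<in> edges F" by (simp add: nbh_def)
      then have "z \<in> FD \<or> z \<in> FE" using II[OF i] nbh_verts[OF simple z] verts(1) by auto
      then show "card (J - nbr c x (h z) J) \<le> \<eta>"
      proof
        assume "z \<in> FD"
        then have "z \<notin> FE" "f1 z \<in> D" using verts f1 by auto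
        then show ?thesis using ID[OF i \<open>z \<in> FD\<close> ze, of "f1 z"] by (simp add: h_def)
      next
        assume "z \<in> FE"
        then show ?thesis using IE[of "f0 z"] f0(2) by (auto simp: h_def)
      qed
    qed (use simple fin \<eta> in auto)
    moreover have "finite (C i)" using fin by (simp add: C_def)
    ultimately show ?thesis using J by linarith
  qed
  obtain g where g: "inj_on g FI" "\<And>i. i \<in> FI \<Longrightarrow> g i \<in> C i"
    using greedy_sdr[OF finF(2), of C] C by blast
  have gJ: "g i \<in> J" if "i \<in> FI" for i using g(2)[OF that] by (simp add: C_def)
  define f where "f v = (if v \<in> FI then g v else h v)" for v
  have fD: "f v = f1 v" "f v \<in> D" if "v \<in> FD" for v
    using that verts f1 by (auto simp: f_def h_def)
  have fE: "f v = f0 v" "f v \<in> E" if "v \<in> FE" for v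
    using that verts f0 by (auto simp: f_def h_def)
  have fI: "f v = g v" "f v \<in> J" if "v \<in> FI" for v
    using that gJ by (auto simp: f_def)
  have edgeI: "c {f i, f z} = x" if "i \<in> FI" "{i, z} \<in> edges F" for i z
  proof -
    have z: "z \<in> nbh F i" using that(2) by (simp add: nbh_def)
    have "z \<notin> FI" using II that by blast
    then have "f z = h z" by (simp add: f_def)
    moreover have "g i \<in> nbr c x (h z) J" using g(2)[OF that(1)] z by (simp add: C_def)
    ultimately show ?thesis using fI(1)[OF that(1)] by (simp add: nbr_def insert_commute)
  qed
  have "hom c x F f"
  proof (rule homI)
    have "inj_on f FD" using f1(1) fD(1) by (auto simp: hom_def inj_on_def)
    moreover have "inj_on f FI" using g(1) fI(1) by (auto simp: inj_on_def)
    moreover have "inj_on f FE" using f0(1) fE(1) by (auto simp: inj_on_def)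
    moreover have "f ` FD \<subseteq> D" "f ` FI \<subseteq> J" "f ` FE \<subseteq> E" using fD(2) fI(2) fE(2) by auto
    ultimately show "inj_on f (verts F)"
      using disj unfolding verts(1) inj_on_def by (smt (verit, ccfv_SIG) Un_iff disjoint_iff image_subset_iff)
    fix u v assume uv: "{u, v} \<in> edges F"
    then have vu: "{v, u} \<in> edges F" by (simp add: insert_commute)
    have uvV: "u \<in> verts F" "v \<in> verts F" using edge_verts[OF simple uv] by auto
    show "c {f u, f v} = x"
    proof (cases "u \<in> FI \<or> v \<in> FI")
      case True
      then show ?thesis using edgeI[OF _ uv] edgeI[OF _ vu] by (auto simp: insert_commute)
    next
      case False
      then have "(u \<in> FD \<and> v \<in> FD) \<or> (u \<in> FE \<and> v \<in> FE)"
        using uvV verts(1) DE[of u v] DE[of v u] uv vu by auto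
      then show ?thesis
      proof
        assume *: "u \<in> FD \<and> v \<in> FD"
        then have "{u, v} \<in> edges (induced F FD)" using uv by simp
        then show ?thesis using f1(1) fD(1) * unfolding hom_def by auto
      next
        assume *: "u \<in> FE \<and> v \<in> FE"
        then show ?thesis using f0(3)[of u v] uv fE(1) by auto
      qed
    qed
  qed
  moreover have "f ` verts F \<subseteq> D \<union> J \<union> E" using fD(2) fI(2) fE(2) verts(1) by auto
  ultimately show ?thesis using has_copy_hom[OF simple] by blast
qed

section \<open>Families of disjoint copies, indexed by arbitrary sets so that deleting copies stays
  within the notation\<close>

definition copies_on :: "'i set \<Rightarrow> 'a ugraph \<Rightarrow> ('a \<times> 'i) ugraph" where
  "copies_on J H = \<lparr>verts = verts H \<times> J, edges = {e \<times> {i} | e i. e \<in> edges H \<and> i \<in> J}\<rparr>"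

lemma copies_eq: "copies n H = copies_on {..<n} H"
  by (simp add: copies_def copies_on_def)

lemma verts_copies_on [simp]: "verts (copies_on J H) = verts H \<times> J"
  by (simp add: copies_on_def)

lemma edges_copies_on:
  assumes "simple_graph H"
  shows "{u, v} \<in> edges (copies_on J H) \<longleftrightarrow> snd u = snd v \<and> snd u \<in> J \<and> {fst u, fst v} \<in> edges H"
proof
  assume "{u, v} \<in> edges (copies_on J H)"
  then obtain e i where e: "{u, v} = e \<times> {i}" "e \<in> edges H" "i \<in> J" by (auto simp: copies_on_def)
  have "u \<in> e \<times> {i}" "v \<in> e \<times> {i}" using e(1) by auto
  moreover have "fst ` {u, v} = e" unfolding e(1) by force
  then have "{fst u, fst v} = e" by simp
  ultimately show "snd u = snd v \<and> snd u \<in> J \<and> {fst u, fst v} \<in> edges H" using e by auto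
next
  assume *: "snd u = snd v \<and> snd u \<in> J \<and> {fst u, fst v} \<in> edges H"
  then have "{u, v} = {fst u, fst v} \<times> {snd u}" by (cases u; cases v) auto
  with * show "{u, v} \<in> edges (copies_on J H)"
    unfolding copies_on_def ugraph.select_convs mem_Collect_eq by blast
qed

lemma simple_copies_on:
  assumes "simple_graph H" "finite J" shows "simple_graph (copies_on J H)"
  unfolding simple_graph_def
proof
  show "finite (verts (copies_on J H))" using assms by (simp add: simple_graph_def)
  show "edges (copies_on J H) \<subseteq> nsets (verts (copies_on J H)) 2"
    using assms by (auto simp: copies_on_def simple_graph_def nsets_def card_cartesian_product)
qed

lemma nbh_copies_on:
  assumes "simple_graph H" "i \<in> J" shows "nbh (copies_on J H) (v, i) = nbh H v \<times> {i}"
  using assms(2) by (auto simp: nbh_def edges_copies_on[OF assms(1)])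

lemma deg_le_copies_on:
  assumes "simple_graph H" "deg_le H d" shows "deg_le (copies_on J H) d"
  using assms(2) by (auto simp: deg_le_def nbh_copies_on[OF assms(1)] card_cartesian_product)

lemma hom_copies_on:
  assumes "simple_graph H"
  shows "hom c x (copies_on J H) f \<longleftrightarrow> inj_on f (verts H \<times> J) \<and> (\<forall>i\<in>J. hom c x H (\<lambda>v. f (v, i)))"
proof
  assume h: "hom c x (copies_on J H) f"
  have "hom c x H (\<lambda>v. f (v, i))" if "i \<in> J" for i
  proof (rule homI)
    show "inj_on (\<lambda>v. f (v, i)) (verts H)" using h that by (auto simp: hom_def inj_on_def)
    fix u v assume "{u, v} \<in> edges H"
    then have "{(u, i), (v, i)} \<in> edges (copies_on J H)" using that by (simp add: edges_copies_on[OF assms])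
    then show "c {f (u, i), f (v, i)} = x" using h hom_edge by metis
  qed
  then show "inj_on f (verts H \<times> J) \<and> (\<forall>i\<in>J. hom c x H (\<lambda>v. f (v, i)))"
    using h by (simp add: hom_def)
next
  assume h: "inj_on f (verts H \<times> J) \<and> (\<forall>i\<in>J. hom c x H (\<lambda>v. f (v, i)))"
  show "hom c x (copies_on J H) f"
  proof (rule homI)
    fix u v assume "{u, v} \<in> edges (copies_on J H)"
    then have *: "snd u = snd v \<and> snd u \<in> J \<and> {fst u, fst v} \<in> edges H"
      by (subst (asm) edges_copies_on[OF assms])
    then have "hom c x H (\<lambda>w. f (w, snd u))" using h by blast
    then have "c {f (fst u, snd u), f (fst v, snd u)} = x" using hom_edge[of c x H "\<lambda>w. f (w, snd u)" "fst u" "fst v"] * by blast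
    then show "c {f u, f v} = x" using * by (metis prod.collapse)
  qed (use h in simp)
qed

lemma has_copy_copies_on_reindex:
  assumes simple: "simple_graph H" and fin: "finite J'" "finite J" and le: "card J' \<le> card J"
    and h: "has_copy c Z x (copies_on J H)"
  shows "has_copy c Z x (copies_on J' H)"
proof -
  obtain r where r: "r ` J' \<subseteq> J" "inj_on r J'" using card_le_inj[OF fin le] by blast
  obtain f where f: "hom c x (copies_on J H) f" "f ` (verts H \<times> J) \<subseteq> Z"
    using h unfolding has_copy_hom[OF simple_copies_on[OF simple fin(2)]] by auto
  define g where "g = (\<lambda>(v, i). f (v, r i))"
  have injf: "inj_on f (verts H \<times> J)" using f(1) by (simp add: hom_def)
  have "inj_on g (verts H \<times> J')"
  proof (rule inj_onI)
    fix a b assume ab: "a \<in> verts H \<times> J'" "b \<in> verts H \<times> J'" "g a = g b"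
    obtain v i w j where [simp]: "a = (v, i)" "b = (w, j)" by (cases a; cases b) auto
    have "(v, r i) = (w, r j)"
      using inj_onD[OF injf, of "(v, r i)" "(w, r j)"] ab r(1) by (auto simp: g_def)
    then show "a = b" using ab r(2) by (auto simp: inj_on_def)
  qed
  moreover have "\<forall>i\<in>J'. hom c x H (\<lambda>v. g (v, i))"
    using f(1) r(1) by (auto simp: g_def hom_copies_on[OF simple])
  ultimately have "hom c x (copies_on J' H) g" by (simp add: hom_copies_on[OF simple])
  moreover have "g ` (verts H \<times> J') \<subseteq> Z" using f(2) r(1) by (fastforce simp: g_def image_subset_iff)
  ultimately show ?thesis unfolding has_copy_hom[OF simple_copies_on[OF simple fin(1)]] by auto
qed

lemma packs_iff:
  assumes "simple_graph H" "finite J"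
  shows "has_copy c Z x (copies_on J H) \<longleftrightarrow> has_copy c Z x (copies (card J) H)"
  unfolding copies_eq
  using has_copy_copies_on_reindex[OF assms(1), of J "{..<card J}" c Z x]
    has_copy_copies_on_reindex[OF assms(1), of "{..<card J}" J c Z x] assms(2) by auto

lemma packs_le:
  assumes "simple_graph H" "has_copy c Z x (copies n H)" "m \<le> n"
  shows "has_copy c Z x (copies m H)"
  using has_copy_copies_on_reindex[OF assms(1), of "{..<m}" "{..<n}"] assms by (simp add: copies_eq)

lemma packs_0 [simp]: "has_copy c Z x (copies 0 H)"
  by (simp add: has_copy_def copies_def)

lemma packs_Un:
  assumes simple: "simple_graph H"
    and h: "has_copy c Z x (copies m H)" "has_copy c Z' x (copies n H)" and disj: "Z \<inter> Z' = {}"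
  shows "has_copy c (Z \<union> Z') x (copies (m + n) H)"
proof -
  have s: "simple_graph (copies_on {..<j} H)" for j :: nat by (rule simple_copies_on[OF simple]) simp
  obtain f where f: "hom c x (copies_on {..<m} H) f" "f ` (verts H \<times> {..<m}) \<subseteq> Z"
    using h(1) unfolding copies_eq has_copy_hom[OF s] by auto
  obtain g where g: "hom c x (copies_on {..<n} H) g" "g ` (verts H \<times> {..<n}) \<subseteq> Z'"
    using h(2) unfolding copies_eq has_copy_hom[OF s] by auto
  define k where "k = (\<lambda>(v, i). if i < m then f (v, i) else g (v, i - m))"
  have injf: "inj_on f (verts H \<times> {..<m})" and injg: "inj_on g (verts H \<times> {..<n})"
    using f(1) g(1) by (auto simp: hom_def)
  have kf: "k (v, i) = f (v, i)" "k (v, i) \<in> Z" if "v \<in> verts H" "i < m" for v i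
    using that f(2) by (auto simp: k_def)
  have kg: "k (v, i) = g (v, i - m)" "k (v, i) \<in> Z'" if "v \<in> verts H" "\<not> i < m" "i < m + n" for v i
  proof -
    show "k (v, i) = g (v, i - m)" using that by (simp add: k_def)
    moreover have "(v, i - m) \<in> verts H \<times> {..<n}" using that by auto
    ultimately show "k (v, i) \<in> Z'" using g(2) by auto
  qed
  have "inj_on k (verts H \<times> {..<m + n})"
  proof (rule inj_onI)
    fix a b assume ab: "a \<in> verts H \<times> {..<m + n}" "b \<in> verts H \<times> {..<m + n}" "k a = k b"
    obtain v i w j where [simp]: "a = (v, i)" "b = (w, j)" by (cases a; cases b) auto
    have vw: "v \<in> verts H" "w \<in> verts H" "i < m + n" "j < m + n" using ab by auto
    consider "i < m" "j < m" | "\<not> i < m" "\<not> j < m" | "i < m" "\<not> j < m" | "\<not> i < m" "j < m" by blast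
    then show "a = b"
    proof cases
      case 1
      then show ?thesis using ab(3) vw kf(1) inj_onD[OF injf, of "(v, i)" "(w, j)"] by auto
    next
      case 2
      then have "(v, i - m) = (w, j - m)"
        using ab(3) vw kg(1) inj_onD[OF injg, of "(v, i - m)" "(w, j - m)"] by auto
      then show ?thesis using 2 by auto
    next
      case 3
      then show ?thesis using kf(2)[of v i] kg(2)[of w j] vw ab(3) disj by auto
    next
      case 4
      then show ?thesis using kf(2)[of w j] kg(2)[of v i] vw ab(3) disj by auto
    qed
  qed
  moreover have "hom c x H (\<lambda>v. k (v, i))" if "i < m + n" for i
  proof (cases "i < m")
    case True
    then show ?thesis using f(1) by (auto simp: k_def hom_copies_on[OF simple])
  next
    case False
    then have "i - m < n" using that by auto
    then show ?thesis using False g(1) by (auto simp: k_def hom_copies_on[OF simple])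
  qed
  ultimately have "hom c x (copies_on {..<m + n} H) k" by (simp add: hom_copies_on[OF simple])
  moreover have "k ` (verts H \<times> {..<m + n}) \<subseteq> Z \<union> Z'"
  proof (clarify)
    fix v i assume "v \<in> verts H" "i < m + n" "k (v, i) \<notin> Z'"
    then show "k (v, i) \<in> Z" using kf(2)[of v i] kg(2)[of v i] by (cases "i < m") auto
  qed
  ultimately show ?thesis unfolding copies_eq has_copy_hom[OF s] by auto
qed

lemma packs_1:
  assumes simple: "simple_graph H" and h: "has_copy c Z x H"
  shows "has_copy c Z x (copies 1 H)"
proof -
  obtain f where f: "hom c x H f" "f ` verts H \<subseteq> Z" using h unfolding has_copy_hom[OF simple] by auto
  have "inj_on (\<lambda>(v, i::nat). f v) (verts H \<times> {..<1})"
    using f(1) by (auto simp: hom_def inj_on_def)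
  then have "hom c x (copies_on {..<1} H) (\<lambda>(v, i::nat). f v)"
    using f(1) by (simp add: hom_copies_on[OF simple] del: One_nat_def)
  then show ?thesis
    unfolding copies_eq has_copy_hom[OF simple_copies_on[OF simple finite_lessThan]] using f(2) by force
qed

lemma has_copy_exact:
  assumes "has_copy c Z x F" obtains X where "X \<subseteq> Z" "card X = card (verts F)" "has_copy c X x F"
proof -
  obtain f where f: "inj_on f (verts F)" "f ` verts F \<subseteq> Z" "\<forall>e\<in>edges F. c (f ` e) = x"
    using assms unfolding has_copy_def by blast
  then have "has_copy c (f ` verts F) x F" unfolding has_copy_def by blast
  then show ?thesis using that[of "f ` verts F"] f card_image by blast
qed

lemma max_pack:
  assumes simple: "simple_graph H" and ne: "verts H \<noteq> {}" and fin: "finite W"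
  shows "\<exists>j Z. Z \<subseteq> W \<and> card Z = card (verts H) * j \<and> has_copy c Z x (copies j H) \<and> \<not> has_copy c (W - Z) x H"
  using fin
proof (induction "card W" arbitrary: W rule: less_induct)
  case less
  show ?case
  proof (cases "has_copy c W x H")
    case False
    then show ?thesis by (intro exI[of _ 0] exI[of _ "{}"]) auto
  next
    case True
    then obtain X where X: "X \<subseteq> W" "card X = card (verts H)" "has_copy c X x H"
      by (rule has_copy_exact)
    have fX: "finite X" using X less.prems finite_subset by auto
    have k: "0 < card (verts H)" using simple ne by (simp add: simple_graph_def card_gt_0_iff)
    have "card (W - X) < card W"
      using X k less.prems fX by (metis card_Diff_subset card_mono diff_less less_le_trans)
    then obtain j Z where jZ: "Z \<subseteq> W - X" "card Z = card (verts H) * j" "has_copy c Z x (copies j H)"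
      "\<not> has_copy c (W - X - Z) x H" using less.hyps less.prems by blast
    have "finite Z" using jZ(1) less.prems finite_subset by blast
    then have "card (X \<union> Z) = card (verts H) * (1 + j)"
      using X jZ fX by (subst card_Un_disjoint) auto
    moreover have "has_copy c (X \<union> Z) x (copies (1 + j) H)"
      using packs_Un[OF simple packs_1[OF simple X(3)] jZ(3)] jZ(1) by auto
    moreover have "W - (X \<union> Z) = W - X - Z" by auto
    ultimately show ?thesis using jZ X by (intro exI[of _ "1 + j"] exI[of _ "X \<union> Z"]) auto
  qed
qed

section \<open>Ramsey numbers of graphs and critical colourings\<close>

lemma ramsey_exists:
  assumes simple: "simple_graph F"
  shows "\<exists>N. \<forall>c :: nat set \<Rightarrow> colour. has_mono_copy c {..<N} F"
proof -
  define m where "m = card (verts F)"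
  obtain r where r: "\<And>(V :: nat set) E. finite V \<Longrightarrow> r \<le> card V \<Longrightarrow>
      \<exists>R\<subseteq>V. card R = m \<and> clique R E \<or> card R = m \<and> indep R E"
    using ramsey2[of m m] by blast
  have "has_mono_copy c {..<r} F" for c :: "nat set \<Rightarrow> colour"
  proof -
    obtain R where R: "R \<subseteq> {..<r}" "card R = m"
      "clique R {e. c e = Red} \<or> indep R {e. c e = Red}"
      using r[of "{..<r}" "{e. c e = Red}"] by auto
    have fR: "finite R" using R(1) finite_subset by auto
    have "finite (verts F)" using simple by (simp add: simple_graph_def)
    then obtain f where f: "f ` verts F \<subseteq> R" "inj_on f (verts F)"
      using card_le_inj[of "verts F" R] fR R(2) by (auto simp: m_def)
    have ne: "f u \<in> R" "f v \<in> R" "f u \<noteq> f v" if "{u, v} \<in> edges F" for u v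
      using edge_verts[OF simple that] f by (auto simp: inj_on_def)
    have "\<exists>x. hom c x F f"
      using R(3)
    proof
      assume cl: "clique R {e. c e = Red}"
      have "hom c Red F f"
        using f(2) cl ne by (intro homI) (auto simp: clique_def)
      then show ?thesis by blast
    next
      assume cl: "indep R {e. c e = Red}"
      have "c {f u, f v} = Blue" if "{u, v} \<in> edges F" for u v
        using cl ne[OF that] by (cases "c {f u, f v}") (auto simp: indep_def)
      then have "hom c Blue F f" using f(2) by (intro homI) auto
      then show ?thesis by blast
    qed
    then show ?thesis using f(1) R(1) unfolding has_mono_copy_def has_copy_hom[OF simple] by (meson order_trans)
  qed
  then show ?thesis by blast
qed

lemma ramsey_number_copy:
  fixes c :: "'b set \<Rightarrow> colour"
  assumes simple: "simple_graph F" and V: "finite V" "ramsey_number F \<le> card V"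
  shows "has_mono_copy c V F"
proof -
  have P: "has_mono_copy c {..<ramsey_number F} F" for c :: "nat set \<Rightarrow> colour"
    using LeastI_ex[OF ramsey_exists[OF simple]] unfolding ramsey_number_def by blast
  obtain r where r: "r ` {..<ramsey_number F} \<subseteq> V" "inj_on r {..<ramsey_number F}"
    using card_le_inj[of "{..<ramsey_number F}" V] V by auto
  from P[of "\<lambda>e. c (r ` e)"] obtain x f where f: "inj_on f (verts F)" "f ` verts F \<subseteq> {..<ramsey_number F}"
    "\<forall>e\<in>edges F. c (r ` (f ` e)) = x" unfolding has_mono_copy_def has_copy_def by blast
  have "inj_on (r \<circ> f) (verts F)" using f r by (meson comp_inj_on inj_on_subset)
  moreover have "(r \<circ> f) ` verts F \<subseteq> V" using f(2) r(1) by auto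
  moreover have "\<forall>e\<in>edges F. c ((r \<circ> f) ` e) = x" using f(3) by (simp add: image_comp)
  ultimately show ?thesis unfolding has_mono_copy_def has_copy_def by blast
qed

lemma critical_colouring:
  assumes simple: "simple_graph F" and ne: "verts F \<noteq> {}"
  obtains c :: "nat set \<Rightarrow> colour" where "\<not> has_mono_copy c {..<ramsey_number F - 1} F"
proof -
  have "has_mono_copy c {..<ramsey_number F} F" for c :: "nat set \<Rightarrow> colour"
    by (rule ramsey_number_copy[OF simple]) simp_all
  \<comment> \<open>Truncated subtraction would make \<open>ramsey_number F - 1\<close> useless at
    0; a graph with a vertex has no copy in the empty set.\<close>
  then have "ramsey_number F \<noteq> 0" using ne by (fastforce simp: has_mono_copy_def has_copy_def)
  then have "ramsey_number F - 1 < ramsey_number F" by simp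
  then have "\<not> (\<forall>c :: nat set \<Rightarrow> colour. has_mono_copy c {..<ramsey_number F - 1} F)"
    using not_less_Least unfolding ramsey_number_def by blast
  then show ?thesis using that by blast
qed

section \<open>The fixed graph with a chosen maximum independent set\<close>

locale bounded_graph =
  fixes H :: "'a ugraph" and d :: nat and I :: "'a set"
  assumes simple: "simple_graph H" and nonempty: "verts H \<noteq> {}" and no_iso: "no_isolated H"
    and deg: "deg_le H d" and independent_I: "independent H I"
    and card_I: "card I = independence_number H"
begin

abbreviation k :: nat where "k \<equiv> card (verts H)"
abbreviation \<alpha> :: nat where "\<alpha> \<equiv> independence_number H"
text \<open>A minimum vertex cover. Every embedding into two different sets splits \<open>H\<close>
  into \<open>cov\<close> and \<open>I\<close>.\<close>

definition cov :: "'a set" where "cov = verts H - I"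

lemma finite_verts: "finite (verts H)"
  using simple by (simp add: simple_graph_def)

lemma I_subset: "I \<subseteq> verts H"
  using independent_I by (simp add: independent_def)

lemma finite_I: "finite I"
  using I_subset finite_verts finite_subset by blast

lemma finite_cov: "finite cov"
  using finite_verts by (simp add: cov_def)

lemma verts_split: "verts H = cov \<union> I" "cov \<inter> I = {}"
  using I_subset by (auto simp: cov_def)

lemma I_no_edge: "u \<in> I \<Longrightarrow> v \<in> I \<Longrightarrow> {u, v} \<notin> edges H"
  using independent_I by (auto simp: independent_def)

lemma card_cov: "card cov + \<alpha> = k"
  using verts_split finite_cov finite_I card_I card_Un_disjoint by metis

lemma independent_le:
  assumes "J \<subseteq> verts H" "\<And>u v. u \<in> J \<Longrightarrow> v \<in> J \<Longrightarrow> {u, v} \<notin> edges H"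
  shows "card J \<le> \<alpha>"
proof -
  have "independent H J"
    unfolding independent_def
  proof (intro conjI ballI notI)
    fix e assume "e \<in> edges H" "e \<subseteq> J"
    then show False using edges_doubleton[OF simple] assms(2) by (metis insert_subset)
  qed (use assms in simp)
  moreover have "finite {I. independent H I}"
    using finite_verts by (auto intro: finite_subset[of _ "Pow (verts H)"] simp: independent_def)
  ultimately show ?thesis unfolding independence_number_def by (intro Max_ge) auto
qed

lemma has_neighbour:
  assumes "v \<in> verts H" obtains u where "u \<in> nbh H v"
proof -
  obtain e where e: "e \<in> edges H" "v \<in> e" using assms no_iso by (auto simp: no_isolated_def)
  obtain a b where "e = {a, b}" using edges_doubleton[OF simple e(1)] by blast
  then have "a \<in> nbh H v \<or> b \<in> nbh H v" using e by (auto simp: nbh_def insert_commute)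
  then show ?thesis using that by blast
qed

lemma k_pos: "0 < k" using finite_verts nonempty by (simp add: card_gt_0_iff)

text \<open>Each vertex outside the cover has a neighbour, and this neighbour lies in the cover
  because \<open>I\<close> is independent. So the cover and its neighbourhoods exhaust
  \<open>H\<close>. This is the only comparison of \<open>k - \<alpha>\<close> with
  \<open>k\<close>, and it also shows \<open>\<alpha> < k\<close>.\<close>

lemma k_le: "k \<le> (d + 1) * (k - \<alpha>)"
proof -
  have "verts H \<subseteq> cov \<union> (\<Union>z\<in>cov. nbh H z)"
  proof
    fix v assume v: "v \<in> verts H"
    obtain u where u: "u \<in> nbh H v" using has_neighbour[OF v] .
    then have "v \<in> nbh H u" "u \<in> verts H" using nbh_sym nbh_verts[OF simple] by fast+
    moreover have "{u, v} \<in> edges H" using \<open>v \<in> nbh H u\<close> by (simp add: nbh_def)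
    ultimately show "v \<in> cov \<union> (\<Union>z\<in>cov. nbh H z)"
      using v I_no_edge[of u v] by (auto simp: cov_def)
  qed
  then have "k \<le> card (cov \<union> (\<Union>z\<in>cov. nbh H z))"
    using finite_cov simple by (intro card_mono) auto
  also have "\<dots> \<le> card cov + card (\<Union>z\<in>cov. nbh H z)" by (rule card_Un_le)
  also have "card (\<Union>z\<in>cov. nbh H z) \<le> (\<Sum>z\<in>cov. card (nbh H z))" by (rule card_UN_le[OF finite_cov])
  also have "\<dots> \<le> (\<Sum>z\<in>cov. d)" using deg by (intro sum_mono) (auto simp: deg_le_def cov_def)
  finally have "k \<le> card cov + card cov * d" by simp
  then show ?thesis using card_cov by (simp flip: card_cov add: algebra_simps)
qed

lemma \<alpha>_less: "\<alpha> < k"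
  using k_le k_pos by (metis diff_is_0_eq' leD linorder_not_less mult_0_right)

lemma cov_nonempty: "cov \<noteq> {}"
  using \<alpha>_less card_cov by auto

lemma d_pos: "1 \<le> d"
proof -
  obtain v where v: "v \<in> verts H" using nonempty by auto
  then obtain u where "u \<in> nbh H v" using has_neighbour by blast
  then have "0 < card (nbh H v)" using simple by (auto simp: card_gt_0_iff)
  then show ?thesis using deg v by (auto simp: deg_le_def)
qed

end

section \<open>Good pairs\<close>

text \<open>The new vertex \<open>v\<close> has colour \<open>x\<close> to all other images, so it
  can stand in for any vertex of \<open>H\<close>, whatever the neighbours of that vertex
  are.\<close>

lemma hom_upd:
  assumes simple: "simple_graph H" and g: "hom c x H g" and u: "u0 \<in> verts H"
    and v: "\<And>w. w \<in> verts H \<Longrightarrow> w \<noteq> u0 \<Longrightarrow> g w \<noteq> v \<and> c {v, g w} = x"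
  shows "hom c x H (g(u0 := v))"
proof (rule homI)
  show "inj_on (g(u0 := v)) (verts H)"
    using g v unfolding hom_def inj_on_def by (metis fun_upd_apply)
  fix a b assume ab: "{a, b} \<in> edges H"
  then have "a \<in> verts H" "b \<in> verts H" "a \<noteq> b" using edge_verts[OF simple] by auto
  then show "c {(g(u0 := v)) a, (g(u0 := v)) b} = x"
    using v[of a] v[of b] hom_edge[OF g ab] by (auto simp: insert_commute)
qed

section \<open>Scales: error terms measured in powers of Q, sizes in powers of \<Gamma>\<close>

locale ramsey_graph = bounded_graph H d I for H :: "'a ugraph" and d I +
  fixes p :: nat
  assumes p_pos: "1 \<le> p" and d_le: "d \<le> 2^p"
begin

definition Q :: real where "Q = 2^p"
text \<open>The exponent comes from the iteration in \<open>dense_subset\<close>, which costs 53 *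
  48 + 53 = 2597 multiples of p^2 d. With \<open>p\<close> about log d this is the source of d log^2
  d in the theorem.\<close>

definition \<Gamma> :: nat where "\<Gamma> = 2^(2600 * p^2 * d)"

lemma Q_ge2: "2 \<le> Q"
  using p_pos power_increasing[of 1 p "2::real"] by (simp add: Q_def)

lemma Q_pos [simp]: "0 < Q" and Q_nonneg [simp]: "0 \<le> Q" and Q_nz [simp]: "Q \<noteq> 0"
  using Q_ge2 by auto

lemma d_le_Q: "real d \<le> Q"
  using d_le by (simp add: Q_def flip: of_nat_le_iff)

lemma Q_pow: "2^m * Q^n \<le> Q^(n + m)"
proof -
  have "2^m \<le> Q^m" using Q_ge2 by (intro power_mono) auto
  then show ?thesis by (simp add: power_add mult.commute)
qed

text \<open>Every error term is written at such a scale. Since \<open>Q\<close> is at least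
  \<open>d\<close> and at least 2, a union over \<open>d\<close> neighbours costs one level
  (\<open>sc_d\<close>), and a gap of j levels absorbs a constant factor 2^j
  (\<open>sc_pow\<close>). This reduces the later estimates to linear arithmetic.\<close>

definition sc :: "real \<Rightarrow> nat \<Rightarrow> real" where "sc a n = a / Q^n"

lemma sc_nonneg: "0 \<le> a \<Longrightarrow> 0 \<le> sc a n"
  by (simp add: sc_def)

lemma sc_pow: "0 \<le> a \<Longrightarrow> m \<le> n \<Longrightarrow> 2^(n - m) * sc a n \<le> sc a m"
proof -
  assume a: "0 \<le> a" "m \<le> n"
  have "2^(n - m) * sc a n = a * (2^(n - m) * Q^m) / (Q^n * Q^m)" by (simp add: sc_def)
  also have "\<dots> \<le> a * Q^n / (Q^n * Q^m)"
    using Q_pow[of "n - m" m] a by (intro divide_right_mono mult_left_mono) auto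
  also have "\<dots> = sc a m" by (simp add: sc_def)
  finally show ?thesis .
qed

lemma sc_d: "0 \<le> a \<Longrightarrow> d * sc a (Suc n) \<le> sc a n"
proof -
  assume a: "0 \<le> a"
  have "d * sc a (Suc n) \<le> Q * sc a (Suc n)"
    using d_le_Q a by (intro mult_right_mono sc_nonneg) auto
  also have "\<dots> = sc a n" by (simp add: sc_def)
  finally show ?thesis .
qed

lemma sc_0: "sc a 0 = a"
  by (simp add: sc_def)

lemma pow_le_\<Gamma>: "m \<le> 2600 * p^2 * d \<Longrightarrow> 2^m \<le> \<Gamma>"
  unfolding \<Gamma>_def by (rule power_increasing) auto

lemma pd_bounds: "p * d \<le> p^2 * d" "p \<le> p * d" "1 \<le> p * d"
  using p_pos d_pos by (auto simp: power2_eq_square)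

lemma \<Gamma>_pos [simp]: "0 < \<Gamma>" by (simp add: \<Gamma>_def)

lemma Q_pow_le_\<Gamma>: "n \<le> 2000 \<Longrightarrow> Q^n \<le> \<Gamma>"
proof -
  assume "n \<le> 2000"
  then have "p * n \<le> p * 2000" by simp
  also have "\<dots> \<le> 2600 * p^2 * d" using pd_bounds by linarith
  finally have "real (2^(p * n)) \<le> \<Gamma>" using pow_le_\<Gamma> of_nat_le_iff by blast
  then show ?thesis by (simp add: Q_def power_mult)
qed

lemma \<Gamma>_ge: "1024 \<le> \<Gamma>"
  using pow_le_\<Gamma>[of 10] pd_bounds by simp

lemma \<Gamma>_div: "0 \<le> a \<Longrightarrow> n \<le> 2000 \<Longrightarrow> a / \<Gamma> \<le> sc a n"
  unfolding sc_def using Q_pow_le_\<Gamma>[of n] by (intro divide_left_mono) auto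

lemma dense_subset:
  fixes c :: "'b set \<Rightarrow> colour"
  assumes xy: "x \<noteq> y" and U: "finite U" "\<not> has_copy c U y H" "\<Gamma> * s \<le> card U" and s: "\<Gamma> * k \<le> s"
  shows "\<exists>R\<subseteq>U. card R = 2^(48 * p) * s \<and> (\<forall>v\<in>R. card (R - nbr c x v R) \<le> sc (card R) 40)"
proof -
  define \<epsilon> where "\<epsilon> = 1 / Q^48"
  \<comment> \<open>The requirement is \<open>16 * d \<le> \<epsilon>^d * K\<close>, where
    \<open>\<epsilon>^d\<close> has exponent 48 p d and 16 d is at most 2^(4 + p); 4 + p + 48 p d is
    at most 53 p d. Likewise 48 p doublings make \<open>1 / 2^h\<close> equal to
    \<open>\<epsilon>\<close>.\<close>
  define K :: nat where "K = 2^(53 * (p * d))"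
  have \<epsilon>2: "\<epsilon> = 1 / 2^(48 * p)" by (simp add: \<epsilon>_def Q_def mult.commute flip: power_mult)
  have \<epsilon>: "0 < \<epsilon>" "\<epsilon> \<le> 1" by (auto simp: \<epsilon>2)
  have ed: "\<epsilon>^d = 1 / 2^(48 * (p * d))" by (simp add: \<epsilon>2 power_one_over mult.assoc flip: power_mult)
  have "\<exists>R\<subseteq>U. card R = 2^(48 * p) * s \<and> (\<forall>v\<in>R. card (R - nbr c x v R) \<le> 32 * \<epsilon> * card R)"
  proof (rule dense_set[OF simple deg d_pos xy \<epsilon>, where K=K])
    have "16 * d * 2^(48 * (p * d)) \<le> 2^4 * 2^p * 2^(48 * (p * d))" using d_le by simp
    also have "\<dots> = 2^(4 + p + 48 * (p * d))" by (simp add: power_add)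
    also have "\<dots> \<le> K" unfolding K_def
      using pd_bounds by (intro power_increasing) linarith+
    finally have "real (16 * d * 2^(48 * (p * d))) \<le> K" using of_nat_le_iff by blast
    then show "16 * real d \<le> \<epsilon>^d * K" by (simp add: ed field_simps)
    have k1: "1 \<le> k" using k_pos by simp
    have "2^(48 * p) \<le> \<Gamma>" using pd_bounds by (intro pow_le_\<Gamma>) linarith
    also have "\<Gamma> \<le> \<Gamma> * k" using k1 by simp
    also have "\<dots> \<le> s" by (rule s)
    finally have "real (2^(48 * p)) \<le> s" using of_nat_le_iff by blast
    then show "1 \<le> \<epsilon> * s" by (simp add: \<epsilon>2 field_simps)
    have "2^(1 + 48 * (p * d)) \<le> \<Gamma>" using pd_bounds by (intro pow_le_\<Gamma>) linarith
    then have "2^(1 + 48 * (p * d)) * k \<le> \<Gamma> * k" by (rule mult_le_mono1)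
    also have "\<dots> \<le> s" by (rule s)
    finally have "real (2^(1 + 48 * (p * d)) * k) \<le> s" using of_nat_le_iff by blast
    then have "2 * real k \<le> \<epsilon>^d * s" by (simp add: ed field_simps)
    then show "real (2 * k) \<le> \<epsilon>^d * s" by simp
    have "K^Suc (48 * p) = 2^(53 * (p * d) * Suc (48 * p))" unfolding K_def by (rule power_mult[symmetric])
    also have "\<dots> \<le> \<Gamma>"
    proof (rule pow_le_\<Gamma>)
      have "53 * (p * d) * Suc (48 * p) = 2544 * (p^2 * d) + 53 * (p * d)"
        by (simp add: power2_eq_square)
      also have "\<dots> \<le> 2600 * p^2 * d" using pd_bounds by linarith
      finally show "53 * (p * d) * Suc (48 * p) \<le> 2600 * p^2 * d" .
    qed
    finally have "K^Suc (48 * p) * s \<le> \<Gamma> * s" by (rule mult_le_mono1)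
    then show "K^Suc (48 * p) * s \<le> card U" using U(3) by linarith
    show "1 / 2^(48 * p) \<le> \<epsilon>" by (simp add: \<epsilon>2)
  qed (use U in auto)
  then obtain R where R: "R \<subseteq> U" "card R = 2^(48 * p) * s"
    "\<And>v. v \<in> R \<Longrightarrow> card (R - nbr c x v R) \<le> 32 * \<epsilon> * card R" by blast
  have "32 * \<epsilon> * card R = 32 * sc (card R) 48" by (simp add: \<epsilon>_def sc_def)
  then have "32 * \<epsilon> * card R \<le> sc (card R) 40"
    using sc_pow[of "card R" 40 48] sc_nonneg[of "card R" 48] by simp
  then show ?thesis using R by (intro exI[of _ R]) fastforce
qed

text \<open>In a good pair, copies of \<open>H\<close> of colour \<open>y\<close> can be embedded by placing a vertex cover
  greedily in \<open>B\<close> and then an independent set in \<open>R\<close>; \<open>\<theta> m\<close> bounds the number of candidates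
  for a vertex of the independent set with \<open>m\<close> placed neighbours.\<close>

definition good :: "('b set \<Rightarrow> colour) \<Rightarrow> colour \<Rightarrow> colour \<Rightarrow> 'b set \<Rightarrow> 'b set \<Rightarrow> nat \<Rightarrow> (nat \<Rightarrow> real) \<Rightarrow> bool" where
  "good c x y R B S \<theta> \<longleftrightarrow> finite R \<and> finite B \<and> R \<inter> B = {} \<and> card R = S \<and> card B = S
    \<and> (\<forall>v\<in>R. card (R - nbr c x v R) \<le> sc S 40) \<and> (\<forall>v\<in>B. card (B - nbr c y v B) \<le> sc S 40)
    \<and> card {b \<in> B. real (card (nbr c y b R)) < 2 * \<theta> 0} \<le> sc S 20
    \<and> (\<forall>m<d. \<forall>C\<subseteq>R. \<theta> m \<le> real (card C) \<longrightarrow> card {b \<in> B. real (card (nbr c y b C)) < \<theta> (Suc m)} \<le> sc S 20)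
    \<and> (\<forall>m\<le>d. S / \<Gamma> \<le> \<theta> m) \<and> sc S 26 \<le> \<theta> 0 \<and> 2 * \<theta> 0 \<le> sc S 16"

lemma goodD:
  fixes \<theta> :: "nat \<Rightarrow> real"
  assumes "good c x y R B S \<theta>"
  shows "finite R" "finite B" "R \<inter> B = {}" "card R = S" "card B = S"
    "\<And>v. v \<in> R \<Longrightarrow> card (R - nbr c x v R) \<le> sc S 40" "\<And>v. v \<in> B \<Longrightarrow> card (B - nbr c y v B) \<le> sc S 40"
    "card {b \<in> B. card (nbr c y b R) < 2 * \<theta> 0} \<le> sc S 20"
    "\<And>m C. m < d \<Longrightarrow> C \<subseteq> R \<Longrightarrow> \<theta> m \<le> card C \<Longrightarrow> card {b \<in> B. card (nbr c y b C) < \<theta> (Suc m)} \<le> sc S 20"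
    "\<And>m. m \<le> d \<Longrightarrow> S / \<Gamma> \<le> \<theta> m" "sc S 26 \<le> \<theta> 0" "2 * \<theta> 0 \<le> sc S 16"
  using assms unfolding good_def by auto

text \<open>If a large part of the pair is sparse in colour \<open>y\<close>, then it is dense in colour \<open>x\<close>, and the
  roles of the two colours are exchanged.\<close>

lemma good_swapped:
  fixes c :: "'b set \<Rightarrow> colour"
  assumes xy: "x \<noteq> y" and fin: "finite C" "finite Y" "C \<inter> Y = {}"
    and nc: "\<not> has_copy c C y H" "\<not> has_copy c Y x H"
    and s: "\<Gamma> * k \<le> s" and size: "2 * \<Gamma> * s \<le> card C" "\<Gamma> * s \<le> card Y"
    and sparse: "\<And>b. b \<in> Y \<Longrightarrow> card (nbr c y b C) \<le> sc (card C) 24"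
  shows "\<exists>R B S \<theta>. R \<union> B \<subseteq> C \<union> Y \<and> s \<le> S \<and> good c y x R B S \<theta>"
proof -
  define S where "S = 2^(48 * p) * s"
  have sS: "s \<le> S" by (simp add: S_def)
  have "0 < \<Gamma> * k" using k_pos by simp
  then have s0: "0 < s" using s by linarith
  then have S0: "0 < S" by (simp add: S_def)
  obtain R where R: "R \<subseteq> Y" "card R = S" "\<And>v. v \<in> R \<Longrightarrow> card (R - nbr c y v R) \<le> sc S 40"
    using dense_subset[OF xy[symmetric] fin(2) nc(2) size(2) s] unfolding S_def by metis
  have fR: "finite R" using R(1) fin finite_subset by blast
  define f where "f v = real (card (nbr c y v R))" for v
  \<comment> \<open>Twice the average number of \<open>y\<close>-neighbours that a vertex of
    \<open>C\<close> has in \<open>R\<close>; at most half of \<open>C\<close> exceeds it. The new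
    \<open>B\<close> is chosen in the other half, so each of its vertices misses at most
    \<open>t\<close> vertices of \<open>R\<close> in colour \<open>x\<close>.\<close>
  define t where "t = 2 * sc S 24"
  have t0: "0 < t" using S0 by (simp add: t_def sc_def)
  have "sum f C = (\<Sum>b\<in>R. real (card (nbr c y b C)))"
    using nbr_double_count[OF fin(1) fR, of c y] by (simp add: f_def flip: of_nat_sum)
  also have "\<dots> \<le> (\<Sum>b\<in>R. sc (card C) 24)" using R(1) sparse by (intro sum_mono) auto
  also have "\<dots> = card C * t / 2" by (simp add: R(2) t_def sc_def)
  finally have "card {v \<in> C. t < f v} * t \<le> card C * t / 2"
    using markov_card[OF fin(1), of f t] by (simp add: f_def)
  then have "(2 * card {v \<in> C. t < f v}) * t \<le> card C * t" by simp
  then have bad: "2 * card {v \<in> C. t < f v} \<le> card C"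
    using t0 by (simp add: mult_le_cancel_right flip: of_nat_mult)
  define Z where "Z = C - {v \<in> C. t < f v}"
  have ZC: "Z \<subseteq> C" by (auto simp: Z_def)
  have "card Z = card C - card {v \<in> C. t < f v}"
    unfolding Z_def using fin(1) by (intro card_Diff_subset) auto
  then have Zs: "\<Gamma> * s \<le> card Z" using bad size(1) by linarith
  have fZ: "finite Z" using fin by (simp add: Z_def)
  have "\<not> has_copy c Z y H" using nc(1) ZC has_copy_mono by blast
  then obtain B where B: "B \<subseteq> Z" "card B = S" "\<And>v. v \<in> B \<Longrightarrow> card (B - nbr c x v B) \<le> sc S 40"
    using dense_subset[OF xy fZ _ Zs s] unfolding S_def by metis
  have fB: "finite B" using B(1) fZ finite_subset by blast
  have disj: "R \<inter> B = {}" using R(1) B(1) ZC fin(3) by auto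
  \<comment> \<open>The thresholds fall linearly, by the number of missing neighbours in each step.
    Hence no vertex of \<open>B\<close> is ever bad, and both exceptional sets in
    \<open>good\<close> are empty.\<close>
  define \<theta> :: "nat \<Rightarrow> real" where "\<theta> m = sc S 16 / 2 - m * t" for m
  have SR: "0 \<le> real S" by simp
  have "d * t = 2 * (d * sc S (Suc 23))" by (simp add: t_def)
  then have dt: "d * t \<le> 2 * (sc S 23)" using sc_d[of S 23] by linarith
  have q23: "128 * (sc S 23) \<le> sc S 16" using sc_pow[of S 16 23] by simp
  have key: "card D - t \<le> card (nbr c x b D)" if "b \<in> B" "D \<subseteq> R" for b D
  proof -
    have "b \<notin> R" using that disj by auto
    then have "R - nbr c x b R = nbr c y b R" by (rule nbr_other[OF xy])
    moreover have "card (nbr c y b R) \<le> t" using that(1) B(1) by (auto simp: Z_def f_def)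
    ultimately show ?thesis using nbr_card_lower[OF fR that(2), of c x b] by simp
  qed
  have q26: "1024 * (sc S 26) \<le> sc S 16" using sc_pow[of S 16 26] by simp
  have th: "sc S 26 \<le> \<theta> m" if "m \<le> d" for m
  proof -
    have "m * t \<le> d * t" using that t0 by simp
    moreover have "0 \<le> sc S 16" by (simp add: sc_nonneg)
    ultimately show ?thesis unfolding \<theta>_def using dt q23 q26 by linarith
  qed
  have e1: "{b \<in> B. card (nbr c x b R) < 2 * \<theta> 0} = {}"
  proof -
    have "2 * \<theta> 0 \<le> card (nbr c x b R)" if "b \<in> B" for b
    proof -
      have "S - t \<le> card (nbr c x b R)" using key[OF that subset_refl] R(2) by simp
      moreover have "t \<le> 2 * (sc S 23)" using dt t0 d_pos by (smt (verit) mult_le_cancel_right1 of_nat_1 of_nat_mono)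
      moreover have "65536 * (sc S 16) \<le> S" using sc_pow[of S 0 16] by (simp add: sc_0)
      moreover have "0 \<le> sc S 23" "0 \<le> sc S 16" by (simp_all add: sc_nonneg)
      ultimately show ?thesis using q23 unfolding \<theta>_def by simp
    qed
    then show ?thesis by force
  qed
  have e2: "{b \<in> B. card (nbr c x b D) < \<theta> (Suc m)} = {}" if "D \<subseteq> R" "\<theta> m \<le> card D" for m D
  proof -
    have "\<theta> (Suc m) \<le> card (nbr c x b D)" if "b \<in> B" for b
    proof -
      have "\<theta> (Suc m) = \<theta> m - t" by (simp add: \<theta>_def algebra_simps)
      then show ?thesis using key[OF that \<open>D \<subseteq> R\<close>] \<open>\<theta> m \<le> card D\<close> by linarith
    qed
    then show ?thesis by force
  qed
  have "good c y x R B S \<theta>"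
    unfolding good_def
  proof (intro conjI allI impI ballI)
    show "card {b \<in> B. card (nbr c x b R) < 2 * \<theta> 0} \<le> sc S 20" unfolding e1 by (simp add: sc_nonneg)
    show "card {b \<in> B. card (nbr c x b D) < \<theta> (Suc m)} \<le> sc S 20" if "D \<subseteq> R" "\<theta> m \<le> card D" for m D
      unfolding e2[OF that] by (simp add: sc_nonneg)
    show "S / \<Gamma> \<le> \<theta> m" if "m \<le> d" for m
      using th[OF that] \<Gamma>_div[of S 26] by simp
    show "sc S 26 \<le> \<theta> 0" using th by simp
    show "2 * \<theta> 0 \<le> sc S 16" by (simp add: \<theta>_def)
  qed (use R B fR fB disj in auto)
  then show ?thesis using R(1) B(1) ZC sS by blast
qed

text \<open>Two dense sets, one of each colour, are taken with geometrically falling thresholds. If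
  one of the two exceptional sets is too large, it is a set \<open>Y\<close> in \<open>B\<close>
  whose vertices all have few \<open>y\<close>-neighbours in some large \<open>C\<close> in
  \<open>R\<close>, and \<open>good_swapped\<close> turns this pair into a good one with the colours
  exchanged.\<close>

lemma good_exists:
  fixes c :: "'b set \<Rightarrow> colour"
  assumes xy: "x \<noteq> y" and fin: "finite X0" "finite Y0" "X0 \<inter> Y0 = {}"
    and nc: "\<not> has_copy c X0 y H" "\<not> has_copy c Y0 x H"
    and s: "\<Gamma> * k \<le> s" and size: "\<Gamma>^3 * s \<le> card X0" "\<Gamma>^3 * s \<le> card Y0"
  shows "\<exists>R B S \<theta>. R \<union> B \<subseteq> X0 \<union> Y0 \<and> s \<le> S \<and> (good c x y R B S \<theta> \<or> good c y x R B S \<theta>)"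
proof -
  \<comment> \<open>A failure may cost a factor \<open>\<Gamma>\<close> in size, and the swapped
    pair needs \<open>2 * \<Gamma> * s\<close> vertices; two spare powers of \<open>\<Gamma>\<close>
    cover both.\<close>
  define s' where "s' = \<Gamma>^2 * s"
  have "s \<le> s'" using \<Gamma>_pos by (simp add: s'_def Suc_le_eq)
  then have s': "\<Gamma> * k \<le> s'" using s by linarith
  have sz: "\<Gamma> * s' \<le> card X0" "\<Gamma> * s' \<le> card Y0"
    using size by (auto simp: s'_def power3_eq_cube power2_eq_square mult.assoc)
  define S where "S = 2^(48 * p) * s'"
  obtain R where R: "R \<subseteq> X0" "card R = S" "\<And>v. v \<in> R \<Longrightarrow> card (R - nbr c x v R) \<le> sc S 40"
    using dense_subset[OF xy fin(1) nc(1) sz(1) s'] unfolding S_def by metis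
  obtain B where B: "B \<subseteq> Y0" "card B = S" "\<And>v. v \<in> B \<Longrightarrow> card (B - nbr c y v B) \<le> sc S 40"
    using dense_subset[OF xy[symmetric] fin(2) nc(2) sz(2) s'] unfolding S_def by metis
  have fR: "finite R" and fB: "finite B" using R(1) B(1) fin finite_subset by blast+
  have disj: "R \<inter> B = {}" using R(1) B(1) fin(3) by auto
  \<comment> \<open>Each placed neighbour may shrink the candidates by \<open>Q^24\<close>, so a
    failure at any \<open>m\<close> means the density required by \<open>good_swapped\<close>. The
    factor 1/2 makes \<open>2 * \<theta> 0\<close> equal to \<open>sc S 24\<close>, so that a
    failure on all of \<open>R\<close> has the same form.\<close>
  define \<theta> :: "nat \<Rightarrow> real" where "\<theta> m = sc S (24 * Suc m) / 2" for m
  have \<theta>Suc: "\<theta> (Suc m) = \<theta> m / Q^24" for m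
    by (simp add: \<theta>_def power_add sc_def)
  have "2 * s' \<le> S" using power_increasing[of 1 "48 * p" "2::nat"] p_pos by (simp add: S_def)
  then have S2: "2 * (\<Gamma>^2 * s) \<le> S" by (simp add: s'_def)
  have \<theta>low: "S / \<Gamma> \<le> \<theta> m" if "m \<le> d" for m
  proof -
    have "2 * Q^(24 * Suc m) \<le> Q * Q^(24 * Suc m)" using Q_ge2 by (intro mult_right_mono) auto
    also have "\<dots> = Q^(1 + 24 * Suc m)" by (simp flip: power_Suc)
    also have "\<dots> \<le> Q^(25 + 24 * d)" using that Q_ge2 by (intro power_increasing) auto
    also have "\<dots> = 2^(25 * p + 24 * (p * d))" by (simp add: Q_def algebra_simps flip: power_mult power_add)
    also have "\<dots> = real (2^(25 * p + 24 * (p * d)))" by simp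
    also have "\<dots> \<le> \<Gamma>" using pd_bounds by (intro of_nat_mono pow_le_\<Gamma>) linarith
    finally have "2 * Q^(24 * Suc m) \<le> \<Gamma>" .
    then have "S / \<Gamma> \<le> S / (2 * Q^(24 * Suc m))" by (intro divide_left_mono) auto
    then show ?thesis by (simp add: \<theta>_def sc_def)
  qed
  show ?thesis
  proof (cases "card {b \<in> B. card (nbr c y b R) < 2 * \<theta> 0} \<le> sc S 20 \<and>
      (\<forall>m<d. \<forall>C\<subseteq>R. \<theta> m \<le> card C \<longrightarrow> card {b \<in> B. card (nbr c y b C) < \<theta> (Suc m)} \<le> sc S 20)")
    case True
    have "sc S 26 \<le> \<theta> 0"
      using sc_pow[of S 24 26] sc_nonneg[of S 26] by (simp add: \<theta>_def)
    moreover have "2 * \<theta> 0 \<le> sc S 16" using sc_pow[of S 16 24] sc_nonneg[of S 24] by (simp add: \<theta>_def)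
    ultimately have "good c x y R B S \<theta>"
      using True R B fR fB disj \<theta>low unfolding good_def by blast
    moreover have "s \<le> S" using S2 \<open>s \<le> s'\<close> s'_def by linarith
    ultimately show ?thesis using R(1) B(1) by blast
  next
    case False
    have "\<exists>C Y. C \<subseteq> R \<and> Y \<subseteq> B \<and> S / \<Gamma> \<le> card C \<and> sc S 20 < card Y
        \<and> (\<forall>b\<in>Y. card (nbr c y b C) \<le> sc (card C) 24)"
    proof (cases "card {b \<in> B. card (nbr c y b R) < 2 * \<theta> 0} \<le> sc S 20")
      case True
      then obtain m C where mC: "m < d" "C \<subseteq> R" "\<theta> m \<le> card C"
        "\<not> card {b \<in> B. card (nbr c y b C) < \<theta> (Suc m)} \<le> sc S 20" using False by blast
      have "\<theta> (Suc m) \<le> sc (card C) 24"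
        unfolding \<theta>Suc using mC(3) by (simp add: sc_def divide_right_mono)
      then have "\<forall>b\<in>{b \<in> B. card (nbr c y b C) < \<theta> (Suc m)}. card (nbr c y b C) \<le> sc (card C) 24" by auto
      moreover have "S / \<Gamma> \<le> card C" using \<theta>low[of m] mC by linarith
      moreover have "{b \<in> B. card (nbr c y b C) < \<theta> (Suc m)} \<subseteq> B" by auto
      ultimately show ?thesis using mC(2,4) not_le by blast
    next
      case F: False
      have "2 * \<theta> 0 = sc (card R) 24" by (simp add: \<theta>_def R(2))
      then have "\<forall>b\<in>{b \<in> B. card (nbr c y b R) < 2 * \<theta> 0}. card (nbr c y b R) \<le> sc (card R) 24" by auto
      moreover have "S / \<Gamma> \<le> card R" unfolding R(2)
        by (simp add: divide_le_eq mult_le_cancel_left1 Suc_leI)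
      moreover have "{b \<in> B. card (nbr c y b R) < 2 * \<theta> 0} \<subseteq> B" by auto
      ultimately show ?thesis using F not_le by blast
    qed
    then obtain C Y where CY: "C \<subseteq> R" "Y \<subseteq> B" "S / \<Gamma> \<le> card C" "sc S 20 < card Y"
        "\<And>b. b \<in> Y \<Longrightarrow> card (nbr c y b C) \<le> sc (card C) 24" by blast
    have S\<Gamma>: "2 * \<Gamma> * s \<le> S / \<Gamma>"
    proof -
      have "real (2 * (\<Gamma>^2 * s)) \<le> S" using S2 of_nat_le_iff by blast
      then show ?thesis by (simp add: field_simps power2_eq_square)
    qed
    have "real (2 * \<Gamma> * s) \<le> card C" using S\<Gamma> CY(3) by linarith
    then have C: "2 * \<Gamma> * s \<le> card C" using of_nat_le_iff by blast
    have "real (\<Gamma> * s) \<le> real (2 * \<Gamma> * s)" by simp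
    also have "\<dots> \<le> S / \<Gamma>" using S\<Gamma> by simp
    also have "\<dots> \<le> sc S 20" by (rule \<Gamma>_div) auto
    finally have "real (\<Gamma> * s) \<le> card Y" using CY(4) by linarith
    then have Y: "\<Gamma> * s \<le> card Y" using of_nat_le_iff by blast
    have "C \<union> Y \<subseteq> X0 \<union> Y0" using CY R B by auto
    moreover have "\<exists>R B S \<theta>. R \<union> B \<subseteq> C \<union> Y \<and> s \<le> S \<and> good c y x R B S \<theta>"
    proof (rule good_swapped[OF xy _ _ _ _ _ s C Y CY(5)])
      show "finite C" "finite Y" using CY fR fB finite_subset by blast+
      show "C \<inter> Y = {}" using CY disj by auto
      show "\<not> has_copy c C y H" using nc(1) CY(1) R(1) has_copy_mono by blast
      show "\<not> has_copy c Y x H" using nc(2) CY(2) B(1) has_copy_mono by blast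
    qed
    ultimately show ?thesis by (meson order_trans)
  qed
qed

end

section \<open>Ties\<close>

lemma sorted_wrt_all:
  assumes "\<And>u v. u \<in> set xs \<Longrightarrow> v \<in> set xs \<Longrightarrow> P u v" shows "sorted_wrt P xs"
  using assms by (simp add: sorted_wrt_iff_nth_less)

context ramsey_graph
begin

abbreviation tie_size :: nat where "tie_size \<equiv> 2 * k - \<alpha>"

lemma k_small:
  assumes "\<Gamma>^2 * k \<le> S"
  shows "real k < S / \<Gamma>" "n \<le> 2000 \<Longrightarrow> real k \<le> sc S n" "0 < S"
proof -
  have "2 * k \<le> \<Gamma> * k" using \<Gamma>_ge by (intro mult_le_mono1) linarith
  then have "k < \<Gamma> * k" using k_pos by linarith
  then have "\<Gamma> * k < \<Gamma> * (\<Gamma> * k)" by simp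
  also have "\<dots> = \<Gamma>^2 * k" by (simp add: power2_eq_square)
  finally have 1: "k * \<Gamma> < S" using assms unfolding mult.commute[of k] by linarith
  then have "real (k * \<Gamma>) < real S" by (rule of_nat_less_iff[THEN iffD2])
  then show *: "real k < S / \<Gamma>" by (simp add: field_simps)
  show "real k \<le> sc S n" if "n \<le> 2000" using \<Gamma>_div[of S n] * that by simp
  show "0 < S" using 1 by linarith
qed

text \<open>The \<open>y\<close>-copy puts \<open>cov\<close> into \<open>B'\<close> and then
  \<open>I\<close> into \<open>R'\<close>. The \<open>x\<close>-copy reuses the images of
  \<open>I\<close> and puts \<open>cov\<close> into the rest of \<open>R'\<close>. The copies share
  exactly the \<alpha> images of \<open>I\<close>. Since \<open>good\<close> is inherited by the
  smaller sets, \<open>\<theta> 0\<close> candidates in \<open>R'\<close> suffice, and the bound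
  \<open>2 * \<theta> 0\<close> inside \<open>good\<close> leaves room for removing used
  vertices.\<close>

lemma base_tie:
  fixes c :: "'b set \<Rightarrow> colour"
  assumes xy: "x \<noteq> y" and good: "good c x y R B S \<theta>" and S: "\<Gamma>^2 * k \<le> S"
    and sub: "R' \<subseteq> R" "B' \<subseteq> B" and size: "\<theta> 0 \<le> card R'" "sc S 12 \<le> card B'"
  shows "\<exists>f g. hom c y H f \<and> hom c x H g \<and> (\<forall>v\<in>cov. f v \<in> B' \<and> g v \<in> R') \<and> (\<forall>v\<in>I. f v = g v \<and> f v \<in> R')"
proof -
  note G = goodD[OF good]
  have finR: "finite R'" and finB: "finite B'" using sub G(1,2) finite_subset by blast+
  have SR: "0 \<le> real S" by simp
  have S0: "0 < real S" using k_small(3)[OF S] by simp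
  have pos: "0 < sc S 12" "0 < sc S 26" using S0 by (auto simp: sc_def)
  have k100: "real k \<le> sc S 100" by (rule k_small(2)[OF S]) simp
  \<comment> \<open>Inside \<open>B\<close> each placed neighbour removes only the few
    non-neighbours in colour \<open>y\<close>; from \<open>B\<close> to \<open>R\<close> the
    thresholds of the good pair are the only information.\<close>
  define t where "t v m = (if v \<in> cov then card B' - m * sc S 40 else \<theta> m)" for v and m :: nat
  \<comment> \<open>In the order \<open>cs @ js\<close> the independent set comes last, so placing
    one of its vertices affects no later neighbour.\<close>
  define \<beta> where "\<beta> v = (if v \<in> cov then sc S 20 else 0)" for v
  define A where "A v = (if v \<in> cov then B' else R')" for v
  obtain cs where cs: "distinct cs" "set cs = cov" using finite_distinct_list[OF finite_cov] by blast
  obtain js where js: "distinct js" "set js = I" using finite_distinct_list[OF finite_I] by blast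
  define P where "P u v \<longleftrightarrow> ({u, v} \<in> edges H \<longrightarrow>
        (\<forall>m<d. \<forall>C\<subseteq>A v. t v m \<le> card C \<longrightarrow>
          real (card {w \<in> A u. card (nbr c y w C) < t v (Suc m)}) \<le> \<beta> u))" for u v
  have Pcov: "P u v" if "u \<in> cov" "v \<in> cov" for u v
    unfolding P_def
  proof (intro impI allI)
    fix m C assume m: "m < d" "C \<subseteq> A v" "t v m \<le> card C"
    have "t v (Suc m) \<le> card (nbr c y w C)" if w: "w \<in> B'" for w
    proof -
      have "card (B - nbr c y w B) \<le> sc S 40" using G(7) w sub by auto
      moreover have "card C - real (card (B - nbr c y w B)) \<le> card (nbr c y w C)"
        using m(2) that sub \<open>v \<in> cov\<close> by (intro nbr_card_lower[OF G(2)]) (auto simp: A_def)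
      ultimately show ?thesis using m(3) \<open>v \<in> cov\<close> by (simp add: t_def algebra_simps)
    qed
    then have "{w \<in> A u. card (nbr c y w C) < t v (Suc m)} = {}"
      using \<open>u \<in> cov\<close> by (force simp: A_def)
    then show "real (card {w \<in> A u. card (nbr c y w C) < t v (Suc m)}) \<le> \<beta> u"
      using sc_nonneg[OF SR] by (simp only: card.empty) (simp add: \<beta>_def)
  qed
  have PcovI: "P u v" if "u \<in> cov" "v \<in> I" for u v
    unfolding P_def
  proof (intro impI allI)
    fix m C assume m: "m < d" "C \<subseteq> A v" "t v m \<le> card C"
    have vc: "v \<notin> cov" using that verts_split by auto
    have "{w \<in> A u. card (nbr c y w C) < t v (Suc m)} \<subseteq> {b \<in> B. card (nbr c y b C) < \<theta> (Suc m)}"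
      using that(1) vc sub by (auto simp: A_def t_def)
    then have "card {w \<in> A u. card (nbr c y w C) < t v (Suc m)} \<le> card {b \<in> B. card (nbr c y b C) < \<theta> (Suc m)}"
      using G(2) by (intro card_mono) auto
    moreover have "card {b \<in> B. card (nbr c y b C) < \<theta> (Suc m)} \<le> sc S 20"
      using m vc sub by (intro G(9)) (auto simp: A_def t_def)
    ultimately show "real (card {w \<in> A u. card (nbr c y w C) < t v (Suc m)}) \<le> \<beta> u"
      using that(1) by (simp add: \<beta>_def)
  qed
  have PI: "P u v" if "u \<in> I" "v \<in> I" for u v using I_no_edge[OF that] by (simp add: P_def)
  have "\<exists>f. hom c y H f \<and> (\<forall>v\<in>verts H. f v \<in> A v)"
  proof (rule candidate_embedding[where t=t and \<beta>=\<beta>, OF simple deg])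
    show "distinct (cs @ js)" using cs js verts_split by auto
    show "set (cs @ js) = verts H" using cs js verts_split by auto
    have "sorted_wrt P (cs @ js)"
      using Pcov PcovI PI cs js by (auto simp: sorted_wrt_append intro!: sorted_wrt_all)
    then show "sorted_wrt (\<lambda>u v. {u, v} \<in> edges H \<longrightarrow>
        (\<forall>m<d. \<forall>C\<subseteq>A v. t v m \<le> card C \<longrightarrow>
          real (card {w \<in> A u. card (nbr c y w C) < t v (Suc m)}) \<le> \<beta> u)) (cs @ js)"
      by (rule sorted_wrt_mono_rel[rotated]) (simp only: P_def)
    fix v
    show "finite (A v)" "0 \<le> \<beta> v" using finR finB sc_nonneg[OF SR] by (auto simp: A_def \<beta>_def)
    show "t v 0 \<le> card (A v)" using size by (auto simp: A_def t_def)
    fix m assume m: "m \<le> d"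
    show "k + d * \<beta> v < t v m"
    proof (cases "v \<in> cov")
      case True
      have "m * sc S 40 \<le> d * sc S (Suc 39)" using m sc_nonneg[OF SR, of 40] by (simp add: mult_right_mono)
      also have "\<dots> \<le> sc S 39" by (rule sc_d[OF SR])
      finally have "m * sc S 40 \<le> sc S 39" .
      moreover have "d * sc S 20 \<le> sc S 19" using sc_d[OF SR, of 19] by simp
      moreover have "128 * sc S 19 \<le> sc S 12" using sc_pow[OF SR, of 12 19] by simp
      moreover have "128 * sc S 39 \<le> sc S 32" using sc_pow[OF SR, of 32 39] by simp
      moreover have "128 * sc S 100 \<le> sc S 93" using sc_pow[OF SR, of 93 100] by simp
      moreover have "sc S 32 \<le> sc S 12" "sc S 93 \<le> sc S 12"
        using sc_pow[OF SR, of 12 32] sc_pow[OF SR, of 12 93] sc_nonneg[OF SR, of 32] sc_nonneg[OF SR, of 93]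
        by auto
      ultimately have "k + d * sc S 20 < card B' - m * sc S 40"
        using size(2) k100 pos by linarith
      then show ?thesis using True by (simp add: t_def \<beta>_def)
    next
      case False
      then show ?thesis using k_small(1)[OF S] G(10)[OF m] by (simp add: t_def \<beta>_def)
    qed
  qed
  then obtain f where f: "hom c y H f" "\<And>v. v \<in> verts H \<Longrightarrow> f v \<in> A v" by blast
  have fcov: "f v \<in> B'" if "v \<in> cov" for v using f(2)[of v] that verts_split by (auto simp: A_def)
  have fI: "f v \<in> R'" if "v \<in> I" for v using f(2)[of v] that verts_split by (auto simp: A_def split: if_splits)
  define R2 where "R2 = R' - f ` I"
  have finR2: "finite R2" using finR by (simp add: R2_def)
  have cR2: "card R' - real k \<le> card R2"
  proof -
    have "card (f ` I) \<le> card I" using finite_I by (rule card_image_le)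
    also have "\<dots> \<le> k" using \<alpha>_less card_I by simp
    finally have "card R' - k \<le> card R' - card (f ` I)" by simp
    also have "\<dots> \<le> card R2" unfolding R2_def using finite_I by (intro diff_card_le_card_Diff) auto
    finally show ?thesis by linarith
  qed
  have R2R: "R2 \<subseteq> R" using sub by (auto simp: R2_def)
  have nonR2: "card (D - nbr c x v D) \<le> sc S 40" if "v \<in> R" "D \<subseteq> R" for v D
  proof -
    have "D - nbr c x v D \<subseteq> R - nbr c x v R" using that by (auto simp: nbr_def)
    then have "card (D - nbr c x v D) \<le> card (R - nbr c x v R)" using G(1) by (intro card_mono) auto
    then show ?thesis using G(6)[OF that(1)] by linarith
  qed
  \<comment> \<open>The images of \<open>I\<close> are already fixed by \<open>f\<close>;
    restricting the candidates to their common \<open>x\<close>-neighbours leaves only the graph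
    induced on \<open>cov\<close> to be embedded.\<close>
  define A2 where "A2 v = {a \<in> R2. \<forall>i\<in>nbh H v \<inter> I. a \<in> nbr c x (f i) R2}" for v
  have A2: "card R2 - d * sc S 40 \<le> card (A2 v)" if "v \<in> cov" for v
    unfolding A2_def
  proof (rule card_inter_nbr)
    have "card (nbh H v \<inter> I) \<le> card (nbh H v)" using simple by (intro card_mono) auto
    then show "card (nbh H v \<inter> I) \<le> d" using deg that by (auto simp: deg_le_def cov_def)
    fix z assume "z \<in> nbh H v \<inter> I"
    then show "card (R2 - nbr c x (f z) R2) \<le> sc S 40"
      using fI sub R2R by (intro nonR2) auto
  qed (use finR2 finite_I sc_nonneg[OF SR] in auto)
  define t2 where "t2 v m = card R2 - d * sc S 40 - m * sc S 40" for v :: 'a and m :: nat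
  have covs: "cov \<subseteq> verts H" by (auto simp: cov_def)
  have "\<exists>g. hom c x (induced H cov) g \<and> (\<forall>v\<in>verts (induced H cov). g v \<in> A2 v)"
  proof (rule candidate_embedding[where t=t2 and \<beta>="\<lambda>_. 0" and ys=cs,
        OF simple_induced[OF simple covs] deg_le_induced[OF simple deg covs] cs(1)])
    show "set cs = verts (induced H cov)" using cs by simp
    have empty: "{w \<in> A2 u. card (nbr c x w C) < t2 v (Suc m)} = {}"
      if "C \<subseteq> A2 v" "t2 v m \<le> card C" for u v m C
    proof -
      have "t2 v (Suc m) \<le> card (nbr c x w C)" if w: "w \<in> A2 u" for w
      proof -
        have "w \<in> R" using w R2R by (auto simp: A2_def)
        moreover have "C \<subseteq> R2" using \<open>C \<subseteq> A2 v\<close> by (auto simp: A2_def)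
        ultimately have "card C - real (card (R2 - nbr c x w R2)) \<le> card (nbr c x w C)"
          "card (R2 - nbr c x w R2) \<le> sc S 40"
          using nonR2 R2R by (auto intro!: nbr_card_lower[OF finR2])
        then show ?thesis using \<open>t2 v m \<le> card C\<close> by (simp add: t2_def algebra_simps)
      qed
      then show ?thesis by force
    qed
    have emptyc: "real (card {w \<in> A2 u. card (nbr c x w C) < t2 v (Suc m)}) \<le> 0"
      if "C \<subseteq> A2 v" "t2 v m \<le> card C" for u v m C
      by (simp only: empty[OF that]) simp
    show "sorted_wrt (\<lambda>u v. {u, v} \<in> edges (induced H cov) \<longrightarrow>
        (\<forall>m<d. \<forall>C\<subseteq>A2 v. t2 v m \<le> card C \<longrightarrow>
          real (card {w \<in> A2 u. card (nbr c x w C) < t2 v (Suc m)}) \<le> 0)) cs"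
      using emptyc by (intro sorted_wrt_all impI allI)
    fix v
    show "finite (A2 v)" using finR2 by (simp add: A2_def)
    assume v: "v \<in> verts (induced H cov)"
    show "t2 v 0 \<le> card (A2 v)" using A2 v by (simp add: t2_def)
    fix m assume "m \<le> d"
    then have "m * sc S 40 \<le> d * sc S 40" using sc_nonneg[OF SR, of 40] by (simp add: mult_right_mono)
    moreover have "d * sc S 40 \<le> sc S 39" using sc_d[OF SR, of 39] by simp
    moreover have "128 * sc S 39 \<le> sc S 32" using sc_pow[OF SR, of 32 39] by simp
    moreover have "128 * sc S 100 \<le> sc S 93" using sc_pow[OF SR, of 93 100] by simp
    moreover have "64 * sc S 32 \<le> sc S 26" "sc S 93 \<le> sc S 26"
      using sc_pow[OF SR, of 26 32] sc_pow[OF SR, of 26 93] sc_nonneg[OF SR, of 93] by auto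
    ultimately have "real k < card R2 - d * sc S 40 - m * sc S 40"
      using k100 cR2 size(1) G(11) pos by linarith
    moreover have "card cov \<le> k" using card_cov by simp
    ultimately show "real (card (verts (induced H cov))) + real d * 0 < t2 v m"
      by (simp add: t2_def)
  qed simp
  then obtain g0 where g0: "hom c x (induced H cov) g0" "\<And>v. v \<in> cov \<Longrightarrow> g0 v \<in> A2 v" by auto
  define g where "g v = (if v \<in> I then f v else g0 v)" for v
  have gcov: "g v = g0 v" "g v \<in> R2" if "v \<in> cov" for v
    using that g0(2)[OF that] verts_split by (auto simp: g_def A2_def)
  have gedge: "c {g u, g v} = x" if "u \<in> cov" "{u, v} \<in> edges H" for u v
  proof (cases "v \<in> I")
    case True
    then have "v \<in> nbh H u \<inter> I" using that by (simp add: nbh_def)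
    then have "g0 u \<in> nbr c x (f v) R2" using g0(2)[OF that(1)] by (simp add: A2_def)
    then show ?thesis using True gcov(1)[OF that(1)] by (simp add: g_def nbr_def insert_commute)
  next
    case False
    then have "v \<in> cov" using edge_verts[OF simple that(2)] verts_split by auto
    then have "{u, v} \<in> edges (induced H cov)" using that by simp
    then show ?thesis using hom_edge[OF g0(1)] gcov(1) that(1) \<open>v \<in> cov\<close> by simp
  qed
  have "hom c x H g"
  proof (rule homI)
    show "inj_on g (verts H)"
    proof (rule inj_onI)
      fix a b assume ab: "a \<in> verts H" "b \<in> verts H" "g a = g b"
      have ig0: "inj_on g0 cov" using g0(1) by (simp add: hom_def)
      have ifI: "inj_on f (verts H)" using f(1) by (simp add: hom_def)
      have ne: "g u \<noteq> g v" if "u \<in> I" "v \<in> cov" for u v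
      proof -
        have "g u \<in> f ` I" using that(1) by (simp add: g_def)
        moreover have "g v \<notin> f ` I" using gcov(2)[OF that(2)] by (simp add: R2_def)
        ultimately show ?thesis by metis
      qed
      show "a = b"
      proof (cases "a \<in> I"; cases "b \<in> I")
        assume "a \<in> I" "b \<in> I"
        then show ?thesis using ab ifI by (auto simp: g_def inj_on_def)
      next
        assume "a \<in> I" "b \<notin> I"
        then show ?thesis using ne[of a b] ab by (auto simp: cov_def)
      next
        assume "a \<notin> I" "b \<in> I"
        then show ?thesis using ne[of b a] ab by (auto simp: cov_def)
      next
        assume "a \<notin> I" "b \<notin> I"
        then show ?thesis using ab ig0 by (auto simp: g_def inj_on_def cov_def)
      qed
    qed
    fix u v assume uv: "{u, v} \<in> edges H"
    then have vu: "{v, u} \<in> edges H" by (simp add: insert_commute)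
    have "u \<in> cov \<or> v \<in> cov" using uv I_no_edge edge_verts[OF simple uv] verts_split by auto
    then show "c {g u, g v} = x" using gedge[OF _ uv] gedge[OF _ vu] by (auto simp: insert_commute)
  qed
  moreover have "g v \<in> R'" if "v \<in> cov" for v using gcov(2)[OF that] by (simp add: R2_def)
  ultimately show ?thesis using f(1) fcov fI by (intro exI[of _ f] exI[of _ g]) (auto simp: g_def)
qed

lemma tie_sets:
  assumes f: "inj_on f (verts H)" and g: "inj_on g (verts H)" and I: "\<And>v. v \<in> I \<Longrightarrow> f v = g v"
    and disj: "\<And>u v. u \<in> cov \<Longrightarrow> v \<in> cov \<Longrightarrow> f u \<noteq> g v"
  shows "card (f ` verts H \<union> g ` verts H) = tie_size"
proof -
  have "f ` verts H \<inter> g ` verts H = f ` I"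
  proof
    have "f ` I = g ` I" using I by auto
    then show "f ` I \<subseteq> f ` verts H \<inter> g ` verts H" using I_subset by blast
    show "f ` verts H \<inter> g ` verts H \<subseteq> f ` I"
    proof
      fix a assume "a \<in> f ` verts H \<inter> g ` verts H"
      then obtain u v where uv: "u \<in> verts H" "v \<in> verts H" "a = f u" "a = g v" by auto
      have "u \<in> I"
      proof (rule ccontr)
        assume "u \<notin> I"
        then have "u \<in> cov" using uv by (simp add: cov_def)
        then have "v \<in> I" using disj[of u v] uv by (auto simp: cov_def)
        then have "f u = f v" using uv I by auto
        then have "u = v" using f uv by (auto simp: inj_on_def)
        then show False using \<open>v \<in> I\<close> \<open>u \<notin> I\<close> by simp
      qed
      then show "a \<in> f ` I" using uv by auto
    qed
  qed
  moreover have "card (f ` I) = \<alpha>" using card_image inj_on_subset[OF f I_subset] card_I by metis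
  moreover have "card (f ` verts H) = k" "card (g ` verts H) = k" using f g card_image by auto
  ultimately show ?thesis
    using card_Un_Int[of "f ` verts H" "g ` verts H"] finite_verts \<alpha>_less by simp
qed

text \<open>The \<open>x\<close>-copy from \<open>base_tie\<close> lies entirely in
  \<open>R'\<close>, hence in the \<open>x\<close>-neighbourhood of \<open>v\<close>, and one of its
  vertices can be replaced by \<open>v\<close>. Nothing is required of the edges from
  \<open>v\<close> to \<open>B\<close>.\<close>

lemma tie_through_x:
  fixes c :: "'b set \<Rightarrow> colour"
  assumes xy: "x \<noteq> y" and good: "good c x y R B S \<theta>" and S: "\<Gamma>^2 * k \<le> S"
    and sub: "R' \<subseteq> nbr c x v R" "B' \<subseteq> B" "v \<notin> B'" and size: "\<theta> 0 \<le> card R'" "sc S 12 \<le> card B'"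
  shows "\<exists>X Y. has_copy c X x H \<and> has_copy c Y y H \<and> v \<in> X \<and> v \<notin> Y
     \<and> X \<union> Y \<subseteq> insert v (R' \<union> B') \<and> card (X \<union> Y) = tie_size"
proof -
  have R'R: "R' \<subseteq> R" using sub(1) nbr_subset by fast
  obtain f g where fg: "hom c y H f" "hom c x H g" "\<And>v. v \<in> cov \<Longrightarrow> f v \<in> B' \<and> g v \<in> R'"
    "\<And>v. v \<in> I \<Longrightarrow> f v = g v \<and> f v \<in> R'"
    using base_tie[OF xy good S R'R sub(2) size] by blast
  \<comment> \<open>Replacing a vertex of the cover leaves the shared images of \<open>I\<close>
    alone, so the union keeps its size.\<close>
  obtain u0 where u0: "u0 \<in> cov" using cov_nonempty by auto
  define g' where "g' = g(u0 := v)"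
  have gR: "g w \<in> R'" if "w \<in> verts H" for w using fg(3)[of w] fg(4)[of w] that verts_split by auto
  have vR: "v \<notin> R'" using sub(1) by (auto simp: nbr_def)
  have g': "hom c x H g'" unfolding g'_def
  proof (rule hom_upd[OF simple fg(2)])
    show "u0 \<in> verts H" using u0 by (simp add: cov_def)
    fix w assume "w \<in> verts H"
    then have "g w \<in> nbr c x v R" using gR sub(1) by auto
    then show "g w \<noteq> v \<and> c {v, g w} = x" by (auto simp: nbr_def)
  qed
  have "card (f ` verts H \<union> g' ` verts H) = tie_size"
  proof (rule tie_sets)
    show "inj_on f (verts H)" "inj_on g' (verts H)" using fg(1) g' by (auto simp: hom_def)
    show "f w = g' w" if "w \<in> I" for w using that fg(4) u0 verts_split by (auto simp: g'_def)
    show "f u \<noteq> g' w" if "u \<in> cov" "w \<in> cov" for u w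
    proof -
      have "f u \<in> B'" "f u \<in> B" using fg(3) that sub by auto
      moreover have "R' \<inter> B = {}" using goodD(3)[OF good] R'R by auto
      ultimately show ?thesis using fg(3)[OF that(2)] sub(3) by (auto simp: g'_def)
    qed
  qed
  moreover have "has_copy c (g' ` verts H) x H" "has_copy c (f ` verts H) y H"
    unfolding has_copy_hom[OF simple] using fg(1) g' by blast+
  moreover have "v \<in> g' ` verts H" using u0 by (auto simp: g'_def cov_def)
  moreover have "f w \<in> R' \<union> B'" if "w \<in> verts H" for w using fg(3)[of w] fg(4)[of w] that verts_split by auto
  ultimately show ?thesis using gR vR sub(3)
    by (intro exI[of _ "g' ` verts H"] exI[of _ "f ` verts H"]) (auto simp: g'_def Un_commute)
qed

text \<open>Here \<open>v\<close> enters the \<open>y\<close>-copy, which uses both sets, so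
  \<open>v\<close> needs many \<open>y\<close>-neighbours in \<open>R\<close> and in
  \<open>B\<close>.\<close>

lemma tie_through_y:
  fixes c :: "'b set \<Rightarrow> colour"
  assumes xy: "x \<noteq> y" and good: "good c x y R B S \<theta>" and S: "\<Gamma>^2 * k \<le> S"
    and sub: "R' \<subseteq> nbr c y v R" "B' \<subseteq> nbr c y v B" and size: "\<theta> 0 \<le> card R'" "sc S 12 \<le> card B'"
  shows "\<exists>X Y. has_copy c X x H \<and> has_copy c Y y H \<and> v \<notin> X \<and> v \<in> Y
     \<and> X \<union> Y \<subseteq> insert v (R' \<union> B') \<and> card (X \<union> Y) = tie_size"
proof -
  have R'R: "R' \<subseteq> R" and B'B: "B' \<subseteq> B" using sub nbr_subset by fast+
  obtain f g where fg: "hom c y H f" "hom c x H g" "\<And>v. v \<in> cov \<Longrightarrow> f v \<in> B' \<and> g v \<in> R'"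
    "\<And>v. v \<in> I \<Longrightarrow> f v = g v \<and> f v \<in> R'"
    using base_tie[OF xy good S R'R B'B size] by blast
  obtain u0 where u0: "u0 \<in> cov" using cov_nonempty by auto
  define f' where "f' = f(u0 := v)"
  have gR: "g w \<in> R'" if "w \<in> verts H" for w using fg(3)[of w] fg(4)[of w] that verts_split by auto
  have fRB: "f w \<in> R' \<union> B'" if "w \<in> verts H" for w using fg(3)[of w] fg(4)[of w] that verts_split by auto
  have vR: "v \<notin> R'" "v \<notin> B'" using sub by (auto simp: nbr_def)
  have f': "hom c y H f'" unfolding f'_def
  proof (rule hom_upd[OF simple fg(1)])
    show "u0 \<in> verts H" using u0 by (simp add: cov_def)
    fix w assume "w \<in> verts H"
    then have "f w \<in> nbr c y v R \<union> nbr c y v B" using fRB sub by auto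
    then show "f w \<noteq> v \<and> c {v, f w} = y" by (auto simp: nbr_def)
  qed
  have "card (f' ` verts H \<union> g ` verts H) = tie_size"
  proof (rule tie_sets)
    show "inj_on f' (verts H)" "inj_on g (verts H)" using fg(2) f' by (auto simp: hom_def)
    show "f' w = g w" if "w \<in> I" for w using that fg(4) u0 verts_split by (auto simp: f'_def)
    show "f' u \<noteq> g w" if "u \<in> cov" "w \<in> cov" for u w
    proof -
      have "f u \<in> B" using fg(3) that B'B by auto
      moreover have "R' \<inter> B = {}" using goodD(3)[OF good] R'R by auto
      ultimately show ?thesis using fg(3)[OF that(2)] vR by (auto simp: f'_def)
    qed
  qed
  moreover have "has_copy c (f' ` verts H) y H" "has_copy c (g ` verts H) x H"
    unfolding has_copy_hom[OF simple] using fg(2) f' by blast+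
  moreover have "v \<in> f' ` verts H" using u0 by (auto simp: f'_def cov_def)
  ultimately show ?thesis using gR fRB vR
    by (intro exI[of _ "g ` verts H"] exI[of _ "f' ` verts H"]) (auto simp: f'_def Un_commute)
qed

lemma is_tieI:
  assumes "x \<noteq> y" "has_copy c X x H" "has_copy c Y y H" "card (X \<union> Y) = tie_size" "X \<union> Y \<subseteq> W"
  shows "is_tie c W H (X \<union> Y)"
proof -
  have "finite (X \<union> Y)" using assms(4) \<alpha>_less by (intro card_ge_0_finite) simp
  moreover have "has_copy c (X \<union> Y) z H" for z
    using assms(1-3) has_copy_mono[of c X x H "X \<union> Y"] has_copy_mono[of c Y y H "X \<union> Y"]
    by (cases x; cases y; cases z) auto
  ultimately show ?thesis using assms(4,5) by (simp add: is_tie_def)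
qed

lemma good_tie:
  fixes c :: "'b set \<Rightarrow> colour"
  assumes xy: "x \<noteq> y" and good: "good c x y R B S \<theta>" and S: "\<Gamma>^2 * k \<le> S"
  shows "\<exists>T. is_tie c (R \<union> B) H T"
proof -
  note G = goodD[OF good]
  have S0: "0 < S" using k_small(3)[OF S] .
  then obtain v where v: "v \<in> R" using G(4) by fastforce
  have SR: "0 \<le> real S" by simp
  have "card R - real (card (R - nbr c x v R)) \<le> card (nbr c x v R)"
    by (rule nbr_card_lower[OF G(1)]) simp
  moreover have "65536 * sc S 16 \<le> S" using sc_pow[OF SR, of 0 16] by (simp add: sc_0)
  moreover have "sc S 40 \<le> sc S 16" using sc_pow[OF SR, of 16 40] sc_nonneg[OF SR, of 40] by simp
  moreover have "0 \<le> sc S 16" by (rule sc_nonneg[OF SR])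
  ultimately have 1: "\<theta> 0 \<le> card (nbr c x v R)" using G(4) G(6)[OF v] G(12) by linarith
  have 2: "sc S 12 \<le> card B" using sc_pow[OF SR, of 0 12] sc_nonneg[OF SR, of 12] G(5) by (simp add: sc_0)
  have "v \<notin> B" using v G(3) by auto
  from tie_through_x[OF xy good S subset_refl subset_refl this 1 2]
  obtain X Y where XY: "has_copy c X x H" "has_copy c Y y H" "card (X \<union> Y) = tie_size"
    "X \<union> Y \<subseteq> insert v (nbr c x v R \<union> B)" by blast
  have "insert v (nbr c x v R \<union> B) \<subseteq> R \<union> B" using v by (auto simp: nbr_def)
  then show ?thesis using is_tieI[OF xy XY(1,2,3)] XY(4) by blast
qed

section \<open>Packing almost all vertices when there are no ties\<close>

definition defect :: nat where "defect = \<Gamma>^6 * k"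

text \<open>A large set without a blue copy has an almost red subset, which contains a red copy by
  Sauer-Spencer.\<close>

lemma no_copies_card:
  fixes c :: "'b set \<Rightarrow> colour"
  assumes "finite U" "\<And>z. \<not> has_copy c U z H" shows "card U < \<Gamma> * (\<Gamma> * k)"
proof (rule ccontr)
  assume "\<not> ?thesis"
  then have "\<Gamma> * (\<Gamma> * k) \<le> card U" by simp
  then obtain R where R: "R \<subseteq> U" "card R = 2^(48 * p) * (\<Gamma> * k)"
      "\<And>v. v \<in> R \<Longrightarrow> card (R - nbr c Red v R) \<le> sc (card R) 40"
    using dense_subset[of Red Blue U c "\<Gamma> * k"] assms by auto
  have fR: "finite R" using R(1) assms finite_subset by blast
  have "1 * k \<le> (2^(48 * p) * \<Gamma>) * k" using \<Gamma>_pos by (intro mult_le_mono1) (simp add: Suc_le_eq)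
  then have kR: "k \<le> card R" using R(2) by (simp add: mult.assoc)
  have "d * sc (card R) 40 \<le> sc (card R) 39" using sc_d[of "card R" 39] by simp
  moreover have "2^39 * sc (card R) 39 \<le> card R" using sc_pow[of "card R" 0 39] by (simp add: sc_0)
  moreover have "0 < real (card R)" using kR k_pos by simp
  ultimately have "2 * d * sc (card R) 40 < card R" by simp
  then have "\<exists>f. hom c Red H f \<and> f ` verts H \<subseteq> R"
    by (intro sauer_spencer[OF simple deg fR kR R(3)]) auto
  then have "has_copy c R Red H" unfolding has_copy_hom[OF simple] .
  then show False using assms(2) R(1) has_copy_mono by blast
qed

text \<open>Otherwise the maximal packings of both colours leave large remainders, one without a
  blue copy and one without a red copy. Their intersection has neither and is small, so they can be
  made disjoint; then they contain a good pair, and with it a tie.\<close>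

lemma tie_free_pack:
  fixes c :: "'b set \<Rightarrow> colour"
  assumes fin: "finite W" and free: "\<not> (\<exists>T. is_tie c W H T)"
  shows "\<exists>z j. has_copy c W z (copies j H) \<and> card W \<le> k * j + defect"
proof (rule ccontr)
  assume contra: "\<not> ?thesis"
  have big: "\<exists>X. X \<subseteq> W \<and> \<not> has_copy c X z H \<and> defect < card X" for z
  proof -
    obtain j Z where jZ: "Z \<subseteq> W" "card Z = k * j" "has_copy c Z z (copies j H)" "\<not> has_copy c (W - Z) z H"
      using max_pack[OF simple nonempty fin] by blast
    have "\<not> card W \<le> k * j + defect" using contra has_copy_mono[OF jZ(3,1)] by blast
    moreover have "card (W - Z) = card W - k * j"
      using jZ(1,2) fin by (simp add: card_Diff_subset finite_subset)
    ultimately show ?thesis using jZ(4) by (intro exI[of _ "W - Z"]) auto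
  qed
  obtain X0 where X0: "X0 \<subseteq> W" "\<not> has_copy c X0 Blue H" "defect < card X0" using big by blast
  obtain Y0 where Y0: "Y0 \<subseteq> W" "\<not> has_copy c Y0 Red H" "defect < card Y0" using big by blast
  have finX: "finite X0" "finite Y0" using X0 Y0 fin finite_subset by blast+
  have "card (X0 \<inter> Y0) < \<Gamma> * (\<Gamma> * k)"
  proof (rule no_copies_card)
    fix z show "\<not> has_copy c (X0 \<inter> Y0) z H"
      using X0(2) Y0(2) has_copy_mono[of c "X0 \<inter> Y0" z H X0] has_copy_mono[of c "X0 \<inter> Y0" z H Y0]
      by (cases z) auto
  qed (use finX in auto)
  moreover have "card (X0 - Y0) = card X0 - card (X0 \<inter> Y0)"
    using finX by (simp add: card_Diff_subset_Int)
  \<comment> \<open>Origin of the exponent 6: the intersection costs the first term, and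
    \<open>good_exists\<close> needs the second to return a pair of size at least
    \<open>\<Gamma>^2 * k\<close>.\<close>
  moreover have "\<Gamma> * (\<Gamma> * k) + \<Gamma>^3 * (\<Gamma>^2 * k) \<le> defect"
  proof -
    have "1 * (\<Gamma> * (\<Gamma> * k)) \<le> \<Gamma>^3 * (\<Gamma> * (\<Gamma> * k))" by (intro mult_le_mono1) (simp add: Suc_le_eq)
    then have "\<Gamma> * (\<Gamma> * k) + \<Gamma>^3 * (\<Gamma>^2 * k) \<le> 2 * (\<Gamma>^5 * k)"
      by (simp add: eval_nat_numeral mult.assoc)
    also have "\<dots> \<le> \<Gamma> * (\<Gamma>^5 * k)" using \<Gamma>_ge by (intro mult_le_mono1) linarith
    also have "\<dots> = defect" by (simp add: defect_def eval_nat_numeral mult.assoc)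
    finally show ?thesis .
  qed
  moreover have "0 \<le> \<Gamma> * (\<Gamma> * k)" by simp
  ultimately have "\<Gamma>^3 * (\<Gamma>^2 * k) \<le> card (X0 - Y0)" "\<Gamma>^3 * (\<Gamma>^2 * k) \<le> card Y0"
    using X0(3) Y0(3) by linarith+
  moreover have "\<Gamma> * k \<le> \<Gamma>^2 * k" using \<Gamma>_pos by (simp add: power2_eq_square Suc_le_eq)
  moreover have "\<not> has_copy c (X0 - Y0) Blue H" using X0(2) has_copy_mono[of c "X0 - Y0" Blue H X0] by auto
  ultimately have "\<exists>R B S \<theta>. R \<union> B \<subseteq> (X0 - Y0) \<union> Y0 \<and> \<Gamma>^2 * k \<le> S
      \<and> (good c Red Blue R B S \<theta> \<or> good c Blue Red R B S \<theta>)"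
    using finX Y0(2) by (intro good_exists) auto
  then obtain R B S \<theta> where good: "R \<union> B \<subseteq> (X0 - Y0) \<union> Y0" "\<Gamma>^2 * k \<le> S"
      "good c Red Blue R B S \<theta> \<or> good c Blue Red R B S \<theta>" by blast
  then have "\<exists>T. is_tie c (R \<union> B) H T" using good_tie by (metis colour.distinct(1))
  moreover have "R \<union> B \<subseteq> W" using good(1) X0 Y0 by auto
  ultimately show False using free unfolding is_tie_def by (meson order_trans)
qed

lemma max_ties:
  fixes c :: "'b set \<Rightarrow> colour"
  assumes "finite V"
  shows "\<exists>t Z. Z \<subseteq> V \<and> card Z = t * tie_size \<and> (\<forall>z. has_copy c Z z (copies t H)) \<and> \<not> (\<exists>T. is_tie c (V - Z) H T)"
  using assms
proof (induction "card V" arbitrary: V rule: less_induct)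
  case less
  show ?case
  proof (cases "\<exists>T. is_tie c V H T")
    case False
    then show ?thesis by (intro exI[of _ 0] exI[of _ "{}"]) auto
  next
    case True
    then obtain T where T: "T \<subseteq> V" "finite T" "card T = tie_size" "has_copy c T Red H" "has_copy c T Blue H"
      by (auto simp: is_tie_def)
    have Tz: "has_copy c T z (copies 1 H)" for z using T(4,5) packs_1[OF simple] by (cases z) auto
    have "0 < tie_size" using \<alpha>_less by simp
    then have "card (V - T) < card V"
      using T less.prems by (metis card_Diff_subset card_mono diff_less less_le_trans)
    then obtain t Z where tZ: "Z \<subseteq> V - T" "card Z = t * tie_size" "\<And>z. has_copy c Z z (copies t H)"
      "\<not> (\<exists>T'. is_tie c (V - T - Z) H T')" using less.hyps[OF _ finite_Diff[OF less.prems]] by (metis (no_types, lifting))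
    have "finite Z" using tZ(1) less.prems finite_subset by blast
    then have "card (T \<union> Z) = (1 + t) * tie_size"
      using T tZ by (subst card_Un_disjoint) auto
    moreover have "has_copy c (T \<union> Z) z (copies (1 + t) H)" for z
      using packs_Un[OF simple Tz tZ(3)] tZ(1) by auto
    moreover have "V - (T \<union> Z) = V - T - Z" by auto
    ultimately show ?thesis using tZ T by (intro exI[of _ "1 + t"] exI[of _ "T \<union> Z"]) auto
  qed
qed

text \<open>Disjoint ties are removed as long as possible, and the rest is packed in one colour.
  Each tie gives a copy of either colour for \<open>tie_size\<close> vertices, and each further copy
  costs only \<open>k\<close>. This matches \<open>ramsey_number_lower\<close> up to a bounded
  error.\<close>

lemma no_mono_card:
  fixes c :: "'b set \<Rightarrow> colour"
  assumes fin: "finite V" and free: "\<not> has_mono_copy c V (copies n H)"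
  shows "card V \<le> n * tie_size + defect"
proof -
  obtain t Z where tZ: "Z \<subseteq> V" "card Z = t * tie_size" "\<And>z. has_copy c Z z (copies t H)"
    "\<not> (\<exists>T. is_tie c (V - Z) H T)" using max_ties[OF fin] by blast
  obtain z j where zj: "has_copy c (V - Z) z (copies j H)" "card (V - Z) \<le> k * j + defect"
    using tie_free_pack[OF _ tZ(4)] fin by auto
  have "has_copy c (Z \<union> (V - Z)) z (copies (t + j) H)" using packs_Un[OF simple tZ(3) zj(1)] by auto
  moreover have "Z \<union> (V - Z) = V" using tZ(1) by auto
  ultimately have "\<not> n \<le> t + j"
    using packs_le[OF simple, of c V z "t + j" n] free unfolding has_mono_copy_def by auto
  moreover have "card V = t * tie_size + card (V - Z)"
    using tZ(1,2) fin by (metis card_Diff_subset card_mono finite_subset le_add_diff_inverse)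
  moreover have "k * j \<le> j * tie_size" using \<alpha>_less by (subst mult.commute) (rule mult_le_mono2, simp)
  ultimately have "card V \<le> (t + j) * tie_size + defect" using zj(2) unfolding add_mult_distrib by linarith
  also have "(t + j) * tie_size \<le> n * tie_size" using \<open>\<not> n \<le> t + j\<close> by (intro mult_le_mono1) simp
  finally show ?thesis by simp
qed

end

section \<open>Transfer to cliques\<close>

definition structured :: "('b set \<Rightarrow> colour) \<Rightarrow> colour \<Rightarrow> colour \<Rightarrow> 'b set \<Rightarrow> 'b set \<Rightarrow> 'b set \<Rightarrow> bool" where
  "structured c x y R B E \<longleftrightarrow> finite R \<and> finite B \<and> finite E \<and> R \<inter> B = {} \<and> R \<inter> E = {} \<and> B \<inter> E = {}
    \<and> (\<forall>u\<in>R. \<forall>v\<in>R. u \<noteq> v \<longrightarrow> c {u, v} = x) \<and> (\<forall>u\<in>B. \<forall>v\<in>B. u \<noteq> v \<longrightarrow> c {u, v} = y)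
    \<and> (\<forall>u\<in>R. \<forall>v\<in>B. c {u, v} = y) \<and> (\<forall>u\<in>R. \<forall>v\<in>E. c {u, v} = y) \<and> (\<forall>u\<in>B. \<forall>v\<in>E. c {u, v} = x)"

lemma structuredD:
  assumes "structured c x y R B E"
  shows "finite R" "finite B" "finite E" "R \<inter> B = {}" "R \<inter> E = {}" "B \<inter> E = {}"
    "\<And>u v. u \<in> R \<Longrightarrow> v \<in> R \<Longrightarrow> u \<noteq> v \<Longrightarrow> c {u, v} = x"
    "\<And>u v. u \<in> B \<Longrightarrow> v \<in> B \<Longrightarrow> u \<noteq> v \<Longrightarrow> c {u, v} = y"
    "\<And>u v. u \<in> R \<Longrightarrow> v \<in> B \<Longrightarrow> c {u, v} = y \<and> c {v, u} = y"
    "\<And>u v. u \<in> R \<Longrightarrow> v \<in> E \<Longrightarrow> c {u, v} = y \<and> c {v, u} = y"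
    "\<And>u v. u \<in> B \<Longrightarrow> v \<in> E \<Longrightarrow> c {u, v} = x \<and> c {v, u} = x"
  using assms unfolding structured_def by (auto simp: insert_commute)

lemma structured_exists:
  fixes c :: "'b set \<Rightarrow> colour"
  assumes "finite R" "finite B" "finite E" "R \<inter> B = {}" "R \<inter> E = {}" "B \<inter> E = {}"
  shows "\<exists>c'. structured c' x y R B E \<and> (\<forall>u\<in>E. \<forall>v\<in>E. c' {u, v} = c {u, v})"
proof -
  define c' where "c' e = (if e \<subseteq> E then c e else if e \<subseteq> R then x else if e \<subseteq> R \<union> B \<union> E \<and> e \<inter> R \<noteq> {} then y
    else if e \<subseteq> B then y else x)" for e
  have "structured c' x y R B E"
    unfolding structured_def using assms by (auto simp: c'_def)
  then show ?thesis by (intro exI[of _ c']) (auto simp: c'_def)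
qed

context bounded_graph
begin

lemma slice_sum:
  fixes f :: "'a \<times> nat \<Rightarrow> 'b"
  assumes "finite M"
  shows "card {p \<in> verts H \<times> M. f p \<in> W} = (\<Sum>i\<in>M. card {v \<in> verts H. f (v, i) \<in> W})"
proof -
  have "bij_betw prod.swap (Sigma M (\<lambda>i. {v \<in> verts H. f (v, i) \<in> W})) {p \<in> verts H \<times> M. f p \<in> W}"
    unfolding bij_betw_def by (auto simp: inj_on_def image_iff)
  then have "card {p \<in> verts H \<times> M. f p \<in> W} = card (Sigma M (\<lambda>i. {v \<in> verts H. f (v, i) \<in> W}))"
    by (rule bij_betw_same_card[symmetric])
  also have "\<dots> = (\<Sum>i\<in>M. card {v \<in> verts H. f (v, i) \<in> W})"
    using assms finite_verts by (intro card_SigmaI) auto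
  finally show ?thesis .
qed

text \<open>At most \<open>card E\<close> copies meet \<open>E\<close>. Deleting \<open>\<tau>\<close> of the other copies leaves a graph whose
  part in \<open>D'\<close> fits exactly into the dense set \<open>D\<close>, while \<open>J\<close> has room to spare.\<close>

lemma transfer_colour:
  fixes c c' :: "'b set \<Rightarrow> colour" and \<eta> :: real
  assumes f: "hom c' z (copies_on {..<n + \<tau>} H) f" "f ` (verts H \<times> {..<n + \<tau>}) \<subseteq> D' \<union> J' \<union> E"
    and disj': "D' \<inter> J' = {}" "D' \<inter> E = {}" "J' \<inter> E = {}" and fin': "finite D'" "finite J'" "finite E"
    and disj: "D \<inter> J = {}" "D \<inter> E = {}" "J \<inter> E = {}" and fin: "finite D" "finite J"
    and EE: "\<And>u v. u \<in> E \<Longrightarrow> v \<in> E \<Longrightarrow> u \<noteq> v \<Longrightarrow> c' {u, v} = c {u, v}"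
    and JJ: "\<And>u v. u \<in> J' \<Longrightarrow> v \<in> J' \<Longrightarrow> u \<noteq> v \<Longrightarrow> c' {u, v} \<noteq> z"
    and DE: "\<And>u v. u \<in> D' \<Longrightarrow> v \<in> E \<Longrightarrow> c' {u, v} \<noteq> z"
    and JD: "(\<forall>u\<in>J'. \<forall>v\<in>D'. c' {u, v} \<noteq> z) \<or> (\<forall>a\<in>D. card (J - nbr c z a J) \<le> \<eta>)"
    and DD: "\<And>a. a \<in> D \<Longrightarrow> card (D - nbr c z a D) \<le> \<eta>" and EJ: "\<And>e. e \<in> E \<Longrightarrow> card (J - nbr c z e J) \<le> \<eta>"
    and \<eta>: "0 \<le> \<eta>" "2 * d * \<eta> < card D"
    and En: "card E \<le> n"
    and few: "\<And>i. i < n + \<tau> \<Longrightarrow> (\<forall>v\<in>verts H. f (v, i) \<notin> E) \<Longrightarrow>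
        card {v \<in> verts H. f (v, i) \<in> J'} \<le> m \<and> l \<le> card {v \<in> verts H. f (v, i) \<in> D'}"
    and D': "card D' \<le> card D + l * \<tau>" and J: "m * n + k * card E + d * \<eta> \<le> card J"
  shows "has_copy c (D \<union> J \<union> E) z (copies n H)"
proof -
  define N where "N = {..<n + \<tau>}"
  \<comment> \<open>The copies that touch \<open>E\<close>. They are disjoint, so there are at most
    \<open>card E\<close>, and \<open>En\<close> leaves at least \<open>\<tau>\<close> copies that
    can be deleted.\<close>
  define Tch where "Tch = {i \<in> N. \<exists>v\<in>verts H. f (v, i) \<in> E}"
  have finN: "finite N" by (simp add: N_def)
  have injf: "inj_on f (verts H \<times> N)" using f(1) by (simp add: hom_def N_def)
  have "\<exists>r. \<forall>i\<in>Tch. r i \<in> verts H \<and> f (r i, i) \<in> E" by (intro bchoice) (auto simp: Tch_def)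
  then obtain r where r: "\<And>i. i \<in> Tch \<Longrightarrow> r i \<in> verts H \<and> f (r i, i) \<in> E" by blast
  have TN: "Tch \<subseteq> N" by (auto simp: Tch_def)
  have cT: "card Tch \<le> card E"
  proof (rule card_inj_on_le)
    show "inj_on (\<lambda>i. f (r i, i)) Tch"
    proof (rule inj_onI)
      fix i j assume ij: "i \<in> Tch" "j \<in> Tch" "f (r i, i) = f (r j, j)"
      then have "(r i, i) = (r j, j)" using r TN by (intro inj_onD[OF injf]) auto
      then show "i = j" by simp
    qed
  qed (use r fin' in auto)
  have "card (N - Tch) = n + \<tau> - card Tch"
    using TN finN by (simp add: card_Diff_subset finite_subset N_def)
  then have "\<tau> \<le> card (N - Tch)" using cT En by linarith
  then obtain T0 where T0: "T0 \<subseteq> N - Tch" "card T0 = \<tau>" by (meson obtain_subset_with_card_n)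
  define M where "M = N - T0"
  have finM: "finite M" using finN by (simp add: M_def)
  have finT0: "finite T0" using T0(1) finN finite_subset by blast
  have cM: "card M = n" unfolding M_def
    using T0 finT0 by (subst card_Diff_subset) (auto simp: N_def)
  define F where "F = copies_on M H"
  have simF: "simple_graph F" unfolding F_def by (rule simple_copies_on[OF simple finM])
  have degF: "deg_le F d" unfolding F_def by (rule deg_le_copies_on[OF simple deg])
  have vF: "verts F = verts H \<times> M" by (simp add: F_def)
  have MN: "M \<subseteq> N" by (auto simp: M_def)
  define FD where "FD = {q \<in> verts H \<times> M. f q \<in> D'}"
  define FI where "FI = {q \<in> verts H \<times> M. f q \<in> J'}"
  define FE where "FE = {q \<in> verts H \<times> M. f q \<in> E}"
  have fz: "c' {f u, f v} = z" and fne: "f u \<noteq> f v" if "{u, v} \<in> edges F" for u v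
  proof -
    have "{u, v} \<in> edges (copies_on {..<n + \<tau>} H)"
      using that MN unfolding F_def edges_copies_on[OF simple] by (auto simp: N_def)
    then show "c' {f u, f v} = z" using hom_edge[OF f(1)] by blast
    have "u \<in> verts H \<times> M" "v \<in> verts H \<times> M" "u \<noteq> v" using edge_verts[OF simF that] vF by auto
    then show "f u \<noteq> f v" using injf MN unfolding inj_on_def by blast
  qed
  define s where "s W i = card {v \<in> verts H. f (v, i) \<in> W}" for W i
  have few': "s J' i \<le> m" "l \<le> s D' i" if "i \<in> N - Tch" for i
    using few[of i] that by (auto simp: s_def N_def Tch_def)
  have sk: "s W i \<le> k" for W i
    unfolding s_def using finite_verts by (intro card_mono) auto
  have cFD: "card FD \<le> card D"
  proof -
    have "(\<Sum>i\<in>N. s D' i) = card {q \<in> verts H \<times> N. f q \<in> D'}"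
      using slice_sum[OF finN, of f D'] by (simp add: s_def)
    also have "\<dots> \<le> card D'"
      using injf fin'(1) by (intro card_inj_on_le[of f]) (auto simp: inj_on_def)
    finally have "(\<Sum>i\<in>N. s D' i) \<le> card D'" .
    moreover have "(\<Sum>i\<in>N. s D' i) = (\<Sum>i\<in>M. s D' i) + (\<Sum>i\<in>T0. s D' i)"
      using T0 finN unfolding M_def by (intro sum.subset_diff) auto
    \<comment> \<open>Each deleted copy frees at least \<open>l\<close> vertices of
      \<open>D'\<close>, which pays exactly for the \<open>l * \<tau>\<close> vertices by which
      \<open>D'\<close> may exceed \<open>D\<close>.\<close>
    moreover have "(\<Sum>i\<in>T0. l) \<le> (\<Sum>i\<in>T0. s D' i)" using few' T0 by (intro sum_mono) auto
    moreover have "card FD = (\<Sum>i\<in>M. s D' i)"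
      unfolding FD_def using slice_sum[OF finM, of f D'] by (simp add: s_def)
    ultimately show ?thesis using D' T0(2) by (simp add: mult.commute)
  qed
  have cFI: "card FI \<le> m * n + k * card E"
  proof -
    have "card FI = (\<Sum>i\<in>M. s J' i)"
      unfolding FI_def using slice_sum[OF finM, of f J'] by (simp add: s_def)
    \<comment> \<open>Copies touching \<open>E\<close> obey no bound in \<open>J'\<close> except
      their order \<open>k\<close>; all others have at most \<open>m\<close> vertices there.\<close>
    also have "\<dots> \<le> (\<Sum>i\<in>M. m + (if i \<in> Tch then k else 0))"
    proof (rule sum_mono)
      fix i assume "i \<in> M"
      then show "s J' i \<le> m + (if i \<in> Tch then k else 0)"
        using few'(1)[of i] sk[of J' i] MN by auto
    qed
    also have "\<dots> = m * n + k * card (M \<inter> Tch)"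
      using finM cM by (simp add: sum.distrib sum.If_cases mult.commute)
    also have "card (M \<inter> Tch) \<le> card E"
      using cT TN finN card_mono[of Tch "M \<inter> Tch"] finite_subset by fastforce
    finally show ?thesis by simp
  qed
  have "has_copy c (D \<union> J \<union> E) z F"
  proof (rule split_embedding[OF simF degF, where FD=FD and FI=FI and FE=FE and ?f0.0=f and \<eta>=\<eta>])
    show "verts F = FD \<union> FI \<union> FE"
      using f(2) MN by (auto simp: vF FD_def FI_def FE_def N_def)
    show "FD \<inter> FI = {}" "FD \<inter> FE = {}" "FI \<inter> FE = {}"
      using disj' by (auto simp: FD_def FI_def FE_def)
    show "{u, v} \<notin> edges F" if "u \<in> FI" "v \<in> FI" for u v
      using JJ[of "f u" "f v"] fz[of u v] fne[of u v] that by (auto simp: FI_def)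
    show "{u, v} \<notin> edges F" if "u \<in> FD" "v \<in> FE" for u v
      using DE[of "f u" "f v"] fz[of u v] that by (auto simp: FD_def FE_def)
    show "inj_on f FE" using inj_on_subset[OF injf, of FE] MN by (auto simp: FE_def)
    show "f ` FE \<subseteq> E" by (auto simp: FE_def)
    show "c {f u, f v} = z" if "u \<in> FE" "v \<in> FE" "{u, v} \<in> edges F" for u v
      using EE[of "f u" "f v"] fz[OF that(3)] fne[OF that(3)] that by (auto simp: FE_def)
    show "card (J - nbr c z a J) \<le> \<eta>" if "u \<in> FI" "v \<in> FD" "{u, v} \<in> edges F" "a \<in> D" for u v a
      using JD
    proof
      assume "\<forall>u\<in>J'. \<forall>v\<in>D'. c' {u, v} \<noteq> z"
      then show ?thesis using fz[OF that(3)] that by (auto simp: FI_def FD_def)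
    qed (use that in auto)
    show "real (card FI) + d * \<eta> \<le> card J"
    proof -
      have "real (card FI) \<le> real (m * n + k * card E)" using cFI by (rule of_nat_mono)
      then show ?thesis using J by simp
    qed
  qed (use disj fin cFD DD EJ \<eta> in auto)
  then show ?thesis unfolding F_def packs_iff[OF simple finM] cM .
qed

text \<open>In colour \<open>x\<close> a copy avoiding \<open>E\<close> lies inside
  \<open>R'\<close>: a vertex in \<open>B'\<close> would have no neighbour of that colour outside
  \<open>E\<close>, and \<open>H\<close> has no isolated vertex. In colour \<open>y\<close> such a
  copy meets \<open>R'\<close> in an independent set, hence \<open>B'\<close> in at least
  \<open>k - \<alpha>\<close> vertices. So \<open>R\<close> plays the tight set \<open>D\<close> for
  \<open>x\<close> with l = k, and \<open>B\<close> for \<open>y\<close> with l = k - \<alpha>,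
  which fixes the numbers of vertices added for each of the \<open>\<tau>\<close> new
  copies.\<close>

lemma transfer:
  fixes c c' :: "'b set \<Rightarrow> colour" and \<eta> :: real
  assumes xy: "x \<noteq> y" and st: "structured c' x y R' B' E"
    and fin: "finite R" "finite B" and disj: "R \<inter> B = {}" "R \<inter> E = {}" "B \<inter> E = {}"
    and EE: "\<And>u v. u \<in> E \<Longrightarrow> v \<in> E \<Longrightarrow> u \<noteq> v \<Longrightarrow> c' {u, v} = c {u, v}"
    and RR: "\<And>v. v \<in> R \<Longrightarrow> card (R - nbr c x v R) \<le> \<eta>" and BB: "\<And>v. v \<in> B \<Longrightarrow> card (B - nbr c y v B) \<le> \<eta>"
    and BR: "\<And>v. v \<in> B \<Longrightarrow> card (R - nbr c y v R) \<le> \<eta>"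
    and ER: "\<And>v. v \<in> E \<Longrightarrow> card (R - nbr c y v R) \<le> \<eta>" and EB: "\<And>v. v \<in> E \<Longrightarrow> card (B - nbr c x v B) \<le> \<eta>"
    and \<eta>: "0 \<le> \<eta>" "2 * d * \<eta> < card R" "2 * d * \<eta> < card B"
    and En: "card E \<le> n" and sB: "k * card E + d * \<eta> \<le> card B" and sR: "\<alpha> * n + k * card E + d * \<eta> \<le> card R"
    and R': "card R' = card R + k * \<tau>" and B': "card B' = card B + (k - \<alpha>) * \<tau>"
    and free: "\<not> has_mono_copy c (R \<union> B \<union> E) (copies n H)"
  shows "\<not> has_mono_copy c' (R' \<union> B' \<union> E) (copies (n + \<tau>) H)"
proof
  assume "has_mono_copy c' (R' \<union> B' \<union> E) (copies (n + \<tau>) H)"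
  then obtain z where z: "has_copy c' (R' \<union> B' \<union> E) z (copies_on {..<n + \<tau>} H)"
    by (auto simp: has_mono_copy_def copies_eq)
  note S = structuredD[OF st]
  obtain f where f: "hom c' z (copies_on {..<n + \<tau>} H) f" "f ` (verts H \<times> {..<n + \<tau>}) \<subseteq> R' \<union> B' \<union> E"
    using z unfolding has_copy_hom[OF simple_copies_on[OF simple finite_lessThan]] by auto
  have homi: "hom c' z H (\<lambda>v. f (v, i))" if "i < n + \<tau>" for i
    using f(1) that unfolding hom_copies_on[OF simple] by simp
  have fin_i: "f (v, i) \<in> R' \<union> B'" if "i < n + \<tau>" "v \<in> verts H" "\<forall>v\<in>verts H. f (v, i) \<notin> E" for v i
  proof -
    have "f (v, i) \<in> f ` (verts H \<times> {..<n + \<tau>})" using that by (intro imageI) auto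
    then show ?thesis using that f(2) by blast
  qed
  have ne_i: "f (u, i) \<noteq> f (v, i) \<and> u \<in> verts H \<and> v \<in> verts H" if "i < n + \<tau>" "{u, v} \<in> edges H" for u v i
    using hom_inj[OF homi[OF that(1)]] edge_verts[OF simple that(2)] by (auto simp: inj_on_def)
  have "z = x \<or> z = y" using xy by (cases x; cases y; cases z) auto
  then have "has_copy c (R \<union> B \<union> E) z (copies n H)"
  proof
    assume zx: "z = x"
    show ?thesis
    proof (rule transfer_colour[where D'=R' and J'=B' and m=0 and l=k and \<eta>=\<eta>, OF f])
      fix i assume i: "i < n + \<tau>" and nE: "\<forall>v\<in>verts H. f (v, i) \<notin> E"
      have no: "f (v, i) \<notin> B'" if v: "v \<in> verts H" for v
      proof
        assume vB: "f (v, i) \<in> B'"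
        obtain u where "u \<in> nbh H v" using has_neighbour[OF v] .
        then have uv: "{v, u} \<in> edges H" by (simp add: nbh_def)
        have "c' {f (v, i), f (u, i)} = x" using hom_edge[OF homi[OF i] uv] zx by simp
        moreover have "f (u, i) \<in> R' \<union> B'" "f (v, i) \<noteq> f (u, i)"
          using fin_i[OF i _ nE] ne_i[OF i uv] by auto
        ultimately show False using S(8,9) vB xy by (metis Un_iff)
      qed
      have e: "{v \<in> verts H. f (v, i) \<in> B'} = {}" using no by auto
      have r: "{v \<in> verts H. f (v, i) \<in> R'} = verts H" using no fin_i[OF i _ nE] by auto
      show "card {v \<in> verts H. f (v, i) \<in> B'} \<le> 0 \<and> k \<le> card {v \<in> verts H. f (v, i) \<in> R'}" unfolding e r by simp
    next
      show "(\<forall>u\<in>B'. \<forall>v\<in>R'. c' {u, v} \<noteq> z) \<or> (\<forall>a\<in>R. card (B - nbr c z a B) \<le> \<eta>)"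
        using S(9) zx xy by auto
      show "real (0 * n + k * card E) + d * \<eta> \<le> card B" using sB by simp
    qed (use S fin disj EE RR EB \<eta> En R' zx xy in auto)
  next
    assume zy: "z = y"
    have "has_copy c (B \<union> R \<union> E) z (copies n H)"
    proof (rule transfer_colour[where D'=B' and J'=R' and m=\<alpha> and l="k - \<alpha>" and \<eta>=\<eta>, OF f(1)])
      show "f ` (verts H \<times> {..<n + \<tau>}) \<subseteq> B' \<union> R' \<union> E" using f(2) by auto
      fix i assume i: "i < n + \<tau>" and nE: "\<forall>v\<in>verts H. f (v, i) \<notin> E"
      have R\<alpha>: "card {v \<in> verts H. f (v, i) \<in> R'} \<le> \<alpha>"
      proof (rule independent_le)
        fix u v assume uv: "u \<in> {v \<in> verts H. f (v, i) \<in> R'}" "v \<in> {v \<in> verts H. f (v, i) \<in> R'}"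
        show "{u, v} \<notin> edges H"
        proof
          assume e: "{u, v} \<in> edges H"
          have "c' {f (u, i), f (v, i)} = y" using hom_edge[OF homi[OF i] e] zy by simp
          then show False using S(7)[of "f (u, i)" "f (v, i)"] uv ne_i[OF i e] xy by auto
        qed
      qed auto
      have "verts H = {v \<in> verts H. f (v, i) \<in> R'} \<union> {v \<in> verts H. f (v, i) \<in> B'}"
        using fin_i[OF i _ nE] by auto
      then have "k = card ({v \<in> verts H. f (v, i) \<in> R'} \<union> {v \<in> verts H. f (v, i) \<in> B'})" by (rule arg_cong)
      also have "\<dots> \<le> card {v \<in> verts H. f (v, i) \<in> R'} + card {v \<in> verts H. f (v, i) \<in> B'}"
        by (rule card_Un_le)
      finally have "k \<le> card {v \<in> verts H. f (v, i) \<in> R'} + card {v \<in> verts H. f (v, i) \<in> B'}" .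
      then show "card {v \<in> verts H. f (v, i) \<in> R'} \<le> \<alpha> \<and> k - \<alpha> \<le> card {v \<in> verts H. f (v, i) \<in> B'}"
        using R\<alpha> by linarith
    next
      show "(\<forall>u\<in>R'. \<forall>v\<in>B'. c' {u, v} \<noteq> z) \<or> (\<forall>a\<in>B. card (R - nbr c z a R) \<le> \<eta>)"
        using BR zy by auto
      show "real (\<alpha> * n + k * card E) + d * \<eta> \<le> card R" using sR by simp
    qed (use S fin disj EE BB ER \<eta> En B' zy xy in auto)
    then show ?thesis by (simp add: Un_commute)
  qed
  then show False using free unfolding has_mono_copy_def by blast
qed

end

section \<open>Trading ties for clique vertices\<close>

lemma fresh_set:
  assumes "finite (E :: nat set)" shows "\<exists>A. finite A \<and> card A = m \<and> A \<inter> E = {}"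
proof -
  have "infinite (- E)" using assms by simp
  then obtain A where "finite A" "card A = m" "A \<subseteq> - E" using infinite_arbitrarily_large by blast
  then show ?thesis by blast
qed

context bounded_graph
begin

lemma clique_hom:
  assumes K: "finite K" "k \<le> card K" "\<forall>u\<in>K. \<forall>v\<in>K. u \<noteq> v \<longrightarrow> c {u, v} = w"
  obtains h where "hom c w H h" "h ` verts H \<subseteq> K"
proof -
  obtain h where h: "h ` verts H \<subseteq> K" "inj_on h (verts H)"
    using card_le_inj[OF finite_verts K(1,2)] by blast
  have "hom c w H h"
  proof (rule homI[OF h(2)])
    fix u v assume "{u, v} \<in> edges H"
    then have uv: "u \<in> verts H" "v \<in> verts H" "u \<noteq> v" using edge_verts[OF simple] by auto
    then have "h u \<noteq> h v" using h(2) by (auto simp: inj_on_def)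
    then show "c {h u, h v} = w" using K(3) h(1) uv by auto
  qed
  then show ?thesis using that h(1) by blast
qed

lemma remove_tie:
  assumes T: "is_tie c V H T" and free: "\<not> has_mono_copy c V (copies n H)" and n: "1 \<le> n"
  shows "\<not> has_mono_copy c (V - T) (copies (n - 1) H)"
proof
  assume "has_mono_copy c (V - T) (copies (n - 1) H)"
  then obtain z where z: "has_copy c (V - T) z (copies (n - 1) H)" by (auto simp: has_mono_copy_def)
  have "has_copy c T z H" using T by (cases z) (auto simp: is_tie_def)
  then have "has_copy c (T \<union> (V - T)) z (copies (1 + (n - 1)) H)"
    using packs_Un[OF simple packs_1[OF simple] z] by blast
  moreover have "T \<union> (V - T) = V" using T by (auto simp: is_tie_def)
  ultimately show False using free n by (auto simp: has_mono_copy_def)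
qed

text \<open>Induction on \<open>card E\<close>. A tie meeting \<open>E\<close> has at most 2k -
  \<alpha> - 1 vertices in either clique, and R gains k and B gains k - \<alpha>, so a clique loses
  fewer than \<open>k\<close> vertices in a step; the shrinking term \<open>k * card E\<close> in
  the size bounds pays for this. The value of \<open>n\<close> is lowered with the tie and restored
  by \<open>transfer\<close> with \<open>\<tau>\<close> = 1.\<close>

lemma eliminate_ties:
  fixes c :: "nat set \<Rightarrow> colour"
  assumes xy: "x \<noteq> y" and st: "structured c x y R B E"
    and free: "\<not> has_mono_copy c (R \<union> B \<union> E) (copies n H)" and En: "card E < n" and Ew: "card E \<le> w"
    and bR: "\<alpha> * n + k * w + 2 * k + 2 * d + 1 + k * card E \<le> card R"
    and bB: "k * w + 2 * k + 2 * d + 1 + k * card E \<le> card B"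
  shows "\<exists>(c' :: nat set \<Rightarrow> colour) R' B' E'. structured c' x y R' B' E' \<and> \<not> has_mono_copy c' (R' \<union> B' \<union> E') (copies n H)
    \<and> card (R' \<union> B' \<union> E') = card (R \<union> B \<union> E)
    \<and> 2 * k + k * card E' \<le> card R' \<and> 2 * k + k * card E' \<le> card B'
    \<and> \<not> (\<exists>T. is_tie c' (R' \<union> B' \<union> E') H T \<and> T \<inter> E' \<noteq> {})"
  using st free En Ew bR bB
proof (induction "card E" arbitrary: c R B E rule: less_induct)
  case less
  note S = structuredD[OF less.prems(1)]
  show ?case
  proof (cases "\<exists>T. is_tie c (R \<union> B \<union> E) H T \<and> T \<inter> E \<noteq> {}")
    case False
    have "2 * k + k * card E \<le> card R" "2 * k + k * card E \<le> card B"
      using less.prems(5,6) by linarith+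
    with less.prems(1,2) False have "structured c x y R B E \<and> \<not> has_mono_copy c (R \<union> B \<union> E) (copies n H)
      \<and> card (R \<union> B \<union> E) = card (R \<union> B \<union> E) \<and> 2 * k + k * card E \<le> card R \<and> 2 * k + k * card E \<le> card B
      \<and> \<not> (\<exists>T. is_tie c (R \<union> B \<union> E) H T \<and> T \<inter> E \<noteq> {})"
      by (intro conjI refl)
    then show ?thesis by (intro exI)
  next
    case True
    then obtain T where T: "is_tie c (R \<union> B \<union> E) H T" "T \<inter> E \<noteq> {}" by blast
    then have T': "T \<subseteq> R \<union> B \<union> E" "finite T" "card T = 2 * k - \<alpha>" by (auto simp: is_tie_def)
    define R1 B1 E1 where "R1 = R - T" and "B1 = B - T" and "E1 = E - T"
    have fin1: "finite R1" "finite B1" "finite E1" using S(1-3) by (auto simp: R1_def B1_def E1_def)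
    \<comment> \<open>The new clique may be any set of naturals off \<open>E1\<close>: only the
      colours inside \<open>E1\<close> are inherited from \<open>c\<close>, and of the old clique
      only the size.\<close>
    obtain R2 where R2: "finite R2" "card R2 = card R1 + k * 1" "R2 \<inter> E1 = {}"
      using fresh_set[OF fin1(3)] by blast
    obtain B2 where B2: "finite B2" "card B2 = card B1 + (k - \<alpha>) * 1" "B2 \<inter> (E1 \<union> R2) = {}"
      using fresh_set[of "E1 \<union> R2"] fin1(3) R2(1) by blast
    obtain c' where c': "structured c' x y R2 B2 E1" "\<And>u v. u \<in> E1 \<Longrightarrow> v \<in> E1 \<Longrightarrow> c' {u, v} = c {u, v}"
      using structured_exists[of R2 B2 E1 x y c] R2 B2 fin1(3) by blast
    have TE: "1 \<le> card (T \<inter> E)" using T(2) T'(2) by (simp add: Suc_le_eq card_gt_0_iff)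
    have Tsplit: "card (T \<inter> R) + card (T \<inter> B) + card (T \<inter> E) = 2 * k - \<alpha>"
    proof -
      have "T = (T \<inter> R) \<union> (T \<inter> B) \<union> (T \<inter> E)" using T'(1) by auto
      then have "card T = card ((T \<inter> R) \<union> (T \<inter> B) \<union> (T \<inter> E))" by simp
      also have "\<dots> = card (T \<inter> R) + card (T \<inter> B) + card (T \<inter> E)"
        using S(4-6) T'(2) by (subst card_Un_disjoint; (subst card_Un_disjoint)?) auto
      finally show ?thesis using T'(3) by simp
    qed
    have cR1: "card R1 + card (T \<inter> R) = card R" and cB1: "card B1 + card (T \<inter> B) = card B"
      and cE1: "card E1 + card (T \<inter> E) = card E"
      using S(1-3) card_Int_Diff[of R T] card_Int_Diff[of B T] card_Int_Diff[of E T]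
      by (simp_all add: R1_def B1_def E1_def Int_commute)
    have kE: "k * card E1 + k \<le> k * card E"
    proof -
      have "Suc (card E1) \<le> card E" using cE1 TE by simp
      then have "k * Suc (card E1) \<le> k * card E" by (rule mult_le_mono2)
      then show ?thesis by simp
    qed
    have n1: "1 \<le> n" using less.prems(3) by simp
    have "V - T = R1 \<union> B1 \<union> E1" if "V = R \<union> B \<union> E" for V using that by (auto simp: R1_def B1_def E1_def)
    then have free1: "\<not> has_mono_copy c (R1 \<union> B1 \<union> E1) (copies (n - 1) H)"
      using remove_tie[OF T(1) less.prems(2) n1] by simp
    \<comment> \<open>In a true clique the only non-neighbour of \<open>v\<close> is
      \<open>v\<close> itself, whence \<eta> = 1 rather than 0.\<close>
    have small: "real (card (D - nbr c z v D)) \<le> 1" if "\<And>u. u \<in> D \<Longrightarrow> u \<noteq> v \<Longrightarrow> c {v, u} = z" for D z v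
    proof -
      have "D - nbr c z v D \<subseteq> {v}" using that by (auto simp: nbr_def)
      then have "card (D - nbr c z v D) \<le> card {v}" by (intro card_mono) auto
      then show ?thesis by simp
    qed
    have an: "\<alpha> * (n - 1) \<le> \<alpha> * n" by simp
    have "\<not> has_mono_copy c' (R2 \<union> B2 \<union> E1) (copies (n - 1 + 1) H)"
    proof (rule transfer[OF xy c'(1), where R=R1 and B=B1 and c=c and \<eta>=1])
      show "R1 \<inter> B1 = {}" "R1 \<inter> E1 = {}" "B1 \<inter> E1 = {}" using S(4-6) by (auto simp: R1_def B1_def E1_def)
      have "2 * d < card R1" "2 * d < card B1"
        using less.prems(5,6) Tsplit TE cR1 cB1 by linarith+
      then show "real (2 * d) * 1 < card R1" "real (2 * d) * 1 < card B1" by linarith+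
      show "card E1 \<le> n - 1" using less.prems(3) cE1 TE by linarith
      have "k * card E1 + d \<le> card B1" using less.prems(6) Tsplit TE cB1 kE by linarith
      then have "real (k * card E1 + d) \<le> card B1" by (rule of_nat_mono)
      then show "real (k * card E1) + real d * 1 \<le> card B1" by simp
      have "\<alpha> * (n - 1) + k * card E1 + d \<le> card R1" using less.prems(5) Tsplit TE cR1 kE an by linarith
      then have "real (\<alpha> * (n - 1) + k * card E1 + d) \<le> card R1" by (rule of_nat_mono)
      then show "real (\<alpha> * (n - 1) + k * card E1) + real d * 1 \<le> card R1" by simp
      show "card (R1 - nbr c x v R1) \<le> (1::real)" if "v \<in> R1" for v
        by (rule small) (use that S(7) in \<open>auto simp: R1_def\<close>)
      show "card (B1 - nbr c y v B1) \<le> (1::real)" if "v \<in> B1" for v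
        by (rule small) (use that S(8) in \<open>auto simp: B1_def\<close>)
      show "card (R1 - nbr c y v R1) \<le> (1::real)" if "v \<in> B1" for v
        by (rule small) (use that S(9) in \<open>auto simp: B1_def R1_def\<close>)
      show "card (R1 - nbr c y v R1) \<le> (1::real)" if "v \<in> E1" for v
        by (rule small) (use that S(10) in \<open>auto simp: E1_def R1_def\<close>)
      show "card (B1 - nbr c x v B1) \<le> (1::real)" if "v \<in> E1" for v
        by (rule small) (use that S(11) in \<open>auto simp: E1_def B1_def\<close>)
    qed (use fin1 c'(2) R2 B2 free1 in auto)
    then have free2: "\<not> has_mono_copy c' (R2 \<union> B2 \<union> E1) (copies n H)" using n1 by simp
    have tot: "card (R2 \<union> B2 \<union> E1) = card (R \<union> B \<union> E)"
    proof -
      have "card (R2 \<union> B2 \<union> E1) = card R2 + card B2 + card E1"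
        using R2 B2 fin1 by (subst card_Un_disjoint; (subst card_Un_disjoint)?) auto
      moreover have "card (R \<union> B \<union> E) = card R + card B + card E"
        using S(1-6) by (subst card_Un_disjoint; (subst card_Un_disjoint)?) auto
      ultimately show ?thesis using R2(2) B2(2) cR1 cB1 cE1 Tsplit \<alpha>_less by linarith
    qed
    have "card E1 < card E" using cE1 TE by linarith
    moreover have "card E1 < n" "card E1 \<le> w" using less.prems(3,4) cE1 TE by linarith+
    moreover have "\<alpha> * n + k * w + 2 * k + 2 * d + 1 + k * card E1 \<le> card R2"
      "k * w + 2 * k + 2 * d + 1 + k * card E1 \<le> card B2"
      using less.prems(5,6) R2(2) B2(2) cR1 cB1 Tsplit TE kE \<alpha>_less by linarith+
    ultimately show ?thesis using less.hyps[OF _ c'(1) free2] unfolding tot by blast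
  qed
qed

text \<open>Moving \<open>I\<close> into \<open>K\<close> keeps a \<open>z\<close>-copy, since all
  its edges run inside \<open>E\<close> or between \<open>K\<close> and \<open>E\<close>. It meets
  the \<open>w\<close>-copy in \<open>K\<close> exactly in the images of \<open>I\<close>, and its
  cover stays in \<open>E\<close>.\<close>

lemma clique_tie:
  fixes c :: "'b set \<Rightarrow> colour"
  assumes K: "finite K" "k \<le> card K" "\<forall>u\<in>K. \<forall>v\<in>K. u \<noteq> v \<longrightarrow> c {u, v} = w"
    and E: "K \<inter> E = {}" "\<forall>u\<in>K. \<forall>v\<in>E. c {u, v} = z" and wz: "w \<noteq> z"
    and f: "hom c z H f" "f ` verts H \<subseteq> E"
  shows "\<exists>X Y. has_copy c X w H \<and> has_copy c Y z H \<and> card (X \<union> Y) = 2 * k - \<alpha> \<and> X \<union> Y \<subseteq> K \<union> E \<and> Y \<inter> E \<noteq> {}"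
proof -
  obtain h where h: "hom c w H h" "h ` verts H \<subseteq> K" using clique_hom[OF K] by blast
  define g where "g v = (if v \<in> I then h v else f v)" for v
  have hK: "h v \<in> K" "f v \<in> E" if "v \<in> verts H" for v using h(2) f(2) that by auto
  have ne: "h u \<noteq> f v" if "u \<in> verts H" "v \<in> verts H" for u v using hK[OF that(1)] hK[OF that(2)] E(1) by auto
  have injs: "inj_on h (verts H)" "inj_on f (verts H)" using h(1) f(1) by (auto simp: hom_def)
  have g: "hom c z H g"
  proof (rule homI)
    show "inj_on g (verts H)"
    proof (rule inj_onI)
      fix a b assume "a \<in> verts H" "b \<in> verts H" "g a = g b"
      then show "a = b" using ne[of a b] ne[of b a] injs
        by (auto simp: g_def inj_on_def split: if_splits)
    qed
    fix u v assume uv: "{u, v} \<in> edges H"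
    then have V: "u \<in> verts H" "v \<in> verts H" using edge_verts[OF simple] by auto
    have "\<not> (u \<in> I \<and> v \<in> I)" using uv I_no_edge by blast
    then show "c {g u, g v} = z"
      using E(2)[rule_format, of "h u" "f v"] E(2)[rule_format, of "h v" "f u"] hK V hom_edge[OF f(1) uv]
      by (auto simp: g_def insert_commute)
  qed
  have "h ` verts H \<inter> g ` verts H = h ` I"
  proof
    have "h ` I = g ` I" by (auto simp: g_def)
    then show "h ` I \<subseteq> h ` verts H \<inter> g ` verts H" using I_subset by blast
    show "h ` verts H \<inter> g ` verts H \<subseteq> h ` I"
    proof
      fix a assume "a \<in> h ` verts H \<inter> g ` verts H"
      then obtain u v where uv: "u \<in> verts H" "v \<in> verts H" "a = h u" "a = g v" by auto
      then have "v \<in> I" using ne[of u v] by (auto simp: g_def split: if_splits)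
      then show "a \<in> h ` I" using uv(4) by (simp add: g_def)
    qed
  qed
  moreover have "card (h ` I) = \<alpha>" using card_image inj_on_subset[OF injs(1) I_subset] card_I by metis
  moreover have "card (h ` verts H) = k" "card (g ` verts H) = k"
    using injs(1) g card_image by (auto simp: hom_def)
  ultimately have "card (h ` verts H \<union> g ` verts H) = 2 * k - \<alpha>"
    using card_Un_Int[of "h ` verts H" "g ` verts H"] finite_verts \<alpha>_less by simp
  moreover have "has_copy c (h ` verts H) w H" "has_copy c (g ` verts H) z H"
    unfolding has_copy_hom[OF simple] using h(1) g by blast+
  moreover have "g ` verts H \<inter> E \<noteq> {}"
  proof -
    obtain u where "u \<in> cov" using cov_nonempty by auto
    then have "g u \<in> g ` verts H" "g u \<in> E" using hK by (auto simp: g_def cov_def)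
    then show ?thesis by auto
  qed
  moreover have "h ` verts H \<union> g ` verts H \<subseteq> K \<union> E" using hK by (auto simp: g_def)
  ultimately show ?thesis by blast
qed

lemma tie_free_E_small:
  fixes c :: "'b set \<Rightarrow> colour"
  assumes xy: "x \<noteq> y" and st: "structured c x y R B E" and size: "k \<le> card R" "k \<le> card B"
    and free: "\<not> (\<exists>T. is_tie c (R \<union> B \<union> E) H T \<and> T \<inter> E \<noteq> {})"
  shows "card E \<le> ramsey_number H"
proof (rule ccontr)
  note S = structuredD[OF st]
  assume "\<not> ?thesis"
  then have "has_mono_copy c E H" using ramsey_number_copy[OF simple S(3)] by auto
  then obtain z f where f: "hom c z H f" "f ` verts H \<subseteq> E"
    unfolding has_mono_copy_def has_copy_hom[OF simple] by blast
  have "\<exists>w X Y. w \<noteq> z \<and> has_copy c X w H \<and> has_copy c Y z H \<and> card (X \<union> Y) = 2 * k - \<alpha>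
      \<and> X \<union> Y \<subseteq> R \<union> B \<union> E \<and> Y \<inter> E \<noteq> {}"
  proof (cases "z = x")
    case True
    have "\<forall>u\<in>B. \<forall>v\<in>B. u \<noteq> v \<longrightarrow> c {u, v} = y" "\<forall>u\<in>B. \<forall>v\<in>E. c {u, v} = z"
      using S(8,11) True by blast+
    from clique_tie[OF S(2) size(2) this(1) S(6) this(2) _ f] xy True
    show ?thesis by (intro exI[of _ y]) blast
  next
    case False
    then have zy: "z = y" using xy by (cases x; cases y; cases z) auto
    have "\<forall>u\<in>R. \<forall>v\<in>R. u \<noteq> v \<longrightarrow> c {u, v} = x" "\<forall>u\<in>R. \<forall>v\<in>E. c {u, v} = z"
      using S(7,10) zy by blast+
    from clique_tie[OF S(1) size(1) this(1) S(5) this(2) _ f] xy zy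
    show ?thesis by (intro exI[of _ x]) blast
  qed
  then obtain w X Y where XY: "w \<noteq> z" "has_copy c X w H" "has_copy c Y z H" "card (X \<union> Y) = 2 * k - \<alpha>"
      "X \<union> Y \<subseteq> R \<union> B \<union> E" "Y \<inter> E \<noteq> {}" by blast
  have "finite (X \<union> Y)" using XY(4) \<alpha>_less by (intro card_ge_0_finite) simp
  moreover have "has_copy c (X \<union> Y) v H" for v
    using XY(1-3) has_copy_mono[of c X w H "X \<union> Y"] has_copy_mono[of c Y z H "X \<union> Y"]
    by (cases w; cases z; cases v) auto
  ultimately have "is_tie c (R \<union> B \<union> E) H (X \<union> Y)" using XY(4,5) by (simp add: is_tie_def)
  then show False using free XY(6) by blast
qed

text \<open>The extremal colouring: a red clique one vertex too small for n copies, with all other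
  edges blue. A blue copy has at most \<alpha> vertices in the clique, and outside one vertex is
  missing as well. Two missing vertices in all give the +1 in the statement.\<close>

lemma ramsey_number_lower:
  "n * (2 * k - \<alpha>) \<le> ramsey_number (copies n H) + 1"
proof (rule ccontr)
  assume "\<not> ?thesis"
  then have small: "ramsey_number (copies n H) + 2 \<le> n * (2 * k - \<alpha>)" by simp
  then have n: "1 \<le> n" by (cases n) auto
  define a b where "a = k * n - 1" and "b = (k - \<alpha>) * n - 1"
  have a1: "1 \<le> k * n" and b1: "1 \<le> (k - \<alpha>) * n" using n k_pos \<alpha>_less by (simp_all add: Suc_le_eq)
  have "2 * k - \<alpha> = k + (k - \<alpha>)" using \<alpha>_less by simp
  then have "n * (2 * k - \<alpha>) = k * n + (k - \<alpha>) * n" by (simp add: add_mult_distrib2 mult.commute)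
  then have ab: "ramsey_number (copies n H) \<le> a + b" using small a1 b1 unfolding a_def b_def by linarith
  define c where "c e = (if e \<subseteq> {..<a} then Red else Blue)" for e
  have "has_mono_copy c {..<a + b} (copies n H)"
    using ab simple_copies_on[OF simple, of "{..<n}"] by (intro ramsey_number_copy) (auto simp: copies_eq)
  then obtain z where z: "has_copy c {..<a + b} z (copies_on {..<n} H)"
    by (auto simp: has_mono_copy_def copies_eq)
  obtain f where f: "hom c z (copies_on {..<n} H) f" "f ` (verts H \<times> {..<n}) \<subseteq> {..<a + b}"
    using z unfolding has_copy_hom[OF simple_copies_on[OF simple finite_lessThan]] by auto
  have injf: "inj_on f (verts H \<times> {..<n})" using f(1) by (simp add: hom_def)
  have e: "c {f (u, i), f (v, i)} = z" if "i < n" "{u, v} \<in> edges H" for u v i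
    using f(1) that unfolding hom_copies_on[OF simple] by (auto simp: hom_def)
  show False
  proof (cases z)
    case Red
    have "f (v, i) < a" if v: "v \<in> verts H" and i: "i < n" for v i
    proof -
      obtain u where "u \<in> nbh H v" using has_neighbour[OF v] .
      then have "c {f (v, i), f (u, i)} = Red" using e[OF i] Red by (simp add: nbh_def)
      then show ?thesis by (auto simp: c_def split: if_splits)
    qed
    then have "f ` (verts H \<times> {..<n}) \<subseteq> {..<a}" by auto
    then have "card (verts H \<times> {..<n}) \<le> card {..<a}" using injf by (intro card_inj_on_le) auto
    then show False using a1 unfolding card_cartesian_product a_def card_lessThan by linarith
  next
    case Blue
    have s: "k - \<alpha> \<le> card {v \<in> verts H. f (v, i) \<in> {a..<a + b}}" if i: "i < n" for i
    proof -
      have "card {v \<in> verts H. f (v, i) < a} \<le> \<alpha>"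
      proof (rule independent_le)
        fix u v assume "u \<in> {v \<in> verts H. f (v, i) < a}" "v \<in> {v \<in> verts H. f (v, i) < a}"
        then have "c {f (u, i), f (v, i)} = Red" by (simp add: c_def)
        then show "{u, v} \<notin> edges H" using e[OF i] Blue by auto
      qed auto
      moreover have "verts H - {v \<in> verts H. f (v, i) < a} \<subseteq> {v \<in> verts H. f (v, i) \<in> {a..<a + b}}"
      proof
        fix v assume v: "v \<in> verts H - {v \<in> verts H. f (v, i) < a}"
        then have "f (v, i) \<in> f ` (verts H \<times> {..<n})" using i by (intro imageI) auto
        then show "v \<in> {v \<in> verts H. f (v, i) \<in> {a..<a + b}}" using f(2) v by auto
      qed
      then have "card (verts H - {v \<in> verts H. f (v, i) < a}) \<le> card {v \<in> verts H. f (v, i) \<in> {a..<a + b}}"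
        using finite_verts by (intro card_mono) auto
      moreover have "card (verts H - {v \<in> verts H. f (v, i) < a}) = k - card {v \<in> verts H. f (v, i) < a}"
        using finite_verts by (intro card_Diff_subset) auto
      ultimately show ?thesis by linarith
    qed
    have "(k - \<alpha>) * n \<le> (\<Sum>i<n. card {v \<in> verts H. f (v, i) \<in> {a..<a + b}})"
      using sum_mono[of "{..<n}" "\<lambda>_. k - \<alpha>"] s by (simp add: mult.commute)
    also have "\<dots> = card {q \<in> verts H \<times> {..<n}. f q \<in> {a..<a + b}}"
      using slice_sum[of "{..<n}" f "{a..<a + b}"] by simp
    also have "\<dots> \<le> card {a..<a + b}"
      using injf by (intro card_inj_on_le[of f]) (auto simp: inj_on_def)
    finally show False using b1 unfolding b_def card_atLeastLessThan by linarith
  qed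
qed

end

section \<open>Structure of a critical colouring\<close>

context ramsey_graph
begin

text \<open>Bound for the vertices outside the pair and the removed ties. \<open>rest_small\<close>
  yields (d + 1) (defect + 2) + defect; the summand 2 is the gap between \<open>card V\<close> and
  \<open>n * tie_size\<close>.\<close>

definition rest_bound :: nat where "rest_bound = (d + 2) * (defect + 2)"

lemma \<Gamma>_pow_mono: "i \<le> j \<Longrightarrow> \<Gamma>^i \<le> \<Gamma>^j"
  using \<Gamma>_ge by (intro power_increasing) auto

lemma d_\<Gamma>: "4 * d + 8 \<le> \<Gamma>"
proof -
  have "4 * d + 8 \<le> 16 * d" using d_pos by simp
  also have "\<dots> \<le> 2^4 * 2^p" using d_le by simp
  also have "\<dots> = 2^(4 + p)" by (simp add: power_add)
  also have "\<dots> \<le> \<Gamma>" using pd_bounds by (intro pow_le_\<Gamma>) linarith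
  finally show ?thesis .
qed

lemma rest_bound_le: "rest_bound \<le> \<Gamma>^8 * k" "defect + 3 \<le> rest_bound"
proof -
  have k1: "1 \<le> k" using k_pos by simp
  have "1024 * 1 \<le> \<Gamma>^6 * k"
  proof (rule mult_le_mono)
    have "\<Gamma>^1 \<le> \<Gamma>^6" by (rule \<Gamma>_pow_mono) simp
    then show "1024 \<le> \<Gamma>^6" using \<Gamma>_ge by simp
  qed (rule k1)
  then have L: "1024 \<le> defect" by (simp add: defect_def)
  have "rest_bound \<le> \<Gamma> * (2 * defect)" unfolding rest_bound_def using d_\<Gamma> L by (intro mult_le_mono) auto
  also have "\<dots> \<le> \<Gamma> * (\<Gamma> * defect)" using \<Gamma>_ge by (intro mult_le_mono2 mult_le_mono1) simp
  also have "\<dots> = \<Gamma>^8 * k" by (simp add: defect_def eval_nat_numeral mult.assoc)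
  finally show "rest_bound \<le> \<Gamma>^8 * k" .
  have "2 * (defect + 2) \<le> rest_bound" unfolding rest_bound_def by (intro mult_le_mono1) simp
  then show "defect + 3 \<le> rest_bound" by simp
qed

text \<open>Every later loss is a small multiple of \<open>k * rest_bound\<close>, the vertices of
  as many copies as there are exceptional vertices. This lies below scale 50, beyond all scales at
  which the pair is controlled.\<close>

lemma rest_bound_small:
  assumes S: "\<Gamma>^11 * k^2 \<le> S"
  shows "100 * (k * rest_bound) \<le> sc S 50" "\<Gamma>^2 * k \<le> S" "k \<le> k * rest_bound" "1 \<le> k * rest_bound" "rest_bound \<le> k * rest_bound"
proof -
  have k1: "1 \<le> k" using k_pos by simp
  have w1: "1 \<le> rest_bound" using rest_bound_le(2) by simp
  have "\<Gamma> * (100 * (k * rest_bound)) \<le> \<Gamma> * (\<Gamma> * (k * rest_bound))" using \<Gamma>_ge by (intro mult_le_mono2 mult_le_mono1) simp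
  also have "\<dots> \<le> \<Gamma> * (\<Gamma> * (k * (\<Gamma>^8 * k)))" using rest_bound_le(1) by (intro mult_le_mono2)
  also have "\<dots> = \<Gamma>^10 * k^2" by (simp add: eval_nat_numeral mult.assoc mult.left_commute)
  also have "\<dots> \<le> \<Gamma>^11 * k^2" by (intro mult_le_mono1 \<Gamma>_pow_mono) simp
  finally have "\<Gamma> * (100 * (k * rest_bound)) \<le> S" using S by linarith
  then have "real (\<Gamma> * (100 * (k * rest_bound))) \<le> S" by (rule of_nat_mono)
  then have "100 * (k * rest_bound) \<le> S / \<Gamma>" by (simp add: field_simps)
  then show "100 * (k * rest_bound) \<le> sc S 50" using \<Gamma>_div[of S 50] by simp
  have "\<Gamma>^2 * k \<le> \<Gamma>^11 * k^2" using k1 by (intro mult_le_mono \<Gamma>_pow_mono) (auto simp: power2_eq_square)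
  then show "\<Gamma>^2 * k \<le> S" using S by linarith
  have "k * 1 \<le> k * rest_bound" using w1 by (rule mult_le_mono2)
  then show "k \<le> k * rest_bound" by simp
  show "rest_bound \<le> k * rest_bound" using mult_le_mono1[OF k1, of rest_bound] by simp
  show "1 \<le> k * rest_bound" using k1 w1 by (simp add: Suc_le_eq)
qed

lemma n_large:
  assumes n: "\<Gamma>^20 * k \<le> n"
  shows "\<Gamma>^19 * k^2 \<le> (k - \<alpha>) * n"
proof -
  have "\<Gamma> * (\<Gamma>^19 * k^2) = k * (\<Gamma>^20 * k)" by (simp add: eval_nat_numeral mult.assoc mult.left_commute)
  also have "\<dots> \<le> k * n" using n by (rule mult_le_mono2)
  also have "\<dots> \<le> (d + 1) * (k - \<alpha>) * n" using k_le by (rule mult_le_mono1)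
  also have "\<dots> \<le> \<Gamma> * ((k - \<alpha>) * n)" unfolding mult.assoc using d_\<Gamma> by (intro mult_le_mono1) linarith
  finally show ?thesis by simp
qed

lemma tie_size_split: "tie_size = k + (k - \<alpha>)"
  using \<alpha>_less by simp

text \<open>A maximal packing in either colour has fewer than n copies and uses fewer than k n
  vertices, so it leaves about (k - \<alpha>) n vertices without a copy of that colour.
  \<open>n_large\<close> makes this number large enough for \<open>good_exists\<close>.\<close>

lemma find_good:
  fixes c :: "'b set \<Rightarrow> colour"
  assumes fin: "finite V" and free: "\<not> has_mono_copy c V (copies n H)"
    and V: "n * tie_size \<le> card V + 2" and n: "\<Gamma>^20 * k \<le> n"
  shows "\<exists>x y R B S \<theta>. x \<noteq> y \<and> R \<union> B \<subseteq> V \<and> good c x y R B S \<theta> \<and> \<Gamma>^11 * k^2 \<le> S"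
proof -
  have k1: "1 \<le> k" using k_pos by simp
  have big: "\<exists>X. X \<subseteq> V \<and> \<not> has_copy c X z H \<and> \<Gamma>^19 * k^2 \<le> card X + 2" for z
  proof -
    obtain j Z where jZ: "Z \<subseteq> V" "card Z = k * j" "has_copy c Z z (copies j H)" "\<not> has_copy c (V - Z) z H"
      using max_pack[OF simple nonempty fin] by blast
    have "\<not> n \<le> j"
      using packs_le[OF simple jZ(3), of n] has_copy_mono[of c Z z _ V] jZ(1) free
      unfolding has_mono_copy_def by blast
    then have "k * j \<le> k * n" by simp
    moreover have "card (V - Z) = card V - k * j"
      using jZ(1,2) fin by (simp add: card_Diff_subset finite_subset)
    moreover have "n * tie_size = k * n + (k - \<alpha>) * n" unfolding tie_size_split by (simp add: add_mult_distrib2 mult.commute)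
    ultimately have "\<Gamma>^19 * k^2 \<le> card (V - Z) + 2" using V n_large[OF n] by linarith
    then show ?thesis using jZ(4) by (intro exI[of _ "V - Z"]) auto
  qed
  obtain X0 where X0: "X0 \<subseteq> V" "\<not> has_copy c X0 Blue H" "\<Gamma>^19 * k^2 \<le> card X0 + 2" using big by blast
  obtain Y0 where Y0: "Y0 \<subseteq> V" "\<not> has_copy c Y0 Red H" "\<Gamma>^19 * k^2 \<le> card Y0 + 2" using big by blast
  have finX: "finite X0" "finite Y0" using X0 Y0 fin finite_subset by blast+
  have I0: "card (X0 \<inter> Y0) < \<Gamma> * (\<Gamma> * k)"
  proof (rule no_copies_card)
    fix z show "\<not> has_copy c (X0 \<inter> Y0) z H"
      using X0(2) Y0(2) has_copy_mono[of c "X0 \<inter> Y0" z H X0] has_copy_mono[of c "X0 \<inter> Y0" z H Y0]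
      by (cases z) auto
  qed (use finX in auto)
  have D: "card (X0 - Y0) = card X0 - card (X0 \<inter> Y0)"
    using finX by (simp add: card_Diff_subset_Int)
  have num: "\<Gamma>^3 * (\<Gamma>^11 * k^2) + \<Gamma> * (\<Gamma> * k) + 2 \<le> \<Gamma>^19 * k^2"
  proof -
    have kk: "1 \<le> k^2" "k \<le> k^2" using k1 by (auto simp: power2_eq_square)
    have "\<Gamma> * (\<Gamma> * k) = \<Gamma>^2 * k" by (simp add: power2_eq_square)
    also have "\<dots> \<le> \<Gamma>^14 * k^2" using kk by (intro mult_le_mono \<Gamma>_pow_mono) auto
    finally have 1: "\<Gamma> * (\<Gamma> * k) \<le> \<Gamma>^14 * k^2" .
    have "\<Gamma>^1 \<le> \<Gamma>^14" by (rule \<Gamma>_pow_mono) simp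
    then have "2 \<le> \<Gamma>^14" using \<Gamma>_ge by simp
    then have "2 * 1 \<le> \<Gamma>^14 * k^2" using kk by (intro mult_le_mono)
    moreover have "\<Gamma>^3 * (\<Gamma>^11 * k^2) = \<Gamma>^14 * k^2" by (simp add: eval_nat_numeral mult.assoc)
    ultimately have "\<Gamma>^3 * (\<Gamma>^11 * k^2) + \<Gamma> * (\<Gamma> * k) + 2 \<le> 3 * (\<Gamma>^14 * k^2)" using 1 by linarith
    also have "\<dots> \<le> \<Gamma> * (\<Gamma>^14 * k^2)" using \<Gamma>_ge by (intro mult_le_mono1) simp
    also have "\<dots> = \<Gamma>^15 * k^2" by (simp add: eval_nat_numeral mult.assoc)
    also have "\<dots> \<le> \<Gamma>^19 * k^2" by (intro mult_le_mono1 \<Gamma>_pow_mono) simp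
    finally show ?thesis .
  qed
  have sz: "\<Gamma>^3 * (\<Gamma>^11 * k^2) \<le> card (X0 - Y0)" "\<Gamma>^3 * (\<Gamma>^11 * k^2) \<le> card Y0"
    using X0(3) Y0(3) num I0 D by linarith+
  have s: "\<Gamma> * k \<le> \<Gamma>^11 * k^2"
  proof -
    have "\<Gamma>^1 * k \<le> \<Gamma>^11 * k^2" using k1 by (intro mult_le_mono \<Gamma>_pow_mono) (auto simp: power2_eq_square)
    then show ?thesis by simp
  qed
  have nc: "\<not> has_copy c (X0 - Y0) Blue H" using X0(2) has_copy_mono[of c "X0 - Y0" Blue H X0] by auto
  have fd: "finite (X0 - Y0)" "(X0 - Y0) \<inter> Y0 = {}" using finX by auto
  from good_exists[OF colour.distinct(1) fd(1) finX(2) fd(2) nc Y0(2) s sz]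
  obtain R B S \<theta> where RB: "R \<union> B \<subseteq> X0 - Y0 \<union> Y0" "\<Gamma>^11 * k^2 \<le> S"
    "good c Red Blue R B S \<theta> \<or> good c Blue Red R B S \<theta>" by blast
  have sub: "R \<union> B \<subseteq> V" using RB(1) X0(1) Y0(1) by auto
  show ?thesis using RB(3)
  proof
    assume "good c Red Blue R B S \<theta>"
    then show ?thesis using sub RB(2) colour.distinct(1) by blast
  next
    assume "good c Blue Red R B S \<theta>"
    then show ?thesis using sub RB(2) colour.distinct(2) by blast
  qed
qed

lemma card_Diff_real:
  "finite U \<Longrightarrow> real (card A) - real (card U) \<le> card (A - U)"
  using diff_card_le_card_Diff[of U A] by linarith

text \<open>Two ties meeting only in \<open>v\<close>, one using \<open>v\<close> for its first colour and one for its second,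
  have one vertex less than two disjoint ties. Many such vertices would make the colouring too small.\<close>

lemma few_double_vertices:
  fixes c :: "'b set \<Rightarrow> colour"
  assumes xy: "x \<noteq> y" and good: "good c x y R B S \<theta>" and S: "\<Gamma>^11 * k^2 \<le> S"
    and RB: "R \<union> B \<subseteq> V" and fin: "finite V" and free: "\<not> has_mono_copy c V (copies n H)"
    and V: "n * tie_size \<le> card V + 2"
    and D: "D \<subseteq> V" "\<And>v. v \<in> D \<Longrightarrow> 2 * \<theta> 0 \<le> card (nbr c x v R)"
      "\<And>v. v \<in> D \<Longrightarrow> 2 * \<theta> 0 \<le> card (nbr c y v R)" "\<And>v. v \<in> D \<Longrightarrow> sc S 11 \<le> card (nbr c y v B)"
  shows "card D \<le> defect + 2"
proof (rule ccontr)
  assume "\<not> ?thesis"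
  then have "defect + 3 \<le> card D" by simp
  then obtain D1 where D1: "D1 \<subseteq> D" "card D1 = defect + 3" by (meson obtain_subset_with_card_n)
  have finD1: "finite D1" by (rule finite_subset[OF D1(1) finite_subset[OF D(1) fin]])
  note G = goodD[OF good]
  note W = rest_bound_small[OF S]
  have SR: "0 \<le> real S" by simp
  have sc50: "sc S 50 \<le> sc S 26" using sc_pow[OF SR, of 26 50] sc_nonneg[OF SR, of 50] by simp
  have sc26: "sc S 26 \<le> sc S 13" using sc_pow[OF SR, of 13 26] sc_nonneg[OF SR, of 26] by simp
  have sc13: "2 * sc S 12 \<le> sc S 11" "2 * sc S 13 \<le> sc S 12"
    using sc_pow[OF SR, of 11 12] sc_pow[OF SR, of 12 13] by simp_all
  have sc11: "sc S 11 \<le> real S" using sc_pow[OF SR, of 0 11] sc_nonneg[OF SR, of 11] by (simp add: sc_0)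
  have k1: "1 \<le> k" using k_pos by simp
  \<comment> \<open>The summand \<open>card D0\<close> on the left is the saving, one vertex for
    each pair of ties. The last clause keeps the untreated vertices of \<open>D1\<close> free for
    their own ties.\<close>
  have "\<exists>Z\<subseteq>V. card Z + card D0 = 2 * card D0 * tie_size \<and> (\<forall>z. has_copy c Z z (copies (2 * card D0) H)) \<and> Z \<inter> D1 \<subseteq> D0"
    if "D0 \<subseteq> D1" for D0
    using finite_subset[OF that finD1] that
  proof (induction D0 rule: finite_induct)
    case empty
    show ?case by (intro exI[of _ "{}"]) auto
  next
    case (insert v D0)
    then obtain Z where Z: "Z \<subseteq> V" "card Z + card D0 = 2 * card D0 * tie_size"
      "\<And>z. has_copy c Z z (copies (2 * card D0) H)" "Z \<inter> D1 \<subseteq> D0" by blast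
    have v: "v \<in> D1" "v \<in> D" "v \<in> V" "v \<notin> Z" using insert D1 D(1) Z(4) by auto
    have finZ: "finite Z" using Z(1) fin finite_subset by blast
    define U where "U = Z \<union> D1"
    have finU: "finite U" using finZ finD1 by (simp add: U_def)
    have "card U \<le> card Z + card D1" unfolding U_def by (rule card_Un_le)
    moreover have "card Z \<le> 4 * (k * rest_bound)"
    proof -
      have "card D0 \<le> rest_bound" using card_mono[OF finD1, of D0] insert.prems D1(2) rest_bound_le(2) by simp
      then have "2 * card D0 * tie_size \<le> 2 * rest_bound * (2 * k)" by (intro mult_le_mono) auto
      then show ?thesis using Z(2) by (simp add: mult.commute mult.left_commute)
    qed
    moreover have "card D1 \<le> k * rest_bound" using D1(2) rest_bound_le(2) W(5) by linarith
    ultimately have cU: "card U \<le> 5 * (k * rest_bound)" by linarith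
    then have rU: "real (card U) \<le> 5 * (k * rest_bound)" using of_nat_mono by fastforce
    define R1 where "R1 = nbr c x v R - U"
    define B1 where "B1 = B - U"
    have r1: "\<theta> 0 \<le> card R1" unfolding R1_def
      using card_Diff_real[OF finU, of "nbr c x v R"] D(2)[OF v(2)] rU W(1,4) sc50 G(11) by linarith
    have b1: "sc S 12 \<le> card B1" unfolding B1_def
      using card_Diff_real[OF finU, of B] G(5) rU W(1) sc50 sc26 sc13 sc11 by linarith
    have "v \<notin> B1" using v by (simp add: B1_def U_def)
    from tie_through_x[OF xy good W(2) _ _ this r1 b1]
    obtain X1 Y1 where T1: "has_copy c X1 x H" "has_copy c Y1 y H" "v \<in> X1" "v \<notin> Y1"
      "X1 \<union> Y1 \<subseteq> insert v (R1 \<union> B1)" "card (X1 \<union> Y1) = tie_size"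
      by (metis B1_def Diff_subset R1_def)
    define U2 where "U2 = U \<union> (X1 \<union> Y1)"
    have fT1: "finite (X1 \<union> Y1)" using T1(6) \<alpha>_less by (intro card_ge_0_finite) simp
    have finU2: "finite U2" using finU fT1 by (simp add: U2_def)
    have "card U2 \<le> card U + card (X1 \<union> Y1)" unfolding U2_def by (rule card_Un_le)
    moreover have "tie_size \<le> 2 * (k * rest_bound)" using W(3) by linarith
    ultimately have "card U2 \<le> 7 * (k * rest_bound)" using cU T1(6) by linarith
    then have rU2: "real (card U2) \<le> 7 * (k * rest_bound)" using of_nat_mono by fastforce
    define R2 where "R2 = nbr c y v R - U2"
    define B2 where "B2 = nbr c y v B - U2"
    have r2: "\<theta> 0 \<le> card R2" unfolding R2_def
      using card_Diff_real[OF finU2, of "nbr c y v R"] D(3)[OF v(2)] rU2 W(1,4) sc50 G(11) by linarith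
    have b2: "sc S 12 \<le> card B2" unfolding B2_def
      using card_Diff_real[OF finU2, of "nbr c y v B"] D(4)[OF v(2)] rU2 W(1) sc50 sc26 sc13 by linarith
    from tie_through_y[OF xy good W(2) _ _ r2 b2]
    obtain X2 Y2 where T2: "has_copy c X2 x H" "has_copy c Y2 y H" "v \<notin> X2" "v \<in> Y2"
      "X2 \<union> Y2 \<subseteq> insert v (R2 \<union> B2)" "card (X2 \<union> Y2) = tie_size"
      by (metis B2_def Diff_subset R2_def)
    have fT2: "finite (X2 \<union> Y2)" using T2(6) \<alpha>_less by (intro card_ge_0_finite) simp
    have dR2: "(R2 \<union> B2) \<inter> (Z \<union> D1 \<union> X1 \<union> Y1) = {}" by (auto simp: R2_def B2_def U2_def U_def)
    have dR1: "(R1 \<union> B1) \<inter> (Z \<union> D1) = {}" by (auto simp: R1_def B1_def U_def)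
    have I12: "(X1 \<union> Y1) \<inter> (X2 \<union> Y2) = {v}" using T1(3,5) T2(4,5) dR2 by auto
    \<comment> \<open>The common vertex \<open>v\<close> lies in the \<open>x\<close>-copy of the
      first tie and in the \<open>y\<close>-copy of the second only, so each colour still gets two
      disjoint copies.\<close>
    have XX: "X1 \<inter> X2 = {}" and YY: "Y1 \<inter> Y2 = {}" using I12 T1(4) T2(3) by auto
    define Z' where "Z' = Z \<union> ((X1 \<union> Y1) \<union> (X2 \<union> Y2))"
    have "card (X1 \<union> Y1) + card (X2 \<union> Y2) = card ((X1 \<union> Y1) \<union> (X2 \<union> Y2)) + 1"
      using card_Un_Int[OF fT1 fT2] I12 by simp
    then have c12: "card ((X1 \<union> Y1) \<union> (X2 \<union> Y2)) + 1 = 2 * tie_size" using T1(6) T2(6) by simp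
    have ZT: "Z \<inter> ((X1 \<union> Y1) \<union> (X2 \<union> Y2)) = {}" using T1(5) T2(5) dR1 dR2 v(4) by auto
    have "card Z' = card Z + card ((X1 \<union> Y1) \<union> (X2 \<union> Y2))"
      unfolding Z'_def using finZ fT1 fT2 ZT by (intro card_Un_disjoint) auto
    moreover have "card (insert v D0) = Suc (card D0)" using insert.hyps by simp
    ultimately have "card Z' + card (insert v D0) = 2 * card (insert v D0) * tie_size"
      using Z(2) c12 by (simp add: add_mult_distrib)
    moreover have "Z' \<subseteq> V"
    proof -
      have "R1 \<subseteq> R" "B1 \<subseteq> B" "R2 \<subseteq> R" "B2 \<subseteq> B"
        using nbr_subset by (auto simp: R1_def B1_def R2_def B2_def nbr_def)
      then show ?thesis using Z(1) T1(5) T2(5) v(3) RB unfolding Z'_def by blast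
    qed
    moreover have "Z' \<inter> D1 \<subseteq> insert v D0" using Z(4) T1(5) T2(5) dR1 dR2 by (auto simp: Z'_def)
    moreover have "has_copy c Z' z (copies (2 * card (insert v D0)) H)" for z
    proof -
      have two: "has_copy c Z' z (copies (2 * card (insert v D0)) H)"
        if "has_copy c P z H" "has_copy c P' z H" "P \<inter> P' = {}" "P \<union> P' \<subseteq> (X1 \<union> Y1) \<union> (X2 \<union> Y2)" for P P'
      proof -
        have "has_copy c (P \<union> P') z (copies (1 + 1) H)"
          using packs_Un[OF simple packs_1[OF simple that(1)] packs_1[OF simple that(2)] that(3)] .
        then have "has_copy c (Z \<union> (P \<union> P')) z (copies (2 * card D0 + (1 + 1)) H)"
          using that(4) ZT by (intro packs_Un[OF simple Z(3)]) auto
        moreover have "2 * card D0 + (1 + 1) = 2 * card (insert v D0)" using insert.hyps by simp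
        ultimately show ?thesis using that(4) has_copy_mono[of c "Z \<union> (P \<union> P')" z _ Z'] by (auto simp: Z'_def)
      qed
      have "z = x \<or> z = y" using xy by (cases x; cases y; cases z) auto
      then show ?thesis using two[of X1 X2] two[of Y1 Y2] T1 T2 XX YY by auto
    qed
    ultimately show ?case by blast
  qed
  then obtain Z where Z: "Z \<subseteq> V" "card Z + card D1 = 2 * card D1 * tie_size"
      "\<And>z. has_copy c Z z (copies (2 * card D1) H)" by blast
  define g where "g = card D1"
  have finZ: "finite Z" using Z(1) fin finite_subset by blast
  have "\<not> n \<le> 2 * g"
    using packs_le[OF simple Z(3)[of Red], of n] has_copy_mono[of c Z Red _ V] Z(1) free
    unfolding has_mono_copy_def g_def by blast
  then have ng: "2 * g < n" by simp
  have "\<not> has_mono_copy c (V - Z) (copies (n - 2 * g) H)"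
  proof
    assume "has_mono_copy c (V - Z) (copies (n - 2 * g) H)"
    then obtain z where "has_copy c (V - Z) z (copies (n - 2 * g) H)" by (auto simp: has_mono_copy_def)
    then have "has_copy c (Z \<union> (V - Z)) z (copies (2 * g + (n - 2 * g)) H)"
      using Z(3) by (intro packs_Un[OF simple]) (auto simp: g_def)
    moreover have "Z \<union> (V - Z) = V" using Z(1) by auto
    ultimately show False using free ng by (auto simp: has_mono_copy_def)
  qed
  \<comment> \<open>Together with the \<open>g\<close> vertices saved in \<open>Z\<close> this
    bounds \<open>card V\<close> by \<open>n * tie_size + defect - g\<close>, against the lower
    bound \<open>n * tie_size - 2\<close>.\<close>
  then have "card (V - Z) \<le> (n - 2 * g) * tie_size + defect" using fin by (intro no_mono_card) auto
  moreover have "card (V - Z) + card Z = card V"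
    using Z(1) fin finZ by (simp add: card_Diff_subset card_mono)
  moreover have "(n - 2 * g) * tie_size + 2 * g * tie_size = n * tie_size"
    using ng by (metis add_mult_distrib le_add_diff_inverse2 less_imp_le)
  ultimately have "g \<le> defect + 2" using Z(2) V unfolding g_def by linarith
  then show False using D1(2) by (simp add: g_def)
qed

text \<open>A vertex of \<open>B\<close> with many neighbours of both colours in \<open>R\<close> is
  a double vertex, and there are few of them; few have a small \<open>y\<close>-degree, by goodness.
  The remaining vertices have a small \<open>x\<close>-degree into \<open>R\<close>, so almost all
  cross edges have colour \<open>y\<close>.\<close>

lemma dense_pair:
  fixes c :: "'b set \<Rightarrow> colour"
  assumes xy: "x \<noteq> y" and good: "good c x y R B S \<theta>" and S: "\<Gamma>^11 * k^2 \<le> S"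
    and RB: "R \<union> B \<subseteq> V" and fin: "finite V" and free: "\<not> has_mono_copy c V (copies n H)"
    and V: "n * tie_size \<le> card V + 2"
  shows "\<exists>R1 B1. R1 \<subseteq> R \<and> B1 \<subseteq> B \<and> S \<le> 2 * card R1 \<and> S \<le> 2 * card B1
    \<and> (\<forall>b\<in>B1. card (R - nbr c y b R) \<le> sc S 15) \<and> (\<forall>r\<in>R1. card (B1 - nbr c y r B1) \<le> sc S 15)"
proof -
  note G = goodD[OF good]
  note W = rest_bound_small[OF S]
  have SR: "0 \<le> real S" by simp
  have S0: "0 < S" using k_small(3)[OF W(2)] .
  define D where "D = {b \<in> B. 2 * \<theta> 0 \<le> card (nbr c x b R) \<and> 2 * \<theta> 0 \<le> card (nbr c y b R)}"
  define L where "L = {b \<in> B. card (nbr c y b R) < 2 * \<theta> 0}"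
  have BS: "sc S 11 \<le> card (nbr c y b B)" if "b \<in> B" for b
  proof -
    have "card B - real (card (B - nbr c y b B)) \<le> card (nbr c y b B)" by (rule nbr_card_lower[OF G(2)]) simp
    moreover have "2048 * sc S 11 \<le> S" using sc_pow[OF SR, of 0 11] by (simp add: sc_0)
    moreover have "sc S 40 \<le> sc S 11" using sc_pow[OF SR, of 11 40] sc_nonneg[OF SR, of 40] by simp
    ultimately show ?thesis using G(5) G(7)[OF that] sc_nonneg[OF SR, of 11] by linarith
  qed
  have "card D \<le> defect + 2"
    by (rule few_double_vertices[OF xy good S RB fin free V]) (use RB BS in \<open>auto simp: D_def\<close>)
  then have "card D \<le> k * rest_bound" using rest_bound_le(2) W(5) by linarith
  then have rD: "real (card D) \<le> k * rest_bound" by (rule of_nat_mono)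
  have rL: "card L \<le> sc S 20" using G(8) by (simp add: L_def)
  define B1 where "B1 = B - (D \<union> L)"
  have finDL: "finite (D \<union> L)" using G(2) by (auto simp: D_def L_def)
  have "card (D \<union> L) \<le> card D + card L" by (rule card_Un_le)
  then have "real (card (D \<union> L)) \<le> k * rest_bound + sc S 20" using rD rL by linarith
  moreover have "sc S 50 \<le> sc S 20" using sc_pow[OF SR, of 20 50] sc_nonneg[OF SR, of 50] by simp
  moreover have "1048576 * sc S 20 \<le> S" using sc_pow[OF SR, of 0 20] by (simp add: sc_0)
  ultimately have "S \<le> 2 * real (card B1)"
    using card_Diff_real[OF finDL, of B] G(5) W(1,4) unfolding B1_def by linarith
  then have cB1: "S \<le> 2 * card B1" by linarith
  have B1B: "B1 \<subseteq> B" by (auto simp: B1_def)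
  have finB1: "finite B1" using B1B G(2) finite_subset by blast
  have xs: "card (nbr c x b R) \<le> sc S 16" if "b \<in> B1" for b
  proof -
    have "card (nbr c x b R) < 2 * \<theta> 0" using that by (auto simp: B1_def D_def L_def)
    then show ?thesis using G(12) by linarith
  qed
  have sc15: "2 * sc S 16 \<le> sc S 15" using sc_pow[OF SR, of 15 16] by simp
  have s16: "0 < sc S 16" using S0 by (simp add: sc_def)
  define f where "f r = real (card (nbr c x r B1))" for r
  have "sum f R = (\<Sum>b\<in>B1. real (card (nbr c x b R)))"
    using nbr_double_count[OF G(1) finB1, of c x] by (simp add: f_def flip: of_nat_sum)
  also have "\<dots> \<le> (\<Sum>b\<in>B1. sc S 16)" using xs by (intro sum_mono) auto
  also have "\<dots> = card B1 * sc S 16" by simp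
  also have "\<dots> \<le> S * sc S 16"
    using card_mono[OF G(2) B1B] G(5) s16 by (intro mult_right_mono) auto
  finally have "card {r \<in> R. 2 * sc S 16 < f r} * (2 * sc S 16) \<le> S * sc S 16"
    using markov_card[OF G(1), of f "2 * sc S 16"] by (simp add: f_def)
  then have "(2 * card {r \<in> R. 2 * sc S 16 < f r}) * sc S 16 \<le> S * sc S 16" by simp
  then have bad: "2 * card {r \<in> R. 2 * sc S 16 < f r} \<le> S"
    using s16 by (simp add: mult_le_cancel_right flip: of_nat_mult)
  define R1 where "R1 = R - {r \<in> R. 2 * sc S 16 < f r}"
  have "card R1 = card R - card {r \<in> R. 2 * sc S 16 < f r}"
    unfolding R1_def using G(1) by (intro card_Diff_subset) auto
  then have cR1: "S \<le> 2 * card R1" using bad G(4) by linarith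
  have "card (R - nbr c y b R) \<le> sc S 15" if "b \<in> B1" for b
  proof -
    have "b \<notin> R" using that B1B G(3) by auto
    then have "R - nbr c y b R = nbr c x b R" by (rule nbr_other[OF xy[symmetric]])
    then show ?thesis using xs[OF that] sc15 s16 by simp
  qed
  moreover have "card (B1 - nbr c y r B1) \<le> sc S 15" if "r \<in> R1" for r
  proof -
    have "r \<notin> B1" using that B1B G(3) by (auto simp: R1_def)
    then have "B1 - nbr c y r B1 = nbr c x r B1" by (rule nbr_other[OF xy[symmetric]])
    then show ?thesis using that sc15 by (auto simp: R1_def f_def)
  qed
  moreover have "R1 \<subseteq> R" by (auto simp: R1_def)
  ultimately show ?thesis using B1B cB1 cR1 by blast
qed

end

lemma nonnbr_mono:
  assumes "finite A" "D \<subseteq> A" shows "card (D - nbr c x v D) \<le> card (A - nbr c x v A)"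
  using assms by (intro card_mono) (auto simp: nbr_def)

context ramsey_graph
begin

text \<open>Sets of sizes k m and (k - \<alpha>) m act like a union of m disjoint ties: the
  \<open>x\<close>-copies fill \<open>R\<close> exactly, while the \<open>y\<close>-copies fill
  \<open>B\<close> exactly with their covers and put their independent sets into \<open>R\<close>,
  where (k - \<alpha>) m vertices remain to spare.\<close>

lemma packs_in_pair:
  fixes c :: "'b set \<Rightarrow> colour" and \<eta> :: real
  assumes fin: "finite R" "finite B" "R \<inter> B = {}" and card: "card R = k * m" "card B = (k - \<alpha>) * m"
    and RR: "\<And>v. v \<in> R \<Longrightarrow> card (R - nbr c x v R) \<le> \<eta>" and BB: "\<And>v. v \<in> B \<Longrightarrow> card (B - nbr c y v B) \<le> \<eta>"
    and BR: "\<And>v. v \<in> B \<Longrightarrow> card (R - nbr c y v R) \<le> \<eta>"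
    and \<eta>: "0 \<le> \<eta>" "2 * d * \<eta> < (k - \<alpha>) * m"
  shows "has_copy c R x (copies m H)" "has_copy c (R \<union> B) y (copies m H)"
proof -
  have s: "simple_graph (copies_on {..<m} H)" and dg: "deg_le (copies_on {..<m} H) d"
    using simple_copies_on[OF simple, of "{..<m}"] deg_le_copies_on[OF simple deg] by auto
  have mm: "(k - \<alpha>) * m + \<alpha> * m = k * m"
    using \<alpha>_less by (metis add_mult_distrib le_add_diff_inverse2 less_imp_le)
  have "real ((k - \<alpha>) * m) \<le> real (card R)" unfolding card(1) using mm by (intro of_nat_mono) linarith
  then have "2 * d * \<eta> < card R" using \<eta>(2) by linarith
  then have "\<exists>f. hom c x (copies_on {..<m} H) f \<and> f ` verts (copies_on {..<m} H) \<subseteq> R"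
    using RR card by (intro sauer_spencer[OF s dg fin(1)]) (auto simp: card_cartesian_product)
  then show "has_copy c R x (copies m H)" unfolding copies_eq has_copy_hom[OF s] .
  have dB: "2 * real d * \<eta> < card B" using \<eta>(2) card(2) by simp
  have "has_copy c (B \<union> R \<union> {}) y (copies_on {..<m} H)"
  proof (rule split_embedding[OF s dg, where FD="cov \<times> {..<m}" and FI="I \<times> {..<m}" and FE="{}" and \<eta>=\<eta>])
    show "verts (copies_on {..<m} H) = cov \<times> {..<m} \<union> I \<times> {..<m} \<union> {}" using verts_split by auto
    show "(cov \<times> {..<m}) \<inter> (I \<times> {..<m}) = {}" using verts_split by auto
    show "{u, v} \<notin> edges (copies_on {..<m} H)" if "u \<in> I \<times> {..<m}" "v \<in> I \<times> {..<m}" for u v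
      unfolding edges_copies_on[OF simple] using that I_no_edge by auto
    have "card cov = k - \<alpha>" using card_cov by simp
    then show "card (cov \<times> {..<m}) \<le> card B" by (simp add: card(2) card_cartesian_product)
    have "0 \<le> real d * \<eta>" using \<eta>(1) by simp
    then have "d * \<eta> \<le> (k - \<alpha>) * m" using \<eta>(2) by linarith
    then have "real (\<alpha> * m) + d * \<eta> \<le> real ((k - \<alpha>) * m + \<alpha> * m)" by simp
    then show "real (card (I \<times> {..<m})) + d * \<eta> \<le> card R"
      unfolding mm card(1)[symmetric] by (simp add: card_cartesian_product card_I)
  qed (use fin BB BR \<eta> dB in auto)
  then show "has_copy c (R \<union> B) y (copies m H)" by (simp add: copies_eq Un_commute)
qed

lemma sc4_le:
  fixes a :: real
  assumes "0 \<le> a" "a \<le> 4 * (k * m)" shows "sc a 4 \<le> (k - \<alpha>) * m"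
proof -
  have a0: "0 \<le> sc a 4" using assms(1) by (rule sc_nonneg)
  have "(d + 1) * sc a 4 \<le> (2 * d) * sc a 4" using d_pos a0 by (intro mult_right_mono) auto
  also have "\<dots> = 2 * (d * sc a 4)" by simp
  also have "\<dots> \<le> 2 * sc a 3" using sc_d[OF assms(1), of 3] by simp
  also have "\<dots> \<le> a / 4" using sc_pow[OF assms(1), of 0 3] by (simp add: sc_0)
  also have "\<dots> \<le> k * m" using assms(2) by simp
  also have "real (k * m) \<le> real ((d + 1) * ((k - \<alpha>) * m))"
    using mult_le_mono1[OF k_le, of m] unfolding mult.assoc by (rule of_nat_mono)
  also have "\<dots> = (d + 1) * real ((k - \<alpha>) * m)" by (rule of_nat_mult)
  finally show ?thesis by (rule mult_left_le_imp_le) simp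
qed

text \<open>The set \<open>P\<close> counts as \<open>m\<close> ties. After removing further ties
  and packing the remainder, the count of V leaves only boundedly many of the n copies unaccounted
  for.\<close>

lemma rest_small:
  fixes c :: "'b set \<Rightarrow> colour"
  assumes fin: "finite V" and free: "\<not> has_mono_copy c V (copies n H)" and V: "n * tie_size \<le> card V + 2"
    and P: "P \<subseteq> V" "card P = m * tie_size" "\<And>z. has_copy c P z (copies m H)"
  shows "\<exists>t Z. Z \<subseteq> V - P \<and> card Z = t * tie_size \<and> t + m < n \<and> (\<forall>z. has_copy c Z z (copies t H))
    \<and> card (V - P - Z) \<le> rest_bound \<and> n \<le> t + m + (defect + 2)"
proof -
  have finP: "finite P" using P(1) fin finite_subset by blast
  obtain t Z where tZ: "Z \<subseteq> V - P" "card Z = t * tie_size" "\<And>z. has_copy c Z z (copies t H)"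
    "\<not> (\<exists>T. is_tie c (V - P - Z) H T)" using max_ties[of "V - P" c] fin by blast
  have finZ: "finite Z" using tZ(1) fin finite_subset by blast
  obtain z j where zj: "has_copy c (V - P - Z) z (copies j H)" "card (V - P - Z) \<le> k * j + defect"
    using tie_free_pack[OF _ tZ(4)] fin by auto
  have "has_copy c (P \<union> (Z \<union> (V - P - Z))) z (copies (m + (t + j)) H)"
    using tZ(1) by (intro packs_Un[OF simple P(3) packs_Un[OF simple tZ(3) zj(1)]]) auto
  moreover have "P \<union> (Z \<union> (V - P - Z)) = V" using tZ(1) P(1) by auto
  ultimately have lt: "m + (t + j) < n"
    using packs_le[OF simple, of c V z "m + (t + j)" n] free unfolding has_mono_copy_def by (metis not_le)
  have cV: "card V = m * tie_size + t * tie_size + card (V - P - Z)"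
  proof -
    have "card V = card P + card (V - P)" using P(1) fin finP by (simp add: card_Diff_subset card_mono)
    moreover have "card (V - P) = card Z + card (V - P - Z)"
      using tZ(1) fin finZ card_mono[of "V - P" Z] by (simp add: card_Diff_subset)
    ultimately show ?thesis using P(2) tZ(2) by simp
  qed
  \<comment> \<open>The copies still missing before the final one-coloured packing. Its
    \<open>j < e\<close> copies cost \<open>k\<close> each while the lower bound on V demands
    \<open>tie_size\<close> for each of the \<open>e\<close>; the difference
    \<open>e * (k - \<alpha>)\<close> is at most \<open>defect + 2\<close>.\<close>
  define e where "e = n - (m + t)"
  have e: "n = m + t + e" "j + 1 \<le> e" using lt by (auto simp: e_def)
  have "n * tie_size = m * tie_size + t * tie_size + e * tie_size" by (simp add: e(1) add_mult_distrib)
  then have "e * tie_size \<le> k * j + defect + 2" using V cV zj(2) by linarith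
  moreover have "e * tie_size = k * e + e * (k - \<alpha>)" unfolding tie_size_split by (simp add: add_mult_distrib2 mult.commute)
  moreover have "k * j + k \<le> k * e" using mult_le_mono2[OF e(2), of k] by simp
  ultimately have ek: "e * (k - \<alpha>) \<le> defect + 2" and je: "k * j \<le> k * e" by linarith+
  have "1 \<le> k - \<alpha>" using \<alpha>_less by simp
  then have "e * 1 \<le> e * (k - \<alpha>)" by (rule mult_le_mono2)
  then have eL: "e \<le> defect + 2" using ek by linarith
  have "k * e \<le> (d + 1) * (k - \<alpha>) * e" using k_le by (rule mult_le_mono1)
  also have "\<dots> = (d + 1) * (e * (k - \<alpha>))" by (simp only: mult.assoc mult.commute[of e])
  also have "\<dots> \<le> (d + 1) * (defect + 2)" using ek by (rule mult_le_mono2)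
  finally have "card (V - P - Z) \<le> (d + 1) * (defect + 2) + defect" using zj(2) je by linarith
  also have "\<dots> \<le> rest_bound" by (simp add: rest_bound_def)
  finally have "card (V - P - Z) \<le> rest_bound" .
  then show ?thesis using tZ(1-3) lt e eL by (intro exI[of _ t] exI[of _ Z]) auto
qed

text \<open>A vertex with many \<open>x\<close>-neighbours in \<open>R2\<close> lies in a tie by
  \<open>tie_through_x\<close>. Otherwise it sees most of \<open>R2\<close> in colour
  \<open>y\<close>, and then many \<open>y\<close>-neighbours in \<open>B2\<close> suffice for
  \<open>tie_through_y\<close>. The ties are chosen one after another, since together they use a
  negligible part of the pair.\<close>

lemma cover_bad_vertices:
  fixes c :: "'b set \<Rightarrow> colour"
  assumes xy: "x \<noteq> y" and good: "good c x y R B S \<theta>" and S: "\<Gamma>^11 * k^2 \<le> S"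
    and R2: "R2 \<subseteq> R" "S \<le> 4 * card R2" and B2: "B2 \<subseteq> B" "sc S 4 \<le> card B2"
    and D: "finite D" "D \<inter> (R2 \<union> B2) = {}" "card D \<le> rest_bound"
      "\<And>v. v \<in> D \<Longrightarrow> 2 * \<theta> 0 \<le> card (nbr c x v R2) \<or> sc S 11 \<le> card (nbr c y v B2)"
  shows "\<exists>Z\<subseteq>R2 \<union> B2 \<union> D. D \<subseteq> Z \<and> card Z = card D * tie_size \<and> (\<forall>z. has_copy c Z z (copies (card D) H))"
proof -
  note G = goodD[OF good]
  note W = rest_bound_small[OF S]
  have SR: "0 \<le> real S" by simp
  have fin2: "finite R2" "finite B2" using R2(1) B2(1) G(1,2) finite_subset by blast+
  have sc50: "sc S 50 \<le> sc S 26" using sc_pow[OF SR, of 26 50] sc_nonneg[OF SR, of 50] by simp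
  have sc26: "sc S 26 \<le> sc S 13" using sc_pow[OF SR, of 13 26] sc_nonneg[OF SR, of 26] by simp
  have sc13: "2 * sc S 12 \<le> sc S 11" "2 * sc S 13 \<le> sc S 12" "2 * sc S 12 \<le> sc S 4"
    using sc_pow[OF SR, of 11 12] sc_pow[OF SR, of 12 13] sc_pow[OF SR, of 4 12] sc_nonneg[OF SR, of 12] by simp_all
  have sc16: "65536 * sc S 16 \<le> S" using sc_pow[OF SR, of 0 16] by (simp add: sc_0)
  have "\<exists>Z\<subseteq>R2 \<union> B2 \<union> D0. D0 \<subseteq> Z \<and> card Z = card D0 * tie_size \<and> (\<forall>z. has_copy c Z z (copies (card D0) H))"
    if "D0 \<subseteq> D" for D0
    using finite_subset[OF that D(1)] that
  proof (induction D0 rule: finite_induct)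
    case empty
    show ?case by (intro exI[of _ "{}"]) auto
  next
    case (insert v D0)
    then have "D0 \<subseteq> D" by simp
    from insert.IH[OF this]
    obtain Z where Z: "Z \<subseteq> R2 \<union> B2 \<union> D0" "D0 \<subseteq> Z" "card Z = card D0 * tie_size"
      "\<And>z. has_copy c Z z (copies (card D0) H)" by blast
    have v: "v \<in> D" "v \<notin> Z" using insert Z(1) D(2) by auto
    have finZ: "finite Z" using Z(1) fin2 insert.hyps finite_subset by blast
    have "card D0 \<le> rest_bound" using card_mono[OF D(1) \<open>D0 \<subseteq> D\<close>] D(3) by simp
    then have "card D0 * tie_size \<le> rest_bound * (2 * k)" by (intro mult_le_mono) auto
    then have "card Z \<le> 2 * (k * rest_bound)" using Z(3) by (simp add: mult.commute mult.left_commute)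
    then have rZ: "real (card Z) \<le> 2 * (k * rest_bound)" using of_nat_mono by fastforce
    have "\<exists>X Y. has_copy c X x H \<and> has_copy c Y y H \<and> v \<in> X \<union> Y
       \<and> X \<union> Y \<subseteq> insert v ((R2 \<union> B2) - Z) \<and> card (X \<union> Y) = tie_size"
    proof (cases "2 * \<theta> 0 \<le> card (nbr c x v R2)")
      case True
      have 1: "\<theta> 0 \<le> card (nbr c x v R2 - Z)"
        using card_Diff_real[OF finZ, of "nbr c x v R2"] True rZ W(1,4) sc50 G(11) by linarith
      have 2: "sc S 12 \<le> card (B2 - Z)"
        using card_Diff_real[OF finZ, of B2] B2(2) rZ W(1,4) sc50 sc26 sc13 by linarith
      have s: "nbr c x v R2 - Z \<subseteq> nbr c x v R" "B2 - Z \<subseteq> B" "v \<notin> B2 - Z"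
        using R2(1) B2(1) v D(2) by (auto simp: nbr_def)
      have "(nbr c x v R2 - Z) \<union> (B2 - Z) \<subseteq> (R2 \<union> B2) - Z" by (auto simp: nbr_def)
      then show ?thesis using tie_through_x[OF xy good W(2) s 1 2] by blast
    next
      case False
      then have B: "sc S 11 \<le> card (nbr c y v B2)" using D(4)[OF v(1)] by blast
      have "R2 - nbr c y v R2 = nbr c x v R2"
        using v(1) D(2) by (intro nbr_other[OF xy[symmetric]]) auto
      then have "card R2 - real (card (nbr c x v R2)) \<le> card (nbr c y v R2)"
        using nbr_card_lower[OF fin2(1) subset_refl, of c y v] by simp
      moreover have "S \<le> 4 * real (card R2)" using of_nat_mono[OF R2(2)] by simp
      ultimately have "3 * sc S 16 \<le> card (nbr c y v R2)"
        using False G(12) sc16 sc_nonneg[OF SR, of 16] by linarith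
      then have 1: "\<theta> 0 \<le> card (nbr c y v R2 - Z)"
        using card_Diff_real[OF finZ, of "nbr c y v R2"] rZ W(1,4) sc50 G(11,12) by linarith
      have 2: "sc S 12 \<le> card (nbr c y v B2 - Z)"
        using card_Diff_real[OF finZ, of "nbr c y v B2"] B rZ W(1,4) sc50 sc26 sc13 by linarith
      have s: "nbr c y v R2 - Z \<subseteq> nbr c y v R" "nbr c y v B2 - Z \<subseteq> nbr c y v B"
        using R2(1) B2(1) by (auto simp: nbr_def)
      have "(nbr c y v R2 - Z) \<union> (nbr c y v B2 - Z) \<subseteq> (R2 \<union> B2) - Z" by (auto simp: nbr_def)
      then show ?thesis using tie_through_y[OF xy good W(2) s 1 2] by blast
    qed
    then obtain X Y where XY: "has_copy c X x H" "has_copy c Y y H" "v \<in> X \<union> Y"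
       "X \<union> Y \<subseteq> insert v ((R2 \<union> B2) - Z)" "card (X \<union> Y) = tie_size" by blast
    have finT: "finite (X \<union> Y)" using XY(5) \<alpha>_less by (intro card_ge_0_finite) simp
    have disj: "Z \<inter> (X \<union> Y) = {}" using XY(4) v(2) by auto
    have cI: "card (insert v D0) = card D0 + 1" using insert.hyps by simp
    show ?case
    proof (intro exI[of _ "Z \<union> (X \<union> Y)"] conjI allI)
      show "Z \<union> (X \<union> Y) \<subseteq> R2 \<union> B2 \<union> insert v D0" using Z(1) XY(4) by auto
      show "insert v D0 \<subseteq> Z \<union> (X \<union> Y)" using Z(2) XY(3) by auto
      show "card (Z \<union> (X \<union> Y)) = card (insert v D0) * tie_size"
        using finZ finT disj Z(3) XY(5) cI by (simp add: card_Un_disjoint)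
      fix z
      have "z = x \<or> z = y" using xy by (cases x; cases y; cases z) auto
      then have "has_copy c (X \<union> Y) z H"
        using XY(1,2) has_copy_mono[of c X x H "X \<union> Y"] has_copy_mono[of c Y y H "X \<union> Y"] by auto
      then show "has_copy c (Z \<union> (X \<union> Y)) z (copies (card (insert v D0)) H)"
        unfolding cI using disj by (intro packs_Un[OF simple Z(4) packs_1[OF simple]]) auto
    qed
  qed
  then show ?thesis by blast
qed

text \<open>The sizes are arranged for \<open>eliminate_ties\<close>. Only the non-edges matter to
  \<open>transfer\<close>, so the vertices of \<open>E\<close> need to be joined only almost
  completely to what is left of \<open>R2\<close> and \<open>B2\<close>.\<close>

lemma core_structure:
  fixes c :: "nat set \<Rightarrow> colour"
  assumes fin: "finite V" and free: "\<not> has_mono_copy c V (copies n H)"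
    and V: "n * tie_size \<le> card V + 2" and n: "\<Gamma>^20 * k \<le> n"
  shows "\<exists>x y (c' :: nat set \<Rightarrow> colour) R B E. x \<noteq> y \<and> structured c' x y R B E
    \<and> \<not> has_mono_copy c' (R \<union> B \<union> E) (copies n H) \<and> card (R \<union> B \<union> E) = card V
    \<and> card E < n \<and> card E \<le> rest_bound
    \<and> \<alpha> * n + k * rest_bound + 2 * k + 2 * d + 1 + k * card E \<le> card R
    \<and> k * rest_bound + 2 * k + 2 * d + 1 + k * card E \<le> card B"
proof -
  obtain x y R B S \<theta> where xy: "x \<noteq> y" and RB: "R \<union> B \<subseteq> V" and good: "good c x y R B S \<theta>"
    and S: "\<Gamma>^11 * k^2 \<le> S" using find_good[OF fin free V n] by blast
  note G = goodD[OF good]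
  note W = rest_bound_small[OF S]
  have SR: "0 \<le> real S" by simp
  have S0: "0 < S" using k_small(3)[OF W(2)] .
  obtain R1 B1 where R1: "R1 \<subseteq> R" "S \<le> 2 * card R1" and B1: "B1 \<subseteq> B" "S \<le> 2 * card B1"
    and cross: "\<And>b. b \<in> B1 \<Longrightarrow> card (R - nbr c y b R) \<le> sc S 15"
    using dense_pair[OF xy good S RB fin free V] by blast
  \<comment> \<open>The parts \<open>R1\<close> and \<open>B1\<close> keep at least half of
    \<open>S\<close>, so both can be cut down to the exact proportions k m and (k - \<alpha>) m of
    \<open>packs_in_pair\<close>.\<close>
  define m where "m = S div (2 * k)"
  have kp: "0 < 2 * k" using k_pos by simp
  have km: "2 * (k * m) \<le> S" unfolding m_def using times_div_less_eq_dividend[of "2 * k" S] by (simp add: mult.assoc)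
  have sc1: "8 * sc S 50 \<le> S" using sc_pow[OF SR, of 0 50] sc_nonneg[OF SR, of 50] by (simp add: sc_0)
  have "4 * real k \<le> S"
  proof -
    have "real k \<le> real (k * rest_bound)" using W(3) by (rule of_nat_mono)
    then show ?thesis using W(1) sc1 by linarith
  qed
  then have k4: "4 * k \<le> S" by linarith
  have "S < 2 * (k * m) + 2 * k"
    unfolding m_def using dividend_less_times_div[OF kp, of S] by (simp add: mult.assoc)
  then have Skm: "S \<le> 4 * (k * m)" using k4 by linarith
  have am: "(k - \<alpha>) * m \<le> k * m" by (intro mult_le_mono1) simp
  obtain R2 where R2: "R2 \<subseteq> R1" "card R2 = k * m"
    using obtain_subset_with_card_n[of "k * m" R1] km R1(2) by auto
  obtain B2 where B2: "B2 \<subseteq> B1" "card B2 = (k - \<alpha>) * m"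
    using obtain_subset_with_card_n[of "(k - \<alpha>) * m" B1] km B1(2) am by auto
  have R2R: "R2 \<subseteq> R" and B2B: "B2 \<subseteq> B" using R2 R1 B2 B1 by auto
  have fin2: "finite R2" "finite B2" using R2R B2B G(1,2) finite_subset by blast+
  have disj2: "R2 \<inter> B2 = {}" using R2R B2B G(3) by auto
  have "real S \<le> 4 * real (k * m)" using of_nat_mono[OF Skm] by simp
  then have sc4: "sc S 4 \<le> (k - \<alpha>) * m" using sc4_le[OF SR, of m] by simp
  have s40: "sc S 40 \<le> sc S 15" using sc_pow[OF SR, of 15 40] sc_nonneg[OF SR, of 40] by simp
  have s15: "sc S 15 \<le> sc S 11" using sc_pow[OF SR, of 11 15] sc_nonneg[OF SR, of 15] by simp
  have s16: "sc S 16 \<le> sc S 11" using sc_pow[OF SR, of 11 16] sc_nonneg[OF SR, of 16] by simp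
  have s11: "0 \<le> sc S 11" by (rule sc_nonneg[OF SR])
  have s10: "d * sc S 11 \<le> sc S 10" using sc_d[OF SR, of 10] by simp
  have s4: "64 * sc S 10 \<le> sc S 4" using sc_pow[OF SR, of 4 10] by simp
  have s50: "sc S 50 \<le> sc S 10" using sc_pow[OF SR, of 10 50] sc_nonneg[OF SR, of 50] by simp
  have s4p: "0 < sc S 4" using S0 by (simp add: sc_def)
  have RR: "card (R2 - nbr c x v R2) \<le> sc S 11" if "v \<in> R2" for v
    using nonnbr_mono[OF G(1) R2R, of c x v] G(6)[of v] that R2R s40 s15 by force
  have BB: "card (B2 - nbr c y v B2) \<le> sc S 11" if "v \<in> B2" for v
    using nonnbr_mono[OF G(2) B2B, of c y v] G(7)[of v] that B2B s40 s15 by force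
  have BR: "card (R2 - nbr c y v R2) \<le> sc S 11" if "v \<in> B2" for v
    using nonnbr_mono[OF G(1) R2R, of c y v] cross[of v] that B2 s15 by force
  have dm: "2 * d * sc S 11 < (k - \<alpha>) * m" using s10 s4 s4p sc4 by linarith
  note packs = packs_in_pair[OF fin2 disj2 R2(2) B2(2) RR BB BR s11 dm]
  define P where "P = R2 \<union> B2"
  have "card P = card R2 + card B2" unfolding P_def using fin2 disj2 by (rule card_Un_disjoint)
  then have cP: "card P = m * tie_size"
    unfolding R2(2) B2(2) tie_size_split by (simp add: add_mult_distrib2 mult.commute)
  have PV: "P \<subseteq> V" using R2R B2B RB by (auto simp: P_def)
  have Pz: "has_copy c P z (copies m H)" for z
  proof -
    have "z = x \<or> z = y" using xy by (cases x; cases y; cases z) auto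
    then show ?thesis using packs has_copy_mono[OF packs(1), of P] by (auto simp: P_def)
  qed
  obtain t Z where Z: "Z \<subseteq> V - P" "card Z = t * tie_size" "t + m < n" "\<And>z. has_copy c Z z (copies t H)"
    "card (V - P - Z) \<le> rest_bound" "n \<le> t + m + (defect + 2)" using rest_small[OF fin free V PV cP Pz] by blast
  define N where "N = V - P - Z"
  have finN: "finite N" using fin by (simp add: N_def)
  \<comment> \<open>The complement of this condition is exactly what \<open>E\<close> needs: few
    \<open>x\<close>-edges to \<open>R2\<close> and few \<open>y\<close>-edges to
    \<open>B2\<close>.\<close>
  define D where "D = {v \<in> N. 2 * \<theta> 0 \<le> card (nbr c x v R2) \<or> sc S 11 \<le> card (nbr c y v B2)}"
  have DN: "D \<subseteq> N" by (auto simp: D_def)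
  have finD: "finite D" using DN finN finite_subset by blast
  have cD: "card D \<le> rest_bound" using card_mono[OF finN DN] Z(5) by (simp add: N_def)
  have "\<exists>Z\<subseteq>R2 \<union> B2 \<union> D. D \<subseteq> Z \<and> card Z = card D * tie_size \<and> (\<forall>z. has_copy c Z z (copies (card D) H))"
  proof (rule cover_bad_vertices[OF xy good S R2R _ B2B _ finD _ cD])
    show "S \<le> 4 * card R2" using Skm R2(2) by simp
    show "sc S 4 \<le> card B2" using sc4 B2(2) by simp
    show "D \<inter> (R2 \<union> B2) = {}" using DN by (auto simp: N_def P_def)
  qed (auto simp: D_def)
  then obtain Y where Y: "Y \<subseteq> R2 \<union> B2 \<union> D" "D \<subseteq> Y" "card Y = card D * tie_size"
    "\<And>z. has_copy c Y z (copies (card D) H)" by blast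
  have finY: "finite Y" using Y(1) fin2 finD finite_subset by blast
  define Ro Bo E where "Ro = R2 - Y" and "Bo = B2 - Y" and "E = N - D"
  \<comment> \<open>The number of ties removed in all: \<open>t\<close> away from the pair and one
    for each vertex of \<open>D\<close>.\<close>
  define \<tau> where "\<tau> = t + card D"
  define n' where "n' = n - \<tau>"
  have EN: "E \<subseteq> N" by (auto simp: E_def)
  have finE: "finite E" using EN finN finite_subset by blast
  have cE: "card E \<le> rest_bound" using card_mono[OF finN EN] Z(5) by (simp add: N_def)
  have finZ: "finite Z" using Z(1) fin finite_subset by blast
  have YZ: "Z \<inter> Y = {}" using Z(1) Y(1) DN by (auto simp: P_def N_def)
  have ZY: "has_copy c (Z \<union> Y) z (copies \<tau> H)" for z
    unfolding \<tau>_def by (rule packs_Un[OF simple Z(4) Y(4) YZ])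
  have Vsplit: "V = (Z \<union> Y) \<union> (Ro \<union> Bo \<union> E)"
    using Z(1) Y(1,2) PV DN by (auto simp: Ro_def Bo_def E_def N_def P_def)
  have dVs: "(Z \<union> Y) \<inter> (Ro \<union> Bo \<union> E) = {}"
    using Z(1) Y(1,2) by (auto simp: Ro_def Bo_def E_def N_def P_def)
  have cY: "card Y \<le> 2 * (k * rest_bound)"
  proof -
    have "card D * tie_size \<le> rest_bound * (2 * k)" using cD by (intro mult_le_mono) auto
    then show ?thesis using Y(3) by (simp add: mult.commute mult.left_commute)
  qed
  then have rY: "real (card Y) \<le> 2 * (k * rest_bound)" using of_nat_mono by fastforce
  have kw4: "real (10 * (k * rest_bound)) \<le> real ((k - \<alpha>) * m)"
  proof -
    have "real (10 * (k * rest_bound)) = 10 * real (k * rest_bound)" by simp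
    then have "real (10 * (k * rest_bound)) \<le> sc S 50" using W(1,4) by linarith
    also have "\<dots> \<le> (k - \<alpha>) * m" using s50 s4 s4p sc4 sc_nonneg[OF SR, of 10] by linarith
    finally show ?thesis .
  qed
  then have kw10: "10 * (k * rest_bound) \<le> (k - \<alpha>) * m" using of_nat_le_iff by blast
  have m10: "10 * rest_bound \<le> m"
  proof -
    have "k * (10 * rest_bound) = 10 * (k * rest_bound)" by simp
    then have "k * (10 * rest_bound) \<le> k * m" using kw10 am by linarith
    then show ?thesis using k_pos by simp
  qed
  \<comment> \<open>The number of remaining copies is \<open>m\<close> up to
    \<open>rest_bound\<close> from above, so \<alpha> n' vertices fit into what is left of
    \<open>R2\<close> with almost (k - \<alpha>) m vertices to spare.\<close>
  have \<tau>n: "\<tau> + rest_bound < n" "n' = n - \<tau>" "n' + \<tau> = n" "rest_bound \<le> n'" "n' \<le> m + rest_bound"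
  proof -
    have "1 \<le> rest_bound" using rest_bound_le(2) by simp
    then show "\<tau> + rest_bound < n" using Z(3) cD m10 unfolding \<tau>_def by linarith
    then show "n' + \<tau> = n" "rest_bound \<le> n'" by (simp_all add: n'_def)
    show "n' \<le> m + rest_bound" using Z(6) rest_bound_le(2) unfolding n'_def \<tau>_def by linarith
  qed (simp add: n'_def)
  have free': "\<not> has_mono_copy c (Ro \<union> Bo \<union> E) (copies n' H)"
  proof
    assume "has_mono_copy c (Ro \<union> Bo \<union> E) (copies n' H)"
    then obtain z where "has_copy c (Ro \<union> Bo \<union> E) z (copies n' H)" by (auto simp: has_mono_copy_def)
    then have "has_copy c V z (copies (\<tau> + n') H)"
      unfolding Vsplit by (intro packs_Un[OF simple ZY _ dVs])
    then show False using free \<tau>n(3) by (auto simp: has_mono_copy_def add.commute)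
  qed
  have fo: "finite Ro" "finite Bo" using fin2 by (auto simp: Ro_def Bo_def)
  have cRo: "card R2 \<le> card Ro + card Y" and cBo: "card B2 \<le> card Bo + card Y"
    using diff_card_le_card_Diff[OF finY, of R2] diff_card_le_card_Diff[OF finY, of B2]
    by (auto simp: Ro_def Bo_def)
  obtain R' where R': "finite R'" "card R' = card Ro + k * \<tau>" "R' \<inter> E = {}"
    using fresh_set[OF finE] by blast
  obtain B' where B': "finite B'" "card B' = card Bo + (k - \<alpha>) * \<tau>" "B' \<inter> (E \<union> R') = {}"
    using fresh_set[of "E \<union> R'"] finE R'(1) by blast
  obtain c' where c': "structured c' x y R' B' E" "\<And>u v. u \<in> E \<Longrightarrow> v \<in> E \<Longrightarrow> c' {u, v} = c {u, v}"
    using structured_exists[of R' B' E x y c] R' B' finE by blast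
  have am': "(k - \<alpha>) * m + \<alpha> * m = k * m"
    using \<alpha>_less by (metis add_mult_distrib le_add_diff_inverse2 less_imp_le)
  have kE: "k * card E \<le> k * rest_bound" using cE by (rule mult_le_mono2)
  have rkE: "real (k * card E) \<le> k * rest_bound" using kE by (rule of_nat_mono)
  have rR: "real (card R2) \<le> card Ro + card Y" "real (card B2) \<le> card Bo + card Y"
    using cRo cBo by linarith+
  have sub2: "Ro \<subseteq> R2" "Bo \<subseteq> B2" by (auto simp: Ro_def Bo_def)
  have "\<not> has_mono_copy c' (R' \<union> B' \<union> E) (copies (n' + \<tau>) H)"
  proof (rule transfer[OF xy c'(1), where R=Ro and B=Bo and c=c and \<eta>="sc S 11"])
    show "Ro \<inter> Bo = {}" "Ro \<inter> E = {}" "Bo \<inter> E = {}"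
      using disj2 EN by (auto simp: Ro_def Bo_def N_def P_def)
    show "card (Ro - nbr c x v Ro) \<le> sc S 11" if "v \<in> Ro" for v
      using nonnbr_mono[OF fin2(1) sub2(1), of c x v] RR[of v] that sub2 by force
    show "card (Bo - nbr c y v Bo) \<le> sc S 11" if "v \<in> Bo" for v
      using nonnbr_mono[OF fin2(2) sub2(2), of c y v] BB[of v] that sub2 by force
    show "card (Ro - nbr c y v Ro) \<le> sc S 11" if "v \<in> Bo" for v
      using nonnbr_mono[OF fin2(1) sub2(1), of c y v] BR[of v] that sub2 by force
    have Enot: "v \<notin> R2" "v \<notin> B2" "card (nbr c x v R2) < 2 * \<theta> 0" "card (nbr c y v B2) < sc S 11"
      if "v \<in> E" for v
      using that by (auto simp: E_def D_def N_def P_def)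
    show "card (Ro - nbr c y v Ro) \<le> sc S 11" if "v \<in> E" for v
    proof -
      have "R2 - nbr c y v R2 = nbr c x v R2" using Enot(1)[OF that] by (rule nbr_other[OF xy[symmetric]])
      then show ?thesis
        using nonnbr_mono[OF fin2(1) sub2(1), of c y v] Enot(3)[OF that] G(12) s16 by simp
    qed
    show "card (Bo - nbr c x v Bo) \<le> sc S 11" if "v \<in> E" for v
    proof -
      have "B2 - nbr c x v B2 = nbr c y v B2" using Enot(2)[OF that] by (rule nbr_other[OF xy])
      then show ?thesis
        using nonnbr_mono[OF fin2(2) sub2(2), of c x v] Enot(4)[OF that] by simp
    qed
    have Bo1: "2 * (d * sc S 11) + 3 * real (k * rest_bound) < card Bo"
      using rR(2) rY B2(2) s10 s4 s4p sc4 W(1) s50 sc_nonneg[OF SR, of 10] by linarith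
    have Ro1: "real (\<alpha> * n') + d * sc S 11 + 3 * real (k * rest_bound) < card Ro"
    proof -
      have "\<alpha> * n' \<le> \<alpha> * m + \<alpha> * rest_bound" using mult_le_mono2[OF \<tau>n(5), of \<alpha>] by (simp add: distrib_left)
      moreover have "\<alpha> * rest_bound \<le> k * rest_bound" using \<alpha>_less by (intro mult_le_mono1) simp
      ultimately have "\<alpha> * n' \<le> \<alpha> * m + k * rest_bound" by linarith
      then have "real (\<alpha> * n') \<le> real (\<alpha> * m) + real (k * rest_bound)" unfolding of_nat_add[symmetric] by (rule of_nat_mono)
      moreover have "real (card R2) = real ((k - \<alpha>) * m) + real (\<alpha> * m)" unfolding R2(2) am'[symmetric] by (rule of_nat_add)
      ultimately show ?thesis
        using rR(1) rY s10 s4 s4p sc4 W(1) s50 sc_nonneg[OF SR, of 10] by linarith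
    qed
    have kw0: "0 \<le> real (k * rest_bound)" by simp
    have ds0: "0 \<le> real d * sc S 11" using s11 by simp
    show "real (2 * d) * sc S 11 < card Bo" using Bo1 kw0 by linarith
    show "real (2 * d) * sc S 11 < card Ro"
    proof -
      have "real ((k - \<alpha>) * m) \<le> card R2" unfolding R2(2) using am by (rule of_nat_mono)
      then show ?thesis using rR(1) rY s10 s4 s4p sc4 W(1) s50 sc_nonneg[OF SR, of 10] by linarith
    qed
    show "card E \<le> n'" using cE \<tau>n(4) by linarith
    show "real (k * card E) + d * sc S 11 \<le> card Bo" using Bo1 rkE kw0 ds0 by linarith
    show "real (\<alpha> * n' + k * card E) + d * sc S 11 \<le> card Ro" using Ro1 rkE kw0 unfolding of_nat_add by linarith
  qed (use fo c'(2) R' B' free' s11 in auto)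
  then have f2: "\<not> has_mono_copy c' (R' \<union> B' \<union> E) (copies n H)" using \<tau>n(3) by simp
  have tot: "card (R' \<union> B' \<union> E) = card V"
  proof -
    have "card (R' \<union> B' \<union> E) = card R' + card B' + card E"
      using R' B' finE by (subst card_Un_disjoint; (subst card_Un_disjoint)?) auto
    moreover have "card V = card (Z \<union> Y) + card (Ro \<union> Bo \<union> E)"
      using fin dVs unfolding Vsplit by (intro card_Un_disjoint) (auto intro: finite_subset)
    moreover have "card (Z \<union> Y) = \<tau> * tie_size"
      using finZ finY YZ Z(2) Y(3) by (simp add: card_Un_disjoint \<tau>_def add_mult_distrib)
    moreover have "card (Ro \<union> Bo \<union> E) = card Ro + card Bo + card E"
      using fo finE disj2 EN by (subst card_Un_disjoint; (subst card_Un_disjoint)?) (auto simp: Ro_def Bo_def N_def P_def)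
    moreover have "\<tau> * tie_size = k * \<tau> + (k - \<alpha>) * \<tau>" unfolding tie_size_split by (simp add: add_mult_distrib2 mult.commute)
    ultimately show ?thesis using R'(2) B'(2) by linarith
  qed
  \<comment> \<open>The final cliques have about k n and (k - \<alpha>) n vertices. In both, (k -
    \<alpha>) n beyond the required multiple of \<alpha> n is available for all bounded
    terms.\<close>
  have nk: "20 * (k * rest_bound) \<le> (k - \<alpha>) * n"
  proof -
    have "20 * (k * rest_bound) \<le> \<Gamma> * (k * (\<Gamma>^8 * k))" using \<Gamma>_ge rest_bound_le(1) by (intro mult_le_mono mult_le_mono2) auto
    also have "\<dots> = \<Gamma>^9 * k^2" by (simp add: eval_nat_numeral mult.assoc mult.left_commute)
    also have "\<dots> \<le> \<Gamma>^19 * k^2" by (intro mult_le_mono1 \<Gamma>_pow_mono) simp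
    finally show ?thesis using n_large[OF n] by linarith
  qed
  have kd: "2 * k + 2 * d + 1 \<le> 5 * (k * rest_bound)"
  proof -
    have "d + 2 \<le> rest_bound" unfolding rest_bound_def using mult_le_mono2[of 1 "defect + 2" "d + 2"] by simp
    then have "d + 2 \<le> k * rest_bound" using W(5) by linarith
    then show ?thesis using W(3) by linarith
  qed
  have kmn: "k * n = k * \<tau> + k * n'" "(k - \<alpha>) * n = (k - \<alpha>) * \<tau> + (k - \<alpha>) * n'"
    using \<tau>n(3) by (auto simp flip: distrib_left)
  have mw: "k * n' \<le> k * m + k * rest_bound" "(k - \<alpha>) * n' \<le> (k - \<alpha>) * m + k * rest_bound"
  proof -
    show "k * n' \<le> k * m + k * rest_bound" using mult_le_mono2[OF \<tau>n(5), of k] by (simp add: distrib_left)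
    have "(k - \<alpha>) * n' \<le> (k - \<alpha>) * m + (k - \<alpha>) * rest_bound" using mult_le_mono2[OF \<tau>n(5), of "k - \<alpha>"] by (simp add: distrib_left)
    moreover have "(k - \<alpha>) * rest_bound \<le> k * rest_bound" by (intro mult_le_mono1) simp
    ultimately show "(k - \<alpha>) * n' \<le> (k - \<alpha>) * m + k * rest_bound" by linarith
  qed
  have kan: "k * n = (k - \<alpha>) * n + \<alpha> * n"
    using \<alpha>_less by (metis add_mult_distrib le_add_diff_inverse2 less_imp_le)
  have b1: "\<alpha> * n + k * rest_bound + 2 * k + 2 * d + 1 + k * card E \<le> card R'"
    using R'(2) cRo R2(2) cY kmn(1) mw(1) kan nk kd kE by linarith
  have b2: "k * rest_bound + 2 * k + 2 * d + 1 + k * card E \<le> card B'"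
    using B'(2) cBo B2(2) cY kmn(2) mw(2) nk kd kE by linarith
  have "card E < n" using cE \<tau>n(1) by linarith
  then show ?thesis using xy c'(1) f2 tot cE b1 b2 by blast
qed

end

section \<open>The structure theorem\<close>

lemma relabel_copy:
  assumes "inj_on b V" "S \<subseteq> V" "has_copy (\<lambda>e. c (b ` e)) S x F" shows "has_copy c (b ` S) x F"
proof -
  obtain f where f: "inj_on f (verts F)" "f ` verts F \<subseteq> S" "\<forall>e\<in>edges F. c (b ` (f ` e)) = x"
    using assms(3) unfolding has_copy_def by blast
  have "inj_on (b \<circ> f) (verts F)" using f assms by (meson comp_inj_on inj_on_subset subset_trans)
  moreover have "(b \<circ> f) ` verts F \<subseteq> b ` S" using f(2) by auto
  moreover have "\<forall>e\<in>edges F. c ((b \<circ> f) ` e) = x" using f(3) by (simp add: image_comp)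
  ultimately show ?thesis unfolding has_copy_def by blast
qed

lemma relabel_tie:
  assumes "inj_on b V" "is_tie (\<lambda>e. c (b ` e)) V H T" shows "is_tie c (b ` V) H (b ` T)"
proof -
  have T: "T \<subseteq> V" "finite T" "card T = 2 * card (verts H) - independence_number H"
    "has_copy (\<lambda>e. c (b ` e)) T Red H" "has_copy (\<lambda>e. c (b ` e)) T Blue H"
    using assms(2) by (auto simp: is_tie_def)
  have "card (b ` T) = card T" using card_image inj_on_subset[OF assms(1) T(1)] by blast
  then show ?thesis
    using T relabel_copy[OF assms(1) T(1), of c _ H] unfolding is_tie_def by (simp add: image_mono)
qed

lemma relabel_structure:
  fixes c :: "'b set \<Rightarrow> colour"
  assumes st: "structured c x y R B E" and N: "card (R \<union> B \<union> E) = N"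
    and free: "\<not> has_mono_copy c (R \<union> B \<union> E) F"
    and tie: "\<not> (\<exists>T. is_tie c (R \<union> B \<union> E) H T \<and> T \<inter> E \<noteq> {})"
  shows "\<exists>(c' :: nat set \<Rightarrow> colour) R' B' E'. structured c' x y R' B' E' \<and> R' \<union> B' \<union> E' = {..<N}
    \<and> card R' = card R \<and> card B' = card B \<and> card E' = card E
    \<and> \<not> has_mono_copy c' {..<N} F \<and> \<not> (\<exists>T. is_tie c' {..<N} H T \<and> T \<inter> E' \<noteq> {})"
proof -
  note S = structuredD[OF st]
  obtain b where b: "bij_betw b {..<N} (R \<union> B \<union> E)"
    using S(1-3) N bij_betw_iff_card[of "{..<N}" "R \<union> B \<union> E"] by auto
  have inj: "inj_on b {..<N}" and im: "b ` {..<N} = R \<union> B \<union> E" using b by (auto simp: bij_betw_def)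
  define c' where "c' e = c (b ` e)" for e
  define pre where "pre A = {i \<in> {..<N}. b i \<in> A}" for A
  have bpre: "b ` pre A = A" if "A \<subseteq> R \<union> B \<union> E" for A
    using that im by (fastforce simp: pre_def)
  have cpre: "card (pre A) = card A" if "A \<subseteq> R \<union> B \<union> E" for A
  proof -
    have "inj_on b (pre A)" using inj by (rule inj_on_subset) (auto simp: pre_def)
    then show ?thesis using card_image bpre[OF that] by metis
  qed
  have "structured c' x y (pre R) (pre B) (pre E)"
    unfolding structured_def
  proof (intro conjI ballI impI)
    show "c' {u, v} = x" if "u \<in> pre R" "v \<in> pre R" "u \<noteq> v" for u v
      using that S(7)[of "b u" "b v"] inj by (auto simp: c'_def pre_def inj_on_def)
    show "c' {u, v} = y" if "u \<in> pre B" "v \<in> pre B" "u \<noteq> v" for u v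
      using that S(8)[of "b u" "b v"] inj by (auto simp: c'_def pre_def inj_on_def)
    show "c' {u, v} = y" if "u \<in> pre R" "v \<in> pre B" for u v
      using that S(9)[of "b u" "b v"] by (auto simp: c'_def pre_def)
    show "c' {u, v} = y" if "u \<in> pre R" "v \<in> pre E" for u v
      using that S(10)[of "b u" "b v"] by (auto simp: c'_def pre_def)
    show "c' {u, v} = x" if "u \<in> pre B" "v \<in> pre E" for u v
      using that S(11)[of "b u" "b v"] by (auto simp: c'_def pre_def)
  qed (use S(4-6) in \<open>auto simp: pre_def\<close>)
  moreover have "pre R \<union> pre B \<union> pre E = {..<N}" using im by (auto simp: pre_def)
  moreover have "card (pre R) = card R" "card (pre B) = card B" "card (pre E) = card E"
    by (auto intro!: cpre)
  moreover have "\<not> has_mono_copy c' {..<N} F"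
    using free relabel_copy[OF inj subset_refl, of c _ F] im
    unfolding has_mono_copy_def c'_def[abs_def] by metis
  moreover have "\<not> (\<exists>T. is_tie c' {..<N} H T \<and> T \<inter> pre E \<noteq> {})"
  proof
    assume "\<exists>T. is_tie c' {..<N} H T \<and> T \<inter> pre E \<noteq> {}"
    then obtain T where T: "is_tie c' {..<N} H T" "T \<inter> pre E \<noteq> {}" by blast
    have "is_tie c (R \<union> B \<union> E) H (b ` T)"
      using relabel_tie[OF inj, of c H T] T(1) im unfolding c'_def[abs_def] by simp
    moreover have "b ` T \<inter> E \<noteq> {}" using T(2) by (auto simp: pre_def)
    ultimately show False using tie by blast
  qed
  ultimately show ?thesis by blast
qed

lemma ex_max_independent:
  assumes "simple_graph H" shows "\<exists>I. independent H I \<and> card I = independence_number H"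
proof -
  have "finite {I. independent H I}"
    using assms by (auto intro: finite_subset[of _ "Pow (verts H)"] simp: independent_def simple_graph_def)
  moreover have "{} \<notin> edges H" using assms by (auto simp: simple_graph_def nsets_def)
  then have "independent H {}" by (auto simp: independent_def)
  ultimately have "Max (card ` {I. independent H I}) \<in> card ` {I. independent H I}"
    by (intro Max_in) auto
  then show ?thesis unfolding independence_number_def by auto
qed

lemma deg_le_max_degree:
  assumes "simple_graph H" shows "deg_le H (max_degree H)"
  using assms unfolding deg_le_def max_degree_def nbh_degree[OF assms] simple_graph_def by simp

theorem theorem5p3:
  "\<exists>C::real. C > 0 \<and>
     (\<forall>(H :: nat ugraph) (k::nat) (\<Delta>::nat) (n::nat).
        simple_graph H \<longrightarrow> card (verts H) = k \<longrightarrow> k \<ge> 1 \<longrightarrow>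
        no_isolated H \<longrightarrow> max_degree H = \<Delta> \<longrightarrow>
        real n \<ge> 2 powr (C * real \<Delta> * (log_degree \<Delta>)^2) * real k \<longrightarrow>
        (\<exists>(V :: nat set) (c :: nat set \<Rightarrow> colour) R B E.
           V = {..<ramsey_number (copies n H) - 1}
           \<and> \<not> has_mono_copy c V (copies n H)
           \<and> R \<union> B \<union> E = V \<and> R \<inter> B = {} \<and> R \<inter> E = {} \<and> B \<inter> E = {}
           \<and> card E \<le> ramsey_number H
           \<and> card R \<ge> k * (card E + 1) \<and> card B \<ge> k * (card E + 1)
           \<and> (\<forall>e \<in> nsets R 2. c e = Red) \<and> (\<forall>e \<in> nsets B 2. c e = Blue)
           \<and> (\<exists>x. \<forall>u\<in>R. \<forall>v\<in>B. c {u, v} = x)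
           \<and> (\<forall>u\<in>R. \<forall>v\<in>E. c {u, v} = Blue)
           \<and> (\<forall>u\<in>B. \<forall>v\<in>E. c {u, v} = Red)
           \<and> \<not> (\<exists>T. is_tie c V H T \<and> T \<inter> E \<noteq> {})))"
proof (intro exI[of _ 208000] conjI allI impI)
  fix H :: "nat ugraph" and k \<Delta> n :: nat
  assume simple: "simple_graph H" and k: "card (verts H) = k" "k \<ge> 1" and iso: "no_isolated H"
    and \<Delta>: "max_degree H = \<Delta>" and n: "real n \<ge> 2 powr (208000 * real \<Delta> * (log_degree \<Delta>)^2) * real k"
  \<comment> \<open>Rounding up at most doubles the logarithm, because \<open>log_degree\<close> is
    at least 1.\<close>
  define p where "p = nat \<lceil>log_degree \<Delta>\<rceil>"
  have L1: "1 \<le> log_degree \<Delta>" unfolding log_degree_def by simp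
  then have p: "real p \<le> 2 * log_degree \<Delta>" "log_degree \<Delta> \<le> p" unfolding p_def by linarith+
  have p1: "1 \<le> p" using p(2) L1 by linarith
  have "real \<Delta> \<le> real (max 2 \<Delta>)" by simp
  also have "\<dots> = 2 powr log_degree \<Delta>" unfolding log_degree_def by simp
  also have "\<dots> \<le> 2 powr p" using p(2) by simp
  also have "\<dots> = real (2^p)" by (simp add: powr_realpow)
  finally have \<Delta>p: "\<Delta> \<le> 2^p" by linarith
  obtain I where I: "independent H I" "card I = independence_number H"
    using ex_max_independent[OF simple] by blast
  interpret ramsey_graph H \<Delta> I p
    using simple k iso deg_le_max_degree[OF simple] I p1 \<Delta>p \<Delta> by unfold_locales auto
  have "real (\<Gamma>^20 * card (verts H)) = 2^(2600 * p^2 * \<Delta> * 20) * real k"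
    using k(1) by (simp add: \<Gamma>_def flip: power_mult)
  \<comment> \<open>Origin of C: \<open>core_structure\<close> needs \<Gamma>^20 k, which gives 2600
    * 20 = 52000, and p^2 is at most 4 times the squared logarithm, which gives 208000.\<close>
  also have "2^(2600 * p^2 * \<Delta> * 20) = (2::real) powr (52000 * (real p)^2 * real \<Delta>)"
    by (simp add: mult.commute mult.left_commute flip: powr_realpow)
  also have "\<dots> \<le> 2 powr (208000 * real \<Delta> * (log_degree \<Delta>)^2)"
  proof -
    have "(real p)^2 \<le> (2 * log_degree \<Delta>)^2" using p(1) by (intro power_mono) auto
    then have "(52000 * real \<Delta>) * (real p)^2 \<le> (52000 * real \<Delta>) * (2 * log_degree \<Delta>)^2"
      by (intro mult_left_mono) auto
    then show ?thesis by (simp add: power2_eq_square algebra_simps)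
  qed
  finally have "real (\<Gamma>^20 * card (verts H)) \<le> real n" using n by (simp add: mult_right_mono)
  then have n': "\<Gamma>^20 * card (verts H) \<le> n" using of_nat_le_iff by blast
  define N where "N = ramsey_number (copies n H) - 1"
  have n1: "1 \<le> n"
  proof -
    have "1 * 1 \<le> \<Gamma>^20 * card (verts H)" using k by (intro mult_le_mono) (auto simp: Suc_le_eq)
    then show ?thesis using n' by linarith
  qed
  have "simple_graph (copies n H)" unfolding copies_eq by (rule simple_copies_on[OF simple]) simp
  moreover have "verts (copies n H) \<noteq> {}" using nonempty n1 by (simp add: copies_def lessThan_empty_iff)
  ultimately obtain c0 :: "nat set \<Rightarrow> colour" where c0: "\<not> has_mono_copy c0 {..<N} (copies n H)"
    unfolding N_def by (rule critical_colouring)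
  have "n * tie_size \<le> card {..<N} + 2" using ramsey_number_lower[of n] by (simp add: N_def)
  from core_structure[OF finite_lessThan c0 this n']
  obtain x y and c1 :: "nat set \<Rightarrow> colour" and R1 B1 E1 where
    xy: "x \<noteq> y" and s1: "structured c1 x y R1 B1 E1"
    and f1: "\<not> has_mono_copy c1 (R1 \<union> B1 \<union> E1) (copies n H)" and N1: "card (R1 \<union> B1 \<union> E1) = card {..<N}"
    and e1: "card E1 < n" "card E1 \<le> rest_bound"
    and r1: "\<alpha> * n + card (verts H) * rest_bound + 2 * card (verts H) + 2 * \<Delta> + 1 + card (verts H) * card E1 \<le> card R1"
    and b1: "card (verts H) * rest_bound + 2 * card (verts H) + 2 * \<Delta> + 1 + card (verts H) * card E1 \<le> card B1" by blast
  from eliminate_ties[OF xy s1 f1 e1 r1 b1]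
  obtain c2 :: "nat set \<Rightarrow> colour" and R2 B2 E2 where
    s2: "structured c2 x y R2 B2 E2" and f2: "\<not> has_mono_copy c2 (R2 \<union> B2 \<union> E2) (copies n H)"
    and N2: "card (R2 \<union> B2 \<union> E2) = N"
    and rb2: "2 * card (verts H) + card (verts H) * card E2 \<le> card R2"
      "2 * card (verts H) + card (verts H) * card E2 \<le> card B2"
    and t2: "\<not> (\<exists>T. is_tie c2 (R2 \<union> B2 \<union> E2) H T \<and> T \<inter> E2 \<noteq> {})" unfolding N1 card_lessThan by blast
  have "card E2 \<le> ramsey_number H"
    using rb2 by (intro tie_free_E_small[OF xy s2 _ _ t2]) linarith+
  moreover obtain c :: "nat set \<Rightarrow> colour" and R B E where st: "structured c x y R B E" and V: "R \<union> B \<union> E = {..<N}"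
    and card: "card R = card R2" "card B = card B2" "card E = card E2"
    and free: "\<not> has_mono_copy c {..<N} (copies n H)" and tie: "\<not> (\<exists>T. is_tie c {..<N} H T \<and> T \<inter> E \<noteq> {})"
    using relabel_structure[OF s2 N2 f2 t2] by (elim exE conjE) (rule that)
  ultimately have E: "card E \<le> ramsey_number H" by simp
  have RB: "k * (card E + 1) \<le> card R" "k * (card E + 1) \<le> card B"
    using rb2 card k(1) by (simp_all add: algebra_simps)
  note S = structuredD[OF st]
  have nsets: "\<forall>e\<in>nsets A 2. c e = z" if "\<And>u v. u \<in> A \<Longrightarrow> v \<in> A \<Longrightarrow> u \<noteq> v \<Longrightarrow> c {u, v} = z" for A z
    using that by (auto simp: nsets_2_eq)
  have "\<exists>R B. R \<union> B \<union> E = {..<N} \<and> R \<inter> B = {} \<and> R \<inter> E = {} \<and> B \<inter> E = {}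
           \<and> k * (card E + 1) \<le> card R \<and> k * (card E + 1) \<le> card B
           \<and> (\<forall>e \<in> nsets R 2. c e = Red) \<and> (\<forall>e \<in> nsets B 2. c e = Blue)
           \<and> (\<exists>x. \<forall>u\<in>R. \<forall>v\<in>B. c {u, v} = x)
           \<and> (\<forall>u\<in>R. \<forall>v\<in>E. c {u, v} = Blue) \<and> (\<forall>u\<in>B. \<forall>v\<in>E. c {u, v} = Red)"
  \<comment> \<open>If \<open>x\<close> is blue, the two cliques exchange their names: the blue one
    is joined to \<open>E\<close> in red, as the theorem asks of its second set.\<close>
  proof (cases x)
    case Red
    then have y: "y = Blue" using xy by (cases y) auto
    have "\<forall>e\<in>nsets R 2. c e = Red" "\<forall>e\<in>nsets B 2. c e = Blue"
      using S(7,8) Red y by (auto intro!: nsets)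
    moreover have "\<exists>x. \<forall>u\<in>R. \<forall>v\<in>B. c {u, v} = x" "\<forall>u\<in>R. \<forall>v\<in>E. c {u, v} = Blue" "\<forall>u\<in>B. \<forall>v\<in>E. c {u, v} = Red"
      using S(9-11) Red y by auto
    ultimately show ?thesis
      using V S(4-6) RB by - (rule exI[of _ R], rule exI[of _ B], intro conjI, assumption+)
  next
    case Blue
    then have y: "y = Red" using xy by (cases y) auto
    have "\<forall>e\<in>nsets B 2. c e = Red" "\<forall>e\<in>nsets R 2. c e = Blue"
      using S(7,8) Blue y by (auto intro!: nsets)
    moreover have "\<exists>x. \<forall>u\<in>B. \<forall>v\<in>R. c {u, v} = x" "\<forall>u\<in>B. \<forall>v\<in>E. c {u, v} = Blue" "\<forall>u\<in>R. \<forall>v\<in>E. c {u, v} = Red"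
      using S(9-11) Blue y by auto
    moreover have "B \<union> R \<union> E = {..<N}" "B \<inter> R = {}" using V S(4) by auto
    ultimately show ?thesis
      using S(5,6) RB by - (rule exI[of _ B], rule exI[of _ R], intro conjI, assumption+)
  qed
  then show "\<exists>(V :: nat set) (c :: nat set \<Rightarrow> colour) R B E.
           V = {..<ramsey_number (copies n H) - 1}
           \<and> \<not> has_mono_copy c V (copies n H)
           \<and> R \<union> B \<union> E = V \<and> R \<inter> B = {} \<and> R \<inter> E = {} \<and> B \<inter> E = {}
           \<and> card E \<le> ramsey_number H
           \<and> card R \<ge> k * (card E + 1) \<and> card B \<ge> k * (card E + 1)
           \<and> (\<forall>e \<in> nsets R 2. c e = Red) \<and> (\<forall>e \<in> nsets B 2. c e = Blue)
           \<and> (\<exists>x. \<forall>u\<in>R. \<forall>v\<in>B. c {u, v} = x)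
           \<and> (\<forall>u\<in>R. \<forall>v\<in>E. c {u, v} = Blue)
           \<and> (\<forall>u\<in>B. \<forall>v\<in>E. c {u, v} = Red)
           \<and> \<not> (\<exists>T. is_tie c V H T \<and> T \<inter> E \<noteq> {})"
    using free tie E unfolding N_def by blast
qed simp

end
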